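(* Let $u:[0,1]\to\mathbb{R}$ be piecewise continuous, antisymmetric, i.e. $u(t)=-u(1-t)$ for all $t\in[0,1]$, and such that $u(t)<0$ for $t\in[0,1/2)$. Let $0<\lambda_1<\lambda_2$, and let $p_{*,1}$ and $p_{*,2}$ be the optimal solutions of Problem $(P_{\lambda_1})$ and Problem $(P_{\lambda_2})$, respectively (uniform prior on $[0,1]$). Then $$p_{*,1}(0)<p_{*,2}(0)<\tfrac12<p_{*,2}(1)<p_{*,1}(1)\quad\text{and}\quad 0<p_{*,2}'(\tfrac12)<p_{*,1}'(\tfrac12).$$ Moreover, $$p_{*,1}(t)<p_{*,2}(t)<\tfrac12\ \text{ for } t\in[0,\tfrac12),\qquad \tfrac12<p_{*,2}(t)<p_{*,1}(t)\ \text{ for } t\in(\tfrac12,1].$$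
   Context: Piecewise continuous: $u:[0,1]\to\mathbb{R}$ is piecewise continuous if there are $0=t_0<t_1<\dots<t_N=1$ such that $u$ is continuous on each $(t_i,t_{i+1})$, $i=0,\dots,N-1$, the left limits of $u$ exist and are finite at $t_1,\dots,t_N$, and the right limits exist and are finite at $t_0,\dots,t_{N-1}$. Problem $(P_\lambda)$, for $\lambda>0$ (state space $[0,1]$, uniform prior): minimize over absolutely continuous $p:[0,1]\to[0,1]$ the functional $$\int_0^1 \left(\lambda\,\frac{(p'(t))^2}{p(t)(1-p(t))}-u(t)p(t)\right)dt,$$ where the quotient is taken to be $0$ if $p(t)\in\{0,1\}$ and $p'(t)=0$, and $+\infty$ if $p(t)\in\{0,1\}$ and $p'(t)\neq0$. An optimal solution is a $p_*$ attaining the minimum with finite value. *)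

theory Defs
  imports "HOL-Analysis.Analysis"
begin

text \<open>
  Functions on \<open>[0,1]\<close> are represented by total functions on the reals; no definition below
  depends on their values outside \<open>[0,1]\<close>.
\<close>

definition piecewise_continuous :: "(real \<Rightarrow> real) \<Rightarrow> bool" where
  "piecewise_continuous u \<longleftrightarrow>
    (\<exists>(N::nat) (s::nat \<Rightarrow> real). s 0 = 0 \<and> s N = 1 \<and> (\<forall>i<N. s i < s (Suc i)) \<and>
      (\<forall>i<N. continuous_on {s i<..<s (Suc i)} u) \<and>
      (\<forall>i\<in>{1..N}. \<exists>l. (u \<longlongrightarrow> l) (at_left (s i))) \<and>
      (\<forall>i<N. \<exists>l. (u \<longlongrightarrow> l) (at_right (s i))))"

text \<open>
  The usual \<open>\<epsilon>\<close>-\<open>\<delta>\<close> notion; a finite system of non-overlapping intervals is given by the set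
  of its endpoint pairs. Degenerate pairs with \<open>a = b\<close> are harmless.
\<close>

definition absolutely_continuous_on :: "real set \<Rightarrow> (real \<Rightarrow> real) \<Rightarrow> bool" where
  "absolutely_continuous_on S f \<longleftrightarrow>
    (\<forall>\<epsilon>>0. \<exists>\<delta>>0. \<forall>D. finite D \<and> (\<forall>(a, b)\<in>D. a \<le> b \<and> {a..b} \<subseteq> S) \<and>
        disjoint_family_on (\<lambda>(a, b). {a<..<b}) D \<and> (\<Sum>(a, b)\<in>D. b - a) < \<delta> \<longrightarrow>
      (\<Sum>(a, b)\<in>D. \<bar>f b - f a\<bar>) < \<epsilon>)"

text \<open>
  Lebesgue integral of an extended real function as integral of the positive part minus integral
  of the negative part; \<open>e2ennreal\<close> sends negative arguments to \<open>0\<close>.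
\<close>

definition ereal_integral :: "'a measure \<Rightarrow> ('a \<Rightarrow> ereal) \<Rightarrow> ereal" where
  "ereal_integral M f =
    enn2ereal (\<integral>\<^sup>+ x. e2ennreal (f x) \<partial>M) - enn2ereal (\<integral>\<^sup>+ x. e2ennreal (- f x) \<partial>M)"

text \<open>The quotient \<open>v\<^sup>2 / (x (1 - x))\<close> with its boundary convention, at \<open>x = p t\<close>, \<open>v = p' t\<close>.\<close>

definition running_cost :: "real \<Rightarrow> real \<Rightarrow> ereal" where
  "running_cost x v =
    (if x \<in> {0, 1} then (if v = 0 then 0 else \<infinity>) else ereal (v\<^sup>2 / (x * (1 - x))))"

text \<open>
  An absolutely continuous \<open>p\<close> is differentiable almost everywhere, so the arbitrary value of
  \<open>deriv\<close> at other points does not affect the integral.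
\<close>

definition objective :: "real \<Rightarrow> (real \<Rightarrow> real) \<Rightarrow> (real \<Rightarrow> real) \<Rightarrow> ereal" where
  "objective lam u p = ereal_integral (lebesgue_on {0..1})
    (\<lambda>t. ereal lam * running_cost (p t) (deriv p t) - ereal (u t * p t))"

definition feasible :: "(real \<Rightarrow> real) \<Rightarrow> bool" where
  "feasible p \<longleftrightarrow> absolutely_continuous_on {0..1} p \<and> p ` {0..1} \<subseteq> {0..1}"

definition optimal_solution :: "real \<Rightarrow> (real \<Rightarrow> real) \<Rightarrow> (real \<Rightarrow> real) \<Rightarrow> bool" where
  "optimal_solution lam u p \<longleftrightarrow>
    feasible p \<and> \<bar>objective lam u p\<bar> \<noteq> \<infinity> \<and>
    (\<forall>q. feasible q \<longrightarrow> objective lam u p \<le> objective lam u q)"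

end

theory Submission
  imports Defs
begin

text \<open>
  The substitution \<open>p = (1 + sin \<phi>) / 2\<close> turns the functional into \<open>\<integral> \<lambda> \<phi>'\<^sup>2 - u (1 + sin \<phi>) / 2\<close>, now
  without constraint on \<open>\<phi>\<close>. A minimizer satisfies \<open>\<phi>'' = - u cos \<phi> / (4 \<lambda>)\<close> with
  \<open>\<phi>' 0 = \<phi>' 1 = 0\<close>, which makes \<open>\<phi>\<close> nondecreasing; passing to the odd part of \<open>\<phi>\<close> about \<open>1/2\<close> then
  decreases the functional, so \<open>\<phi>\<close> is odd. For two minimizers with \<open>\<lambda>\<^sub>1 < \<lambda>\<^sub>2\<close> the difference
  \<open>\<phi>\<^sub>1 - \<phi>\<^sub>2\<close> is strictly convex on \<open>[0, 1/2]\<close> wherever it is nonnegative, and a maximum principle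
  gives the strict ordering. That an absolutely continuous function is differentiable almost
  everywhere and is the integral of its derivative is obtained from its variation function and the
  Radon-Nikodym theorem.
\<close>

section \<open>Absolutely continuous functions\<close>

text \<open>In the variable p the cost is singular where p reaches 0 or 1, and admissible variations
  are one-sided there. In the angle the energy is quadratic in the velocity, and (1 + sin \<phi>) /
  2 lies in [0, 1] for every real \<phi>, so all pairs (initial value, square-integrable velocity)
  compete and two-sided linear variations are allowed. Minimality transfers through an equality at
  the optimal p and an inequality at the competitors.

  Since u changes sign at 1/2, the sign that makes the difference of the angles convex is used on
  the left half. Oddness makes this half enough: it pins both angles to 0 at 1/2, while the free end
  gives slope 0 at the left. Monotonicity enters oddness through signs: with d and m the odd and
  even parts, u sin d is nonnegative, so replacing cos m by 1 in u sin d cos m can only help.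
  Strictness rests on two exclusions: the angle is not stuck at -\<pi>/2, where cos \<phi> and hence
  the force vanish, and d is not identically 0, because a small linear odd angle has negative
  action.\<close>

lemma sum_length_disjoint_le_measure:
  fixes a b :: "'i \<Rightarrow> real"
  assumes "finite I" and le: "\<And>i. i \<in> I \<Longrightarrow> a i \<le> b i"
    and sub: "\<And>i. i \<in> I \<Longrightarrow> {a i<..<b i} \<subseteq> U"
    and disj: "disjoint_family_on (\<lambda>i. {a i<..<b i}) I" and U: "U \<in> lmeasurable"
  shows "(\<Sum>i\<in>I. b i - a i) \<le> measure lebesgue U"
proof -
  have "(\<Sum>i\<in>I. b i - a i) = (\<Sum>i\<in>I. measure lebesgue {a i<..<b i})"
    using le by (intro sum.cong) auto
  also have "\<dots> = measure lebesgue (\<Union>i\<in>I. {a i<..<b i})"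
  proof (intro measure_UNION' [symmetric] \<open>finite I\<close>)
    show "pairwise (\<lambda>i j. disjnt {a i<..<b i} {a j<..<b j}) I"
      using disj unfolding disjoint_family_on_def pairwise_def disjnt_def by blast
  qed auto
  also have "\<dots> \<le> measure lebesgue U"
    using sub U \<open>finite I\<close> by (intro measure_mono_fmeasurable) auto
  finally show ?thesis .
qed

text \<open>Two equal nondegenerate pairs with different indices would give intersecting intervals,
  as both contain the midpoint. Hence passing from indices to endpoint pairs merges no nondegenerate
  intervals.\<close>

lemma disjoint_nondegenerate_inj_on:
  fixes a b :: "'i \<Rightarrow> real"
  assumes "disjoint_family_on (\<lambda>i. {a i<..<b i}) I"
  shows "inj_on (\<lambda>i. (a i, b i)) {i\<in>I. a i < b i}"
proof (rule inj_onI, rule ccontr)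
  fix i j assume ij: "i \<in> {i\<in>I. a i < b i}" "j \<in> {i\<in>I. a i < b i}" "(a i, b i) = (a j, b j)" "i \<noteq> j"
  then have "{a i<..<b i} \<inter> {a j<..<b j} = {}"
    using assms unfolding disjoint_family_on_def by blast
  moreover have "(a i + b i) / 2 \<in> {a i<..<b i}"
    using ij by (auto simp: field_simps)
  ultimately show False
    using ij(3) by auto
qed

definition interval_system :: "real set \<Rightarrow> (real \<times> real) set \<Rightarrow> bool" where
  "interval_system S D \<longleftrightarrow> finite D \<and> (\<forall>(a, b)\<in>D. a \<le> b \<and> {a..b} \<subseteq> S) \<and>
    disjoint_family_on (\<lambda>(a, b). {a<..<b}) D"

text \<open>Absolute continuity speaks of a set of pairs, while the constructions below produce
  indexed families. Degenerate intervals may repeat and are dropped; the condition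
  \<open>h t t = 0\<close> says that they contribute nothing. One \<open>D\<close> serves every
  \<open>h\<close>, so lengths and oscillations are transferred together.\<close>

lemma interval_system_of_family:
  fixes a b :: "'i \<Rightarrow> real"
  assumes "finite I" and le: "\<And>i. i \<in> I \<Longrightarrow> a i \<le> b i \<and> {a i..b i} \<subseteq> S"
    and disj: "disjoint_family_on (\<lambda>i. {a i<..<b i}) I"
  obtains D where "interval_system S D"
    "\<And>h :: real \<Rightarrow> real \<Rightarrow> real. (\<And>t. h t t = 0) \<Longrightarrow> (\<Sum>i\<in>I. h (a i) (b i)) = (\<Sum>(x, y)\<in>D. h x y)"
proof
  let ?J = "{i\<in>I. a i < b i}"
  let ?D = "(\<lambda>i. (a i, b i)) ` ?J"
  show "interval_system S ?D"
    unfolding interval_system_def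
    using \<open>finite I\<close> le disj by (fastforce simp: disjoint_family_on_def)
  show "(\<Sum>i\<in>I. h (a i) (b i)) = (\<Sum>(x, y)\<in>?D. h x y)" if h: "\<And>t. h t t = 0" for h :: "real \<Rightarrow> real \<Rightarrow> real"
  proof -
    have "(\<Sum>i\<in>I. h (a i) (b i)) = (\<Sum>i\<in>?J. h (a i) (b i))"
      using \<open>finite I\<close> le h
      by (intro sum.mono_neutral_right) (auto, metis order_le_less)
    also have "\<dots> = (\<Sum>(x, y)\<in>?D. h x y)"
      using disjoint_nondegenerate_inj_on[OF disj] by (subst sum.reindex) auto
    finally show ?thesis .
  qed
qed

lemma absolutely_continuous_on_iff:
  "absolutely_continuous_on S f \<longleftrightarrow> (\<forall>\<epsilon>>0. \<exists>\<delta>>0. \<forall>D. interval_system S D \<and> (\<Sum>(a, b)\<in>D. b - a) < \<delta> \<longrightarrow>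
      (\<Sum>(a, b)\<in>D. \<bar>f b - f a\<bar>) < \<epsilon>)"
  unfolding absolutely_continuous_on_def interval_system_def conj_assoc ..

lemma absolutely_continuous_on_family:
  fixes f :: "real \<Rightarrow> real"
  assumes "absolutely_continuous_on S f" "0 < \<epsilon>"
  obtains \<delta> where "0 < \<delta>"
    "\<And>(I :: 'i set) a b. finite I \<Longrightarrow> (\<And>i. i \<in> I \<Longrightarrow> a i \<le> b i \<and> {a i..b i} \<subseteq> S) \<Longrightarrow>
       disjoint_family_on (\<lambda>i. {a i<..<b i}) I \<Longrightarrow> (\<Sum>i\<in>I. b i - a i) < \<delta> \<Longrightarrow>
       (\<Sum>i\<in>I. \<bar>f (b i) - f (a i)\<bar>) < \<epsilon>"
proof -
  obtain \<delta> where "0 < \<delta>" and \<delta>: "\<And>D. interval_system S D \<Longrightarrow> (\<Sum>(a, b)\<in>D. b - a) < \<delta> \<Longrightarrow>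
      (\<Sum>(a, b)\<in>D. \<bar>f b - f a\<bar>) < \<epsilon>"
    using assms unfolding absolutely_continuous_on_iff by blast
  show thesis
  proof (rule that[OF \<open>0 < \<delta>\<close>])
    fix I :: "'i set" and a b
    assume *: "finite I" "\<And>i. i \<in> I \<Longrightarrow> a i \<le> b i \<and> {a i..b i} \<subseteq> S"
      "disjoint_family_on (\<lambda>i. {a i<..<b i}) I" and lt: "(\<Sum>i\<in>I. b i - a i) < \<delta>"
    obtain D where D: "interval_system S D"
      "\<And>h :: real \<Rightarrow> real \<Rightarrow> real. (\<And>t. h t t = 0) \<Longrightarrow> (\<Sum>i\<in>I. h (a i) (b i)) = (\<Sum>(x, y)\<in>D. h x y)"
      by (rule interval_system_of_family[of I a b S]) (use * in auto)
    show "(\<Sum>i\<in>I. \<bar>f (b i) - f (a i)\<bar>) < \<epsilon>"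
      using \<delta>[OF D(1)] lt D(2)[of "\<lambda>x y. y - x"] D(2)[of "\<lambda>x y. \<bar>f y - f x\<bar>"] by simp
  qed
qed

lemma absolutely_continuous_onI:
  assumes "\<And>\<epsilon>. 0 < \<epsilon> \<Longrightarrow> \<exists>\<delta>>0. \<forall>D. interval_system S D \<longrightarrow> (\<Sum>(a, b)\<in>D. b - a) < \<delta> \<longrightarrow>
      (\<Sum>(a, b)\<in>D. \<bar>f b - f a\<bar>) < \<epsilon>"
  shows "absolutely_continuous_on S f"
  unfolding absolutely_continuous_on_iff using assms by meson

lemma absolutely_continuous_onD:
  assumes "absolutely_continuous_on S f" "0 < \<epsilon>"
  obtains \<delta> where "0 < \<delta>" "\<And>D. interval_system S D \<Longrightarrow> (\<Sum>(a, b)\<in>D. b - a) < \<delta> \<Longrightarrow>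
      (\<Sum>(a, b)\<in>D. \<bar>f b - f a\<bar>) < \<epsilon>"
  using assms unfolding absolutely_continuous_on_iff by blast

lemma absolutely_continuous_on_imp_continuous_on:
  assumes "absolutely_continuous_on {c..d} f"
  shows "continuous_on {c..d} f"
  unfolding continuous_on_iff
proof (intro ballI allI impI)
  fix x \<epsilon> :: real assume x: "x \<in> {c..d}" and "0 < \<epsilon>"
  obtain \<delta> where "0 < \<delta>" and \<delta>: "\<And>D. interval_system {c..d} D \<Longrightarrow> (\<Sum>(a, b)\<in>D. b - a) < \<delta> \<Longrightarrow>
      (\<Sum>(a, b)\<in>D. \<bar>f b - f a\<bar>) < \<epsilon>"
    using absolutely_continuous_onD[OF assms \<open>0 < \<epsilon>\<close>] by blast
  have "dist (f y) (f x) < \<epsilon>" if y: "y \<in> {c..d}" "dist y x < \<delta>" for y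
    using \<delta>[of "{(min x y, max x y)}"] x y
    by (cases "x \<le> y") (auto simp: interval_system_def disjoint_family_on_def dist_real_def min_def max_def abs_if split: if_splits)
  then show "\<exists>\<delta>>0. \<forall>y\<in>{c..d}. dist y x < \<delta> \<longrightarrow> dist (f y) (f x) < \<epsilon>"
    using \<open>0 < \<delta>\<close> by blast
qed

text \<open>This is composition with a Lipschitz map, put in terms of increments on
  \<open>S\<close>; it serves both \<open>(1 + sin \<phi>) / 2\<close> and \<open>arcsin\<close> on
  an interval inside (-1, 1). Dividing by \<open>C + 1\<close> covers C = 0.\<close>

lemma absolutely_continuous_on_bounded_by:
  assumes f: "absolutely_continuous_on S f" and "0 \<le> C"
    and g: "\<And>x y. x \<in> S \<Longrightarrow> y \<in> S \<Longrightarrow> \<bar>g y - g x\<bar> \<le> C * \<bar>f y - f x\<bar>"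
  shows "absolutely_continuous_on S g"
proof (rule absolutely_continuous_onI)
  fix \<epsilon> :: real assume "0 < \<epsilon>"
  then have "0 < \<epsilon> / (C + 1)" using \<open>0 \<le> C\<close> by simp
  then obtain \<delta> where "0 < \<delta>" and \<delta>: "\<And>D. interval_system S D \<Longrightarrow> (\<Sum>(a, b)\<in>D. b - a) < \<delta> \<Longrightarrow>
      (\<Sum>(a, b)\<in>D. \<bar>f b - f a\<bar>) < \<epsilon> / (C + 1)"
    using absolutely_continuous_onD[OF f] by blast
  have "(\<Sum>(a, b)\<in>D. \<bar>g b - g a\<bar>) < \<epsilon>" if D: "interval_system S D" "(\<Sum>(a, b)\<in>D. b - a) < \<delta>" for D
  proof -
    have "(\<Sum>(a, b)\<in>D. \<bar>g b - g a\<bar>) \<le> (\<Sum>(a, b)\<in>D. C * \<bar>f b - f a\<bar>)"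
    proof (intro sum_mono)
      fix e assume "e \<in> D"
      then have "fst e \<in> S" "snd e \<in> S"
        using D(1) by (fastforce simp: interval_system_def)+
      then show "(case e of (a, b) \<Rightarrow> \<bar>g b - g a\<bar>) \<le> (case e of (a, b) \<Rightarrow> C * \<bar>f b - f a\<bar>)"
        by (simp add: case_prod_unfold g)
    qed
    also have "\<dots> = C * (\<Sum>(a, b)\<in>D. \<bar>f b - f a\<bar>)"
      by (simp add: sum_distrib_left case_prod_unfold)
    also have "\<dots> \<le> C * (\<epsilon> / (C + 1))"
      using \<delta>[OF D] \<open>0 \<le> C\<close> by (intro mult_left_mono) auto
    also have "\<dots> < \<epsilon>"
      using \<open>0 < \<epsilon>\<close> \<open>0 \<le> C\<close> by (simp add: field_simps)
    finally show ?thesis .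
  qed
  then show "\<exists>\<delta>>0. \<forall>D. interval_system S D \<longrightarrow> (\<Sum>(a, b)\<in>D. b - a) < \<delta> \<longrightarrow>
      (\<Sum>(a, b)\<in>D. \<bar>g b - g a\<bar>) < \<epsilon>"
    using \<open>0 < \<delta>\<close> by blast
qed

lemma absolutely_continuous_on_diff:
  assumes f: "absolutely_continuous_on S f" and g: "absolutely_continuous_on S g"
  shows "absolutely_continuous_on S (\<lambda>x. f x - g x)"
proof (rule absolutely_continuous_onI)
  fix \<epsilon> :: real assume "0 < \<epsilon>"
  then have "0 < \<epsilon> / 2" by simp
  obtain \<delta>1 where 1: "0 < \<delta>1" "\<And>D. interval_system S D \<Longrightarrow> (\<Sum>(a, b)\<in>D. b - a) < \<delta>1 \<Longrightarrow>
      (\<Sum>(a, b)\<in>D. \<bar>f b - f a\<bar>) < \<epsilon> / 2"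
    using absolutely_continuous_onD[OF f \<open>0 < \<epsilon> / 2\<close>] by blast
  obtain \<delta>2 where 2: "0 < \<delta>2" "\<And>D. interval_system S D \<Longrightarrow> (\<Sum>(a, b)\<in>D. b - a) < \<delta>2 \<Longrightarrow>
      (\<Sum>(a, b)\<in>D. \<bar>g b - g a\<bar>) < \<epsilon> / 2"
    using absolutely_continuous_onD[OF g \<open>0 < \<epsilon> / 2\<close>] by blast
  have "(\<Sum>(a, b)\<in>D. \<bar>(f b - g b) - (f a - g a)\<bar>) < \<epsilon>"
    if D: "interval_system S D" "(\<Sum>(a, b)\<in>D. b - a) < min \<delta>1 \<delta>2" for D
  proof -
    have "(\<Sum>(a, b)\<in>D. \<bar>(f b - g b) - (f a - g a)\<bar>) \<le> (\<Sum>(a, b)\<in>D. \<bar>f b - f a\<bar> + \<bar>g b - g a\<bar>)"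
      by (intro sum_mono) auto
    also have "\<dots> = (\<Sum>(a, b)\<in>D. \<bar>f b - f a\<bar>) + (\<Sum>(a, b)\<in>D. \<bar>g b - g a\<bar>)"
      by (simp add: sum.distrib case_prod_unfold)
    also have "\<dots> < \<epsilon>"
      using 1(2)[OF D(1)] 2(2)[OF D(1)] D(2) by simp
    finally show ?thesis .
  qed
  then show "\<exists>\<delta>>0. \<forall>D. interval_system S D \<longrightarrow> (\<Sum>(a, b)\<in>D. b - a) < \<delta> \<longrightarrow>
      (\<Sum>(a, b)\<in>D. \<bar>(f b - g b) - (f a - g a)\<bar>) < \<epsilon>"
    using 1(1) 2(1) by (intro exI[of _ "min \<delta>1 \<delta>2"]) auto
qed

section \<open>Total variation of an absolutely continuous function\<close>

definition clamped_variation :: "(real \<Rightarrow> real) \<Rightarrow> (real \<times> real) set \<Rightarrow> real \<Rightarrow> real \<Rightarrow> real" where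
  "clamped_variation f D x y = (\<Sum>(a, b)\<in>D. \<bar>f (max x (min y b)) - f (max x (min y a))\<bar>)"

text \<open>This is the total variation of \<open>f\<close> on [c, x]. In
  \<open>clamped_variation\<close>, \<open>max x (min y t)\<close> is the projection of
  \<open>t\<close> to [x, y], so an interval is cut down by moving its endpoints, and one outside
  [x, y] contributes 0. The systems range over the fixed {c..d}, so the supremum has the same index
  set for all \<open>x\<close>.\<close>

definition variation_upto :: "(real \<Rightarrow> real) \<Rightarrow> real \<Rightarrow> real \<Rightarrow> real \<Rightarrow> real" where
  "variation_upto f c d x = (SUP D\<in>{D. interval_system {c..d} D}. clamped_variation f D c x)"

text \<open>Composed with \<open>f\<close>, the projection to [x, z] is the sum of the projections
  to [x, y] and [y, z] minus the constant \<open>f y\<close>; the triangle inequality does the rest,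
  and \<open>D\<close> is not refined at \<open>y\<close>.\<close>

lemma clamped_variation_split:
  assumes "x \<le> y" "y \<le> z"
  shows "clamped_variation f D x z \<le> clamped_variation f D x y + clamped_variation f D y z"
proof -
  have *: "f (max x (min z t)) = f (max x (min y t)) + f (max y (min z t)) - f y" for t
    using assms by (cases "t \<le> y") (auto simp: max_def min_def)
  have tri: "\<bar>(p + q - r) - (p' + q' - r)\<bar> \<le> \<bar>p - p'\<bar> + \<bar>q - q'\<bar>" for p q r p' q' :: real
    by arith
  have "clamped_variation f D x z \<le> (\<Sum>e\<in>D. (case e of (a, b) \<Rightarrow> \<bar>f (max x (min y b)) - f (max x (min y a))\<bar>) +
      (case e of (a, b) \<Rightarrow> \<bar>f (max y (min z b)) - f (max y (min z a))\<bar>))"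
    unfolding clamped_variation_def by (intro sum_mono) (simp only: * case_prod_unfold tri)
  then show ?thesis
    by (simp add: clamped_variation_def sum.distrib)
qed

text \<open>The members of all \<open>D i\<close>, cut down to [x i, y i], form a single disjoint
  family of total length at most the sum of \<open>y i - x i\<close>, so the \<open>\<delta>\<close>
  of \<open>f\<close> itself works. A separate system may be chosen for each \<open>i\<close>: this
  uniformity gives both finite variation and absolute continuity of the variation function.\<close>

lemma clamped_variation_family_small:
  fixes f :: "real \<Rightarrow> real"
  assumes "absolutely_continuous_on {c..d} f" "0 < \<epsilon>"
  obtains \<delta> where "0 < \<delta>"
    "\<And>(I :: 'i set) x y D. finite I \<Longrightarrow> (\<And>i. i \<in> I \<Longrightarrow> x i \<le> y i \<and> {x i..y i} \<subseteq> {c..d}) \<Longrightarrow>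
       disjoint_family_on (\<lambda>i. {x i<..<y i}) I \<Longrightarrow> (\<Sum>i\<in>I. y i - x i) < \<delta> \<Longrightarrow>
       (\<And>i. i \<in> I \<Longrightarrow> interval_system {c..d} (D i)) \<Longrightarrow>
       (\<Sum>i\<in>I. clamped_variation f (D i) (x i) (y i)) < \<epsilon>"
proof -
  obtain \<delta> where "0 < \<delta>" and \<delta>:
    "\<And>(I :: ('i \<times> real \<times> real) set) a b. finite I \<Longrightarrow> (\<And>i. i \<in> I \<Longrightarrow> a i \<le> b i \<and> {a i..b i} \<subseteq> {c..d}) \<Longrightarrow>
       disjoint_family_on (\<lambda>i. {a i<..<b i}) I \<Longrightarrow> (\<Sum>i\<in>I. b i - a i) < \<delta> \<Longrightarrow>
       (\<Sum>i\<in>I. \<bar>f (b i) - f (a i)\<bar>) < \<epsilon>"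
    using absolutely_continuous_on_family[OF assms] by blast
  show thesis
  proof (rule that[OF \<open>0 < \<delta>\<close>])
    fix I :: "'i set" and x y D
    assume I: "finite I" "\<And>i. i \<in> I \<Longrightarrow> x i \<le> y i \<and> {x i..y i} \<subseteq> {c..d}"
      and disj: "disjoint_family_on (\<lambda>i. {x i<..<y i}) I" and small: "(\<Sum>i\<in>I. y i - x i) < \<delta>"
      and D: "\<And>i. i \<in> I \<Longrightarrow> interval_system {c..d} (D i)"
    \<comment> \<open>Endpoints of the member (s, t) of \<open>D i\<close> after projection to
      [x i, y i]. The index keeps \<open>i\<close>, so equal pairs from different systems stay
      apart.\<close>
    define a where "a = (\<lambda>(i, s, t :: real). max (x i) (min (y i) s))"
    define b where "b = (\<lambda>(i, s :: real, t). max (x i) (min (y i) t))"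
    let ?I = "Sigma I D"
    have finD: "finite (D i)" if "i \<in> I" for i
      using D[OF that] by (simp add: interval_system_def)
    have Dle: "s \<le> t" if "i \<in> I" "(s, t) \<in> D i" for i s t
      using D[OF that(1)] that(2) by (auto simp: interval_system_def)
    have le: "a e \<le> b e \<and> {a e..b e} \<subseteq> {c..d}" if e: "e \<in> ?I" for e
    proof -
      obtain i s t where [simp]: "e = (i, s, t)" by (cases e)
      have "i \<in> I" "(s, t) \<in> D i" using e by auto
      then have "s \<le> t" "x i \<le> y i" "c \<le> x i" "y i \<le> d"
        using Dle I(2)[of i] by auto
      then show ?thesis
        by (auto simp: a_def b_def)
    qed
    have sub: "{a (i, s, t)<..<b (i, s, t)} \<subseteq> {x i<..<y i} \<inter> {s<..<t}" for i s t
      by (auto simp: a_def b_def)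
    have disjD: "{s<..<t} \<inter> {s'<..<t'} = {}" if "i \<in> I" "(s, t) \<in> D i" "(s', t') \<in> D i" "(s, t) \<noteq> (s', t')" for i s t s' t'
    proof -
      have "disjoint_family_on (\<lambda>(s, t). {s<..<t}) (D i)"
        using D[OF that(1)] by (simp add: interval_system_def)
      from disjoint_family_onD[OF this that(2,3,4)] show ?thesis
        unfolding prod.case .
    qed
    have disj': "disjoint_family_on (\<lambda>e. {a e<..<b e}) ?I"
      unfolding disjoint_family_on_def
    proof (intro ballI impI)
      fix e e' assume e: "e \<in> ?I" "e' \<in> ?I" "e \<noteq> e'"
      obtain i s t i' s' t' where [simp]: "e = (i, s, t)" "e' = (i', s', t')" by (cases e; cases e')
      show "{a e<..<b e} \<inter> {a e'<..<b e'} = {}"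
      proof (cases "i = i'")
        case True
        then have "{s<..<t} \<inter> {s'<..<t'} = {}"
          using e by (intro disjD[of i]) auto
        then show ?thesis
          using sub[of i s t] sub[of i' s' t'] by fastforce
      next
        case False
        then have "{x i<..<y i} \<inter> {x i'<..<y i'} = {}"
          using e by (intro disjoint_family_onD[OF disj]) auto
        then show ?thesis
          using sub[of i s t] sub[of i' s' t'] by fastforce
      qed
    qed
    have "(\<Sum>e\<in>?I. b e - a e) = (\<Sum>i\<in>I. \<Sum>p\<in>D i. b (i, p) - a (i, p))"
      using I(1) finD by (subst sum.Sigma) (auto simp: case_prod_unfold)
    also have "\<dots> \<le> (\<Sum>i\<in>I. y i - x i)"
    proof (rule sum_mono)
      fix i assume i: "i \<in> I"
      have "(\<Sum>p\<in>D i. b (i, p) - a (i, p)) \<le> measure lebesgue {x i<..<y i}"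
      proof (rule sum_length_disjoint_le_measure)
        show "finite (D i)" using finD i .
        show "a (i, p) \<le> b (i, p)" if "p \<in> D i" for p
          using le[of "(i, p)"] i that by auto
        show "{a (i, p)<..<b (i, p)} \<subseteq> {x i<..<y i}" for p
          using sub[of i "fst p" "snd p"] by auto
        show "disjoint_family_on (\<lambda>p. {a (i, p)<..<b (i, p)}) (D i)"
          using disj' i unfolding disjoint_family_on_def by fast
      qed auto
      then show "(\<Sum>p\<in>D i. b (i, p) - a (i, p)) \<le> y i - x i"
        using I(2)[OF i] by simp
    qed
    finally have "(\<Sum>e\<in>?I. \<bar>f (b e) - f (a e)\<bar>) < \<epsilon>"
      using small I(1) finD le disj' by (intro \<delta>) auto
    moreover have "(\<Sum>e\<in>?I. \<bar>f (b e) - f (a e)\<bar>) = (\<Sum>i\<in>I. clamped_variation f (D i) (x i) (y i))"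
      unfolding clamped_variation_def a_def b_def
      using I(1) finD by (subst sum.Sigma) (auto simp: case_prod_unfold)
    ultimately show "(\<Sum>i\<in>I. clamped_variation f (D i) (x i) (y i)) < \<epsilon>"
      by simp
  qed
qed

text \<open>[c, d] is exhausted by finitely many steps of length \<delta>/2, and each step
  contributes less than 1.\<close>

lemma clamped_variation_bounded:
  assumes f: "absolutely_continuous_on {c..d} f" and "c \<le> d"
  obtains B where "\<And>D x. interval_system {c..d} D \<Longrightarrow> x \<in> {c..d} \<Longrightarrow> clamped_variation f D c x \<le> B"
proof -
  obtain \<delta> where "0 < \<delta>" and \<delta>:
    "\<And>(I :: unit set) x y D. finite I \<Longrightarrow> (\<And>i. i \<in> I \<Longrightarrow> x i \<le> y i \<and> {x i..y i} \<subseteq> {c..d}) \<Longrightarrow>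
       disjoint_family_on (\<lambda>i. {x i<..<y i}) I \<Longrightarrow> (\<Sum>i\<in>I. y i - x i) < \<delta> \<Longrightarrow>
       (\<And>i. i \<in> I \<Longrightarrow> interval_system {c..d} (D i)) \<Longrightarrow>
       (\<Sum>i\<in>I. clamped_variation f (D i) (x i) (y i)) < 1"
    by (rule clamped_variation_family_small[OF f zero_less_one, where 'i=unit]) blast
  have step: "clamped_variation f D x y < 1"
    if "interval_system {c..d} D" "c \<le> x" "x \<le> y" "y \<le> d" "y - x < \<delta>" for D x y
    using \<delta>[of "{()}" "\<lambda>_. x" "\<lambda>_. y" "\<lambda>_. D"] that by (auto simp: disjoint_family_on_def)
  obtain N :: nat where "(d - c) / (\<delta> / 2) < real N"
    using reals_Archimedean2 by blast
  then have N: "d - c < N * (\<delta> / 2)"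
    using \<open>0 < \<delta>\<close> by (simp add: field_simps)
  have main: "clamped_variation f D c x \<le> real n"
    if D: "interval_system {c..d} D" and "x \<in> {c..d}" "x - c \<le> n * (\<delta> / 2)" for D x n
    using that(2,3)
  proof (induction n arbitrary: x)
    case 0
    then have "x = c" by simp
    then have "clamped_variation f D c x = 0"
      unfolding clamped_variation_def
      by (intro sum.neutral) (auto simp: max_def min_def)
    then show ?case by simp
  next
    case (Suc n)
    \<comment> \<open>One step back, stopping at \<open>c\<close>. The step is half of
      \<open>\<delta>\<close> because \<open>step\<close> asks for a length strictly below
      \<open>\<delta>\<close>.\<close>
    define y where "y = max c (x - \<delta> / 2)"
    have y: "y \<in> {c..d}" "y \<le> x" "x - y < \<delta>" "y - c \<le> n * (\<delta> / 2)"
      using Suc.prems \<open>0 < \<delta>\<close> by (auto simp: y_def algebra_simps max_def)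
    have "clamped_variation f D c x \<le> clamped_variation f D c y + clamped_variation f D y x"
      using y by (intro clamped_variation_split) auto
    also have "\<dots> \<le> real n + 1"
      using Suc.IH[of y] step[OF D, of y x] y Suc.prems by auto
    finally show ?case by simp
  qed
  show thesis
    by (rule that[of "real N"], rule main) (use N in auto)
qed

context
  fixes f :: "real \<Rightarrow> real" and c d :: real
  assumes f: "absolutely_continuous_on {c..d} f" and cd: "c \<le> d"
begin

lemma clamped_variation_le_variation_upto:
  assumes "interval_system {c..d} D" "x \<in> {c..d}"
  shows "clamped_variation f D c x \<le> variation_upto f c d x"
proof -
  obtain B where "\<And>D x. interval_system {c..d} D \<Longrightarrow> x \<in> {c..d} \<Longrightarrow> clamped_variation f D c x \<le> B"
    using clamped_variation_bounded[OF f cd] by blast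
  then show ?thesis
    unfolding variation_upto_def using assms by (intro cSUP_upper) (auto intro!: bdd_aboveI2)
qed

lemma variation_upto_le:
  assumes "\<And>D. interval_system {c..d} D \<Longrightarrow> clamped_variation f D c x \<le> B"
  shows "variation_upto f c d x \<le> B"
  unfolding variation_upto_def
proof (rule cSUP_least)
  have "interval_system {c..d} {}" by (simp add: interval_system_def disjoint_family_on_def)
  then show "{D. interval_system {c..d} D} \<noteq> {}" by blast
qed (use assms in auto)

text \<open>A system cut down to [c, x] can be enlarged by the interval [x, y]. The absolute value
  makes both \<open>variation_upto\<close> and its difference with \<open>f\<close> nondecreasing,
  as the Jordan decomposition requires.\<close>

lemma variation_upto_add_le:
  assumes "c \<le> x" "x \<le> y" "y \<le> d"
  shows "variation_upto f c d x + \<bar>f y - f x\<bar> \<le> variation_upto f c d y"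
proof -
  have "clamped_variation f D c x \<le> variation_upto f c d y - \<bar>f y - f x\<bar>" if D: "interval_system {c..d} D" for D
  proof -
    \<comment> \<open>\<open>None\<close> indexes the added interval [x, y], and
      \<open>Some p\<close> the interval \<open>p\<close> projected to [c, x].\<close>
    define a where "a = (\<lambda>e :: (real \<times> real) option. case e of None \<Rightarrow> x | Some p \<Rightarrow> max c (min x (fst p)))"
    define b where "b = (\<lambda>e :: (real \<times> real) option. case e of None \<Rightarrow> y | Some p \<Rightarrow> max c (min x (snd p)))"
    let ?I = "insert None (Some ` D)"
    have fin: "finite D" and Dle: "\<And>p. p \<in> D \<Longrightarrow> fst p \<le> snd p"
      using D by (auto simp: interval_system_def)
    have disjD: "{fst p<..<snd p} \<inter> {fst q<..<snd q} = {}" if "p \<in> D" "q \<in> D" "p \<noteq> q" for p q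
    proof -
      have "disjoint_family_on (\<lambda>(s, t). {s<..<t}) D"
        using D by (simp add: interval_system_def)
      from disjoint_family_onD[OF this that] show ?thesis
        unfolding case_prod_unfold .
    qed
    have sub: "{a (Some p)<..<b (Some p)} \<subseteq> {c<..<x} \<inter> {fst p<..<snd p}" for p
      by (auto simp: a_def b_def)
    have "disjoint_family_on (\<lambda>e. {a e<..<b e}) ?I"
      unfolding disjoint_family_on_def
    proof (intro ballI impI)
      fix e e' assume e: "e \<in> ?I" "e' \<in> ?I" "e \<noteq> e'"
      have N: "{a None<..<b None} \<inter> {a (Some p)<..<b (Some p)} = {}" for p
        using sub[of p] by (auto simp: a_def b_def)
      show "{a e<..<b e} \<inter> {a e'<..<b e'} = {}"
      proof (cases e)
        case None
        then show ?thesis using N e by (cases e') auto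
      next
        case p: (Some p)
        show ?thesis
        proof (cases e')
          case None
          then show ?thesis using N[of p] p by (simp add: Int_commute)
        next
          case q: (Some q)
          then have "{fst p<..<snd p} \<inter> {fst q<..<snd q} = {}"
            using e p by (intro disjD) auto
          then show ?thesis
            unfolding p q using sub[of p] sub[of q] by blast
        qed
      qed
    qed
    moreover have "a e \<le> b e \<and> {a e..b e} \<subseteq> {c..d}" if "e \<in> ?I" for e
      using that Dle assms by (auto simp: a_def b_def min_def max_def split: if_splits) (force dest: Dle)+
    ultimately obtain D' where D': "interval_system {c..d} D'"
      "\<And>h :: real \<Rightarrow> real \<Rightarrow> real. (\<And>t. h t t = 0) \<Longrightarrow> (\<Sum>i\<in>?I. h (a i) (b i)) = (\<Sum>(x, y)\<in>D'. h x y)"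
      using interval_system_of_family[of ?I a b "{c..d}"] fin by blast
    have "clamped_variation f D c x + \<bar>f y - f x\<bar> =
        (\<Sum>i\<in>?I. \<bar>f (max c (min y (b i))) - f (max c (min y (a i)))\<bar>)"
    proof -
      have "(\<Sum>i\<in>?I. \<bar>f (max c (min y (b i))) - f (max c (min y (a i)))\<bar>) = \<bar>f y - f x\<bar> +
        (\<Sum>p\<in>D. \<bar>f (max c (min y (b (Some p)))) - f (max c (min y (a (Some p))))\<bar>)"
      proof -
        have "max c (min y (b None)) = y" "max c (min y (a None)) = x"
          using assms by (auto simp: a_def b_def)
        then show ?thesis
          using fin by (simp add: sum.insert sum.reindex o_def)
      qed
      also have "(\<Sum>p\<in>D. \<bar>f (max c (min y (b (Some p)))) - f (max c (min y (a (Some p))))\<bar>) = clamped_variation f D c x"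
        unfolding clamped_variation_def a_def b_def case_prod_unfold option.case
      proof (intro sum.cong refl)
        fix p
        have "max c (min y (max c (min x t))) = max c (min x t)" for t
          using assms by (auto simp: max_def min_def)
        then show "\<bar>f (max c (min y (max c (min x (snd p))))) - f (max c (min y (max c (min x (fst p)))))\<bar> =
            \<bar>f (max c (min x (snd p))) - f (max c (min x (fst p)))\<bar>"
          by simp
      qed
      finally show ?thesis by simp
    qed
    also have "\<dots> = clamped_variation f D' c y"
      unfolding clamped_variation_def
      by (rule D'(2)[of "\<lambda>s t. \<bar>f (max c (min y t)) - f (max c (min y s))\<bar>"]) simp
    also have "\<dots> \<le> variation_upto f c d y"
      using D'(1) assms by (intro clamped_variation_le_variation_upto) auto
    finally show ?thesis by simp
  qed
  from variation_upto_le[OF this] show ?thesis by simp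
qed

lemma absolutely_continuous_on_variation_upto: "absolutely_continuous_on {c..d} (variation_upto f c d)"
proof (rule absolutely_continuous_onI)
  let ?V = "variation_upto f c d"
  fix \<epsilon> :: real assume "0 < \<epsilon>"
  then have "0 < \<epsilon> / 2" by simp
  obtain \<delta> where "0 < \<delta>" and \<delta>:
    "\<And>(I :: (real \<times> real) set) x y D. finite I \<Longrightarrow> (\<And>i. i \<in> I \<Longrightarrow> x i \<le> y i \<and> {x i..y i} \<subseteq> {c..d}) \<Longrightarrow>
       disjoint_family_on (\<lambda>i. {x i<..<y i}) I \<Longrightarrow> (\<Sum>i\<in>I. y i - x i) < \<delta> \<Longrightarrow>
       (\<And>i. i \<in> I \<Longrightarrow> interval_system {c..d} (D i)) \<Longrightarrow>
       (\<Sum>i\<in>I. clamped_variation f (D i) (x i) (y i)) < \<epsilon> / 2"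
    using clamped_variation_family_small[OF f \<open>0 < \<epsilon> / 2\<close>] by blast
  have "(\<Sum>(a, b)\<in>E. \<bar>?V b - ?V a\<bar>) < \<epsilon>"
    if E: "interval_system {c..d} E" and small: "(\<Sum>(a, b)\<in>E. b - a) < \<delta>" for E
  proof -
    have fin: "finite E" and le: "\<And>e. e \<in> E \<Longrightarrow> fst e \<le> snd e \<and> {fst e..snd e} \<subseteq> {c..d}"
      and disj: "disjoint_family_on (\<lambda>e. {fst e<..<snd e}) E"
      using E by (auto simp: interval_system_def case_prod_unfold)
    \<comment> \<open>The error allowed per interval, so that \<open>card E\<close> of them stay
      below \<epsilon>/2; the added 1 covers an empty \<open>E\<close>.\<close>
    define \<eta> where "\<eta> = \<epsilon> / (2 * (card E + 1))"
    have "0 < \<eta>" "card E * \<eta> < \<epsilon> / 2"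
      using \<open>0 < \<epsilon>\<close> by (auto simp: \<eta>_def field_simps)
    have "\<exists>D. interval_system {c..d} D \<and> ?V (snd e) - ?V (fst e) \<le> clamped_variation f D (fst e) (snd e) + \<eta>"
      if e: "e \<in> E" for e
    proof (rule ccontr)
      assume no: "\<nexists>D. interval_system {c..d} D \<and> ?V (snd e) - ?V (fst e) \<le> clamped_variation f D (fst e) (snd e) + \<eta>"
      have ce: "c \<le> fst e" "fst e \<le> snd e" "snd e \<le> d" using le[OF e] by auto
      \<comment> \<open>If no system were good enough, every system would stay \<open>\<eta>\<close>
        below the supremum at \<open>snd e\<close>.\<close>
      have "?V (snd e) \<le> ?V (snd e) - \<eta>"
      proof (rule variation_upto_le)
        fix D assume D: "interval_system {c..d} D"
        have "clamped_variation f D c (snd e) \<le> clamped_variation f D c (fst e) + clamped_variation f D (fst e) (snd e)"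
          using ce by (intro clamped_variation_split)
        also have "clamped_variation f D c (fst e) \<le> ?V (fst e)"
          using D ce by (intro clamped_variation_le_variation_upto) auto
        finally show "clamped_variation f D c (snd e) \<le> ?V (snd e) - \<eta>"
          using no D by force
      qed
      then show False using \<open>0 < \<eta>\<close> by simp
    qed
    then obtain D where D: "\<And>e. e \<in> E \<Longrightarrow> interval_system {c..d} (D e)"
      "\<And>e. e \<in> E \<Longrightarrow> ?V (snd e) - ?V (fst e) \<le> clamped_variation f (D e) (fst e) (snd e) + \<eta>"
      by metis
    have "(\<Sum>(a, b)\<in>E. \<bar>?V b - ?V a\<bar>) \<le> (\<Sum>e\<in>E. clamped_variation f (D e) (fst e) (snd e) + \<eta>)"
    proof (intro sum_mono)
      fix e assume e: "e \<in> E"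
      have "?V (fst e) \<le> ?V (snd e)"
        using variation_upto_add_le[of "fst e" "snd e"] le[OF e] by auto
      then show "(case e of (a, b) \<Rightarrow> \<bar>?V b - ?V a\<bar>) \<le> clamped_variation f (D e) (fst e) (snd e) + \<eta>"
        using D(2)[OF e] by (simp add: case_prod_unfold)
    qed
    also have "\<dots> = (\<Sum>e\<in>E. clamped_variation f (D e) (fst e) (snd e)) + card E * \<eta>"
      by (simp add: sum.distrib)
    also have "\<dots> < \<epsilon> / 2 + \<epsilon> / 2"
    proof (rule add_strict_mono)
      show "(\<Sum>e\<in>E. clamped_variation f (D e) (fst e) (snd e)) < \<epsilon> / 2"
        using fin le disj D(1) small by (intro \<delta>) (auto simp: case_prod_unfold)
    qed fact
    finally show ?thesis by simp
  qed
  then show "\<exists>\<delta>>0. \<forall>D. interval_system {c..d} D \<longrightarrow> (\<Sum>(a, b)\<in>D. b - a) < \<delta> \<longrightarrow>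
      (\<Sum>(a, b)\<in>D. \<bar>?V b - ?V a\<bar>) < \<epsilon>"
    using \<open>0 < \<delta>\<close> by blast
qed

end

section \<open>Integral representation and differentiability almost everywhere\<close>

lemma mono_absolutely_continuous_has_integral:
  fixes F :: "real \<Rightarrow> real"
  assumes cd: "c < d" and mono: "mono_on {c..d} F" and ac: "absolutely_continuous_on {c..d} F"
  obtains g where "\<And>x. 0 \<le> g x" "\<And>x. x \<in> {c..d} \<Longrightarrow> (g has_integral (F x - F c)) {c..x}"
proof -
  \<comment> \<open>Constant extension beyond [c, d]: \<open>G\<close> is nondecreasing and
    continuous on the line, and its Stieltjes measure gives no mass to the complement of the open
    interval.\<close>
  define G where "G = (\<lambda>x. F (max c (min d x)))"
  have mono_G: "G x \<le> G y" if "x \<le> y" for x y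
    unfolding G_def using mono_onD[OF mono, of "max c (min d x)" "max c (min d y)"] that cd
    by (auto simp: max_def min_def)
  have cont_G: "continuous_on UNIV G"
    unfolding G_def
    by (intro continuous_on_compose2[OF absolutely_continuous_on_imp_continuous_on[OF ac]] continuous_intros)
      (use cd in auto)
  have cont_r: "continuous (at_right a) G" for a
    using cont_G by (simp add: continuous_on_eq_continuous_at continuous_at_imp_continuous_at_within)
  define \<mu> where "\<mu> = interval_measure G"
  have sets_\<mu> [simp]: "sets \<mu> = sets borel"
    by (simp add: \<mu>_def)
  have Ioc: "emeasure \<mu> {a<..b} = ennreal (G b - G a)" if "a \<le> b" for a b
    unfolding \<mu>_def using that mono_G cont_r by (intro emeasure_interval_measure_Ioc)
  have Icc: "emeasure \<mu> {a..b} = ennreal (G b - G a)" if "a \<le> b" for a b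
    unfolding \<mu>_def using that mono_G cont_G by (intro emeasure_interval_measure_Icc)
  have "(\<Union>n. {c - real n..c}) \<in> null_sets \<mu>" "(\<Union>n. {d..d + real n}) \<in> null_sets \<mu>"
    using cd by (auto intro!: null_sets_UN null_setsI simp: Icc G_def max_def min_def)
  moreover have "(\<Union>n. {c - real n..c}) \<union> (\<Union>n. {d..d + real n}) = {..c} \<union> {d..}"
  proof -
    have "\<exists>n. c - x \<le> real n" "\<exists>n. x - d \<le> real n" for x
      using real_arch_simple by auto
    then show ?thesis
      by (auto simp: algebra_simps)
  qed
  ultimately have outer: "{..c} \<union> {d..} \<in> null_sets \<mu>"
    by (metis null_sets.Un)
  \<comment> \<open>The \<epsilon>-\<delta> condition makes the Stieltjes mass of small open sets
    small, hence that of null sets zero. The Radon-Nikodym density of \<open>\<mu>\<close> then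
    provides \<open>g\<close>.\<close>
  have "absolutely_continuous lborel \<mu>"
    unfolding absolutely_continuous_def
  proof
    fix N :: "real set" assume N: "N \<in> null_sets lborel"
    then have [measurable]: "N \<in> sets borel" by auto
    define S where "S = N \<inter> {c..d}"
    have [measurable]: "S \<in> sets borel" by (simp add: S_def)
    have S_null: "S \<in> null_sets lebesgue"
      unfolding S_def using N by (metis inf_le1 null_sets_completionI null_sets_completion_subset)
    have "emeasure \<mu> S \<le> ennreal \<epsilon>" if "0 < \<epsilon>" for \<epsilon>
    proof -
      obtain \<delta> where "0 < \<delta>" and \<delta>:
        "\<And>(I :: real set set) a b. finite I \<Longrightarrow> (\<And>i. i \<in> I \<Longrightarrow> a i \<le> b i \<and> {a i..b i} \<subseteq> {c..d}) \<Longrightarrow>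
           disjoint_family_on (\<lambda>i. {a i<..<b i}) I \<Longrightarrow> (\<Sum>i\<in>I. b i - a i) < \<delta> \<Longrightarrow>
           (\<Sum>i\<in>I. \<bar>F (b i) - F (a i)\<bar>) < \<epsilon>"
        using absolutely_continuous_on_family[OF ac \<open>0 < \<epsilon>\<close>] by blast
      have "S \<in> sets lebesgue" using S_null by auto
      then obtain U where U: "open U" "S \<subseteq> U" "U - S \<in> lmeasurable" "emeasure lebesgue (U - S) < ennreal \<delta>"
        using sets_lebesgue_outer_open \<open>0 < \<delta>\<close> by metis
      have "emeasure lebesgue U < ennreal \<delta>"
        using U S_null emeasure_Diff_null_set[OF S_null, of U] by (simp add: borel_open)
      then have Um: "U \<in> lmeasurable"
        using U(1) by (auto simp: fmeasurable_def borel_open intro: order.strict_trans ennreal_less_top)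
      then have "measure lebesgue U < \<delta>"
        using \<open>emeasure lebesgue U < ennreal \<delta>\<close> by (simp add: emeasure_eq_measure2 ennreal_less_iff)
      note Um = Um this
      \<comment> \<open>This gauge makes the covering lemma choose boxes inside \<open>U\<close>,
        since each box lies in \<open>\<gamma> x\<close> for some \<open>x\<close> in
        \<open>S\<close>.\<close>
      define \<gamma> where "\<gamma> x = (if x \<in> U then U else UNIV)" for x :: real
      have "gauge \<gamma>" using U(1) by (auto simp: gauge_def \<gamma>_def)
      have "S \<subseteq> cbox c d" "box c d \<noteq> {}" using cd by (auto simp: S_def)
      then obtain \<D> where D: "countable \<D>" "\<Union>\<D> \<subseteq> cbox c d"
        "\<And>K. K \<in> \<D> \<Longrightarrow> interior K \<noteq> {} \<and> (\<exists>c d. K = cbox c d)"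
        "pairwise (\<lambda>A B. interior A \<inter> interior B = {}) \<D>"
        "\<And>K. K \<in> \<D> \<Longrightarrow> \<exists>x \<in> S \<inter> K. K \<subseteq> \<gamma> x" "S \<subseteq> \<Union>\<D>"
        by (rule covering_lemma[OF _ _ \<open>gauge \<gamma>\<close>]) (rule that)
      have sub: "K \<subseteq> U" if "K \<in> \<D>" for K
        using D(5)[OF that] U(2) by (auto simp: \<gamma>_def split: if_splits)
      define a where "a K = Inf K" for K :: "real set"
      define b where "b K = Sup K" for K :: "real set"
      have K: "a K < b K \<and> K = {a K..b K}" if KD: "K \<in> \<D>" for K
      proof -
        obtain s t where [simp]: "K = {s..t}" using D(3)[OF KD] by (auto simp: cbox_interval)
        have "s < t" using D(3)[OF KD] by auto
        then show ?thesis by (simp add: a_def b_def)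
      qed
      \<comment> \<open>Absolute continuity concerns finite systems, so the bound is proved for
        finite subfamilies; continuity of \<open>\<mu>\<close> from below extends it to the
        countable cover.\<close>
      have fin: "emeasure \<mu> (\<Union>\<F>) \<le> ennreal \<epsilon>" if "finite \<F>" "\<F> \<subseteq> \<D>" for \<F>
      proof -
        have Kcd: "c \<le> a K \<and> b K \<le> d" if "K \<in> \<F>" for K
        proof -
          have "K \<in> \<D>" using that \<open>\<F> \<subseteq> \<D>\<close> by blast
          then have "K \<subseteq> {c..d}" using D(2) by auto
          then show ?thesis
            using K[OF \<open>K \<in> \<D>\<close>] by (metis atLeastatMost_subset_iff less_imp_le)
        qed
        have disj: "disjoint_family_on (\<lambda>K. {a K<..<b K}) \<F>"
          unfolding disjoint_family_on_def
        proof (intro ballI impI)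
          fix K L assume "K \<in> \<F>" "L \<in> \<F>" "K \<noteq> L"
          then have KL: "K \<in> \<D>" "L \<in> \<D>" "K \<noteq> L"
            using \<open>\<F> \<subseteq> \<D>\<close> by auto
          have "interior K \<inter> interior L = {}"
            using pairwiseD[OF D(4) KL] .
          moreover have "interior K = {a K<..<b K}"
            using K[OF KL(1)] interior_atLeastAtMost_real[of "a K" "b K"] by argo
          moreover have "interior L = {a L<..<b L}"
            using K[OF KL(2)] interior_atLeastAtMost_real[of "a L" "b L"] by argo
          ultimately show "{a K<..<b K} \<inter> {a L<..<b L} = {}"
            by argo
        qed
        have "(\<Sum>K\<in>\<F>. b K - a K) \<le> measure lebesgue U"
        proof (rule sum_length_disjoint_le_measure[OF \<open>finite \<F>\<close> _ _ disj Um(1)])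
          fix L assume "L \<in> \<F>"
          then have "L \<in> \<D>" using \<open>\<F> \<subseteq> \<D>\<close> by blast
          then have "a L < b L" "{a L..b L} \<subseteq> U"
            using K[of L] sub[of L] by argo+
          then show "a L \<le> b L" "{a L<..<b L} \<subseteq> U"
            using greaterThanLessThan_subseteq_atLeastAtMost_iff[of "a L" "b L" "a L" "b L"] by auto
        qed
        then have "(\<Sum>K\<in>\<F>. \<bar>F (b K) - F (a K)\<bar>) < \<epsilon>"
          using Um(2)
        proof (intro \<delta> disj \<open>finite \<F>\<close>)
          fix L assume "L \<in> \<F>"
          then show "a L \<le> b L \<and> {a L..b L} \<subseteq> {c..d}"
            using K[of L] Kcd[of L] \<open>\<F> \<subseteq> \<D>\<close> by (metis atLeastatMost_subset_iff less_imp_le subsetD)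
        qed simp
        have "emeasure \<mu> (\<Union>\<F>) \<le> (\<Sum>K\<in>\<F>. emeasure \<mu> K)"
        proof -
          have "L \<in> sets borel" if "L \<in> \<F>" for L
            using K[of L] that \<open>\<F> \<subseteq> \<D>\<close> by (metis atLeastAtMost_borel subsetD)
          then show ?thesis
            using emeasure_subadditive_finite[OF \<open>finite \<F>\<close>, of "\<lambda>K. K" \<mu>] by (auto simp: subset_eq)
        qed
        also have "\<dots> = (\<Sum>K\<in>\<F>. ennreal \<bar>F (b K) - F (a K)\<bar>)"
        proof (rule sum.cong[OF refl])
          fix L assume L: "L \<in> \<F>"
          then have 1: "a L < b L" "L = {a L..b L}" "c \<le> a L" "b L \<le> d"
            using K[of L] Kcd[of L] \<open>\<F> \<subseteq> \<D>\<close> by blast+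
          then have "emeasure \<mu> L = ennreal (G (b L) - G (a L))"
            using Icc[of "a L" "b L"] by (metis less_imp_le)
          moreover have "G (b L) = F (b L)" "G (a L) = F (a L)"
            using 1 by (auto simp: G_def max_def min_def)
          ultimately show "emeasure \<mu> L = ennreal \<bar>F (b L) - F (a L)\<bar>"
            using mono_G[of "a L" "b L"] 1 by simp
        qed
        also have "\<dots> \<le> ennreal \<epsilon>"
          using \<open>(\<Sum>K\<in>\<F>. \<bar>F (b K) - F (a K)\<bar>) < \<epsilon>\<close> by (subst sum_ennreal) (auto intro: ennreal_leI)
        finally show ?thesis .
      qed
      show ?thesis
      proof (cases "\<D> = {}")
        case True
        then show ?thesis using D(6) by simp
      next
        case False
        define A where "A n = \<Union>(from_nat_into \<D> ` {..<n})" for n :: nat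
        have A_sub: "from_nat_into \<D> ` {..<n} \<subseteq> \<D>" for n
          using from_nat_into[OF False] by auto
        have meas: "range A \<subseteq> sets \<mu>"
        proof -
          have "L \<in> sets borel" if "L \<in> \<D>" for L
            using K[OF that] by (metis atLeastAtMost_borel)
          then show ?thesis
            using A_sub by (auto simp: A_def intro!: sets.finite_Union)
        qed
        have "incseq A"
          unfolding A_def by (intro monoI Union_mono image_mono) auto
        have "(\<Union>n. A n) = \<Union>\<D>"
        proof
          show "(\<Union>n. A n) \<subseteq> \<Union>\<D>" using A_sub by (fastforce simp: A_def)
          show "\<Union>\<D> \<subseteq> (\<Union>n. A n)"
          proof
            fix x assume "x \<in> \<Union>\<D>"
            then obtain L where "L \<in> \<D>" "x \<in> L" by blast
            then obtain n where "from_nat_into \<D> n = L"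
              using from_nat_into_surj D(1) by metis
            then have "x \<in> A (Suc n)" using \<open>x \<in> L\<close> by (auto simp: A_def)
            then show "x \<in> (\<Union>n. A n)" by blast
          qed
        qed
        then have "emeasure \<mu> S \<le> emeasure \<mu> (\<Union>n. A n)"
          using D(6) sets.countable_UN[OF meas] by (intro emeasure_mono) auto
        also have "\<dots> = (SUP n. emeasure \<mu> (A n))"
          using SUP_emeasure_incseq[OF meas \<open>incseq A\<close>] by simp
        also have "\<dots> \<le> ennreal \<epsilon>"
          unfolding A_def using A_sub by (intro SUP_least fin) auto
        finally show ?thesis .
      qed
    qed
    then have "emeasure \<mu> S = 0"
      using ennreal_le_epsilon[of 0 "emeasure \<mu> S"] by (simp add: zero_ennreal.rep_eq)
    then have "S \<in> null_sets \<mu>" by (auto intro: null_setsI)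
    then have "S \<union> ({..c} \<union> {d..}) \<in> null_sets \<mu>"
      using outer by auto
    moreover have "N \<subseteq> S \<union> ({..c} \<union> {d..})" by (auto simp: S_def)
    ultimately show "N \<in> null_sets \<mu>"
      using null_sets_subset[of "S \<union> ({..c} \<union> {d..})" \<mu> N] by simp
  qed
  then obtain h where h [measurable]: "h \<in> borel_measurable lborel" and dens: "density lborel h = \<mu>"
    using sigma_finite_measure.Radon_Nikodym[OF lborel.sigma_finite_measure_axioms, of \<mu>] by auto
  have nn: "(\<integral>\<^sup>+x. h x * indicator {c<..y} x \<partial>lborel) = ennreal (F y - F c)" if "y \<in> {c..d}" for y
  proof -
    have "(\<integral>\<^sup>+x. h x * indicator {c<..y} x \<partial>lborel) = emeasure \<mu> {c<..y}"
      unfolding dens[symmetric] by (subst emeasure_density) auto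
    also have "\<dots> = ennreal (G y - G c)"
      using that by (intro Ioc) auto
    finally show ?thesis
      using that cd by (simp add: G_def)
  qed
  \<comment> \<open>The density may be infinite on a null set, where \<open>enn2real\<close>
    replaces it by 0.\<close>
  have "AE x in lborel. h x * indicator {c<..d} x \<noteq> \<infinity>"
    using nn[of d] cd by (intro nn_integral_PInf_AE) auto
  then have AE: "AE x in lborel. x \<in> {c<..d} \<longrightarrow> ennreal (enn2real (h x)) = h x"
    by eventually_elim (auto simp: indicator_def less_top)
  show thesis
  proof (rule that[of "\<lambda>x. enn2real (h x)"])
    fix y assume y: "y \<in> {c..d}"
    have Fy: "0 \<le> F y - F c"
      using mono_onD[OF mono, of c y] y by auto
    have "((\<lambda>x. enn2real (h x) * indicator {c<..y} x) has_integral (F y - F c)) UNIV"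
    proof (rule nn_integral_has_integral)
      have "(\<integral>\<^sup>+x. ennreal (enn2real (h x) * indicator {c<..y} x) \<partial>lborel) = (\<integral>\<^sup>+x. h x * indicator {c<..y} x \<partial>lborel)"
        using AE y by (intro nn_integral_cong_AE) (auto elim!: eventually_mono simp: indicator_def)
      then show "(\<integral>\<^sup>+x. ennreal (enn2real (h x) * indicator {c<..y} x) \<partial>lborel) = ennreal (F y - F c)"
        using nn[OF y] by simp
    qed (use Fy in \<open>auto simp: indicator_def\<close>)
    then have "((\<lambda>x. enn2real (h x)) has_integral (F y - F c)) {c<..y}"
      by (subst has_integral_restrict_UNIV[symmetric])
         (auto elim!: has_integral_eq[rotated] simp: indicator_def)
    then show "((\<lambda>x. enn2real (h x)) has_integral (F y - F c)) {c..y}"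
    proof (rule iffD2[OF has_integral_spike_set_eq, rotated 2])
      show "negligible {x \<in> {c..y} - {c<..y}. enn2real (h x) \<noteq> 0}"
        by (rule negligible_subset[of "{c}"]) auto
      show "negligible {x \<in> {c<..y} - {c..y}. enn2real (h x) \<noteq> 0}"
        by (rule negligible_subset[of "{c}"]) auto
    qed
  qed simp
qed

text \<open>Jordan decomposition: \<open>f\<close> is the difference of the variation function
  \<open>?V\<close> and \<open>?V - f\<close>, both nondecreasing and absolutely continuous.\<close>

theorem absolutely_continuous_on_has_integral:
  fixes f :: "real \<Rightarrow> real"
  assumes cd: "c < d" and ac: "absolutely_continuous_on {c..d} f"
  obtains v where "v absolutely_integrable_on {c..d}"
    "\<And>x. x \<in> {c..d} \<Longrightarrow> (v has_integral (f x - f c)) {c..x}"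
proof -
  let ?V = "variation_upto f c d"
  have V: "?V x + \<bar>f y - f x\<bar> \<le> ?V y" if "c \<le> x" "x \<le> y" "y \<le> d" for x y
    using variation_upto_add_le[OF ac, of x y] cd that by simp
  have acV: "absolutely_continuous_on {c..d} ?V"
    using absolutely_continuous_on_variation_upto[OF ac] cd by simp
  have "mono_on {c..d} ?V"
    using V by (fastforce intro!: mono_onI)
  then obtain g where g: "\<And>x. 0 \<le> g x" "\<And>x. x \<in> {c..d} \<Longrightarrow> (g has_integral (?V x - ?V c)) {c..x}"
    using mono_absolutely_continuous_has_integral[OF cd _ acV] by blast
  have "mono_on {c..d} (\<lambda>x. ?V x - f x)"
    using V by (fastforce intro!: mono_onI)
  then obtain h where h: "\<And>x. 0 \<le> h x" "\<And>x. x \<in> {c..d} \<Longrightarrow> (h has_integral ((?V x - f x) - (?V c - f c))) {c..x}"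
    using mono_absolutely_continuous_has_integral[OF cd _ absolutely_continuous_on_diff[OF acV ac]] by blast
  show thesis
  proof (rule that[of "\<lambda>x. g x - h x"])
    have "g integrable_on {c..d}" "h integrable_on {c..d}"
      using g(2)[of d] h(2)[of d] cd by (auto dest: has_integral_integrable)
    then have "g absolutely_integrable_on {c..d}" "h absolutely_integrable_on {c..d}"
      using g(1) h(1) nonnegative_absolutely_integrable_1 by blast+
    then show "(\<lambda>x. g x - h x) absolutely_integrable_on {c..d}"
      by (rule set_integral_diff)
    show "((\<lambda>x. g x - h x) has_integral (f x - f c)) {c..x}" if "x \<in> {c..d}" for x
      using has_integral_diff[OF g(2)[OF that] h(2)[OF that]] by (simp add: algebra_simps)
  qed
qed

text \<open>The averages in \<open>integrable_ccontinuous_explicit\<close> run over boxes that start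
  at the point, which are right difference quotients. Applied to the reflected function they give
  the left ones.\<close>

lemma indefinite_integral_has_real_derivative_AE:
  fixes v :: "real \<Rightarrow> real"
  assumes v: "v integrable_on {c..d}"
  obtains N where "negligible N"
    "\<And>t. t \<in> {c<..<d} - N \<Longrightarrow> ((\<lambda>t. integral {c..t} v) has_real_derivative v t) (at t)"
proof -
  define V where "V x = (if x \<in> {c..d} then v x else 0)" for x
  have "V integrable_on UNIV"
    unfolding V_def using v by (simp only: integrable_restrict_UNIV)
  then have V: "V integrable_on cbox a b" for a b
    using integrable_on_subcbox by blast
  have V': "(\<lambda>x. V (- x)) integrable_on cbox a b" for a b
    using V[of "- b" "- a"] Henstock_Kurzweil_Integration.integrable_reflect_real[where f=V and a="- b" and b="- a"] by (simp add: cbox_interval)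
  obtain N1 where N1: "negligible N1" "\<And>x e. x \<notin> N1 \<Longrightarrow> 0 < e \<Longrightarrow>
      \<exists>d>0. \<forall>h. 0 < h \<and> h < d \<longrightarrow> norm (integral (cbox x (x + h *\<^sub>R One)) V /\<^sub>R h ^ DIM(real) - V x) < e"
    using integrable_ccontinuous_explicit[OF V] by blast
  obtain N2 where N2: "negligible N2" "\<And>x e. x \<notin> N2 \<Longrightarrow> 0 < e \<Longrightarrow>
      \<exists>d>0. \<forall>h. 0 < h \<and> h < d \<longrightarrow>
        norm (integral (cbox x (x + h *\<^sub>R One)) (\<lambda>x. V (- x)) /\<^sub>R h ^ DIM(real) - V (- x)) < e"
    using integrable_ccontinuous_explicit[OF V'] by blast
  show thesis
  proof
    have "negligible (uminus ` N2)"
      using N2(1) by (intro negligible_differentiable_image_negligible differentiable_on_minus differentiable_on_ident) auto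
    then show "negligible (N1 \<union> uminus ` N2)"
      using N1(1) by simp
    fix t assume t: "t \<in> {c<..<d} - (N1 \<union> uminus ` N2)"
    then have ct: "c < t" "t < d" and "t \<notin> N1" "- t \<notin> N2"
      by (auto simp: image_iff)
    let ?F = "\<lambda>t. integral {c..t} v"
    have seg: "integral {x..y} V = ?F y - ?F x" if "c \<le> x" "x \<le> y" "y \<le> d" for x y
    proof -
      have "integral {x..y} V = integral {x..y} v"
        using that by (intro integral_cong) (auto simp: V_def)
      moreover have "?F x + integral {x..y} v = ?F y"
        using that by (intro Henstock_Kurzweil_Integration.integral_combine integrable_subinterval_real[OF v]) auto
      ultimately show ?thesis by simp
    qed
    show "(?F has_real_derivative v t) (at t)"
      unfolding has_field_derivative_iff LIM_def
    proof (intro allI impI)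
      fix e :: real assume "0 < e"
      obtain d1 where d1: "0 < d1" "\<And>h. 0 < h \<Longrightarrow> h < d1 \<Longrightarrow> \<bar>integral {t..t + h} V / h - V t\<bar> < e"
        using N1(2)[OF \<open>t \<notin> N1\<close> \<open>0 < e\<close>] by (auto simp: cbox_interval divide_inverse mult.commute)
      obtain d2 where d2: "0 < d2" "\<And>h. 0 < h \<Longrightarrow> h < d2 \<Longrightarrow> \<bar>integral {- t..- t + h} (\<lambda>x. V (- x)) / h - V t\<bar> < e"
        using N2(2)[OF \<open>- t \<notin> N2\<close> \<open>0 < e\<close>] by (auto simp: cbox_interval divide_inverse mult.commute)
      define r where "r = min (min d1 d2) (min (t - c) (d - t))"
      have "norm ((?F y - ?F t) / (y - t) - v t) < e" if y: "y \<noteq> t" "\<bar>y - t\<bar> < r" for y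
      proof (cases "t < y")
        case True
        then show ?thesis
          using d1(2)[of "y - t"] y ct seg[of t y] by (auto simp: r_def V_def)
      next
        case False
        have "integral {- t..- y} (\<lambda>x. V (- x)) = integral {y..t} V"
          by (rule Henstock_Kurzweil_Integration.integral_reflect_real)
        then have "\<bar>(?F t - ?F y) / (t - y) - v t\<bar> < e"
          using d2(2)[of "t - y"] y ct seg[of y t] False by (auto simp: r_def V_def)
        moreover have "(?F t - ?F y) / (t - y) = (?F y - ?F t) / (y - t)"
          by (metis minus_diff_eq minus_divide_divide)
        ultimately show ?thesis by simp
      qed
      moreover have "0 < r" using d1 d2 ct by (auto simp: r_def)
      ultimately show "\<exists>s>0. \<forall>y. y \<noteq> t \<and> dist y t < s \<longrightarrow> dist ((?F y - ?F t) / (y - t)) (v t) < e"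
        by (auto simp: dist_real_def)
    qed
  qed
qed

theorem absolutely_continuous_on_differentiable_AE:
  fixes f :: "real \<Rightarrow> real"
  assumes cd: "c < d" and ac: "absolutely_continuous_on {c..d} f"
  obtains v N where "v absolutely_integrable_on {c..d}" "negligible N"
    "\<And>x. x \<in> {c..d} \<Longrightarrow> (v has_integral (f x - f c)) {c..x}"
    "\<And>t. t \<in> {c<..<d} - N \<Longrightarrow> (f has_real_derivative v t) (at t)"
    "\<And>t. t \<notin> {c<..<d} - N \<Longrightarrow> v t = 0"
proof -
  obtain w where w: "w absolutely_integrable_on {c..d}" "\<And>x. x \<in> {c..d} \<Longrightarrow> (w has_integral (f x - f c)) {c..x}"
    using absolutely_continuous_on_has_integral[OF cd ac] by blast
  obtain N where N: "negligible N"
    "\<And>t. t \<in> {c<..<d} - N \<Longrightarrow> ((\<lambda>t. integral {c..t} w) has_real_derivative w t) (at t)"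
    using indefinite_integral_has_real_derivative_AE[of w c d] w(1) set_lebesgue_integral_eq_integral(1) by blast
  \<comment> \<open>The value 0 off the set of known differentiability is a normalization: later it
    makes the velocity vanish at every time when p touches 0 or 1, with no exceptional set.\<close>
  define v where "v t = (if t \<in> {c<..<d} - N then w t else 0)" for t
  have neg: "negligible (N \<union> {c, d})" using N(1) by simp
  show thesis
  proof
    show "negligible N" by fact
    show "v t = 0" if "t \<notin> {c<..<d} - N" for t
      using that unfolding v_def by (rule if_not_P)
    show "v absolutely_integrable_on {c..d}"
      by (rule absolutely_integrable_spike[OF w(1) neg]) (auto simp: v_def)
    show "(v has_integral (f x - f c)) {c..x}" if "x \<in> {c..d}" for x
      by (rule has_integral_spike[OF neg _ w(2)[OF that]]) (use that in \<open>auto simp: v_def\<close>)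
    show "(f has_real_derivative v t) (at t)" if t: "t \<in> {c<..<d} - N" for t
    proof -
      have "((\<lambda>s. f c + integral {c..s} w) has_real_derivative w t) (at t)"
        using DERIV_add[OF DERIV_const N(2)[OF t], of "f c"] by simp
      moreover have "f c + integral {c..s} w = f s" if "s \<in> {c<..<d}" for s
        using integral_unique[OF w(2)[of s]] that by simp
      ultimately have "(f has_real_derivative w t) (at t)"
        using t by (elim has_field_derivative_transform_within_open[where S="{c<..<d}"]) auto
      then show ?thesis using t by (simp add: v_def)
    qed
  qed
qed

lemma fundamental_theorem_of_calculus_absolutely_continuous:
  fixes f :: "real \<Rightarrow> real"
  assumes cd: "c < d" and ac: "absolutely_continuous_on {c..d} f" and "negligible N"
    and g: "\<And>t. t \<in> {c<..<d} - N \<Longrightarrow> (f has_real_derivative g t) (at t)" and x: "x \<in> {c..d}"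
  shows "(g has_integral (f x - f c)) {c..x}"
proof -
  obtain v M where v: "negligible M" "\<And>x. x \<in> {c..d} \<Longrightarrow> (v has_integral (f x - f c)) {c..x}"
    "\<And>t. t \<in> {c<..<d} - M \<Longrightarrow> (f has_real_derivative v t) (at t)"
    using absolutely_continuous_on_differentiable_AE[OF cd ac] by metis
  have "negligible (M \<union> N \<union> {c, d})" using v(1) \<open>negligible N\<close> by simp
  then show ?thesis
  proof (rule has_integral_spike[OF _ _ v(2)[OF x]])
    fix t assume t: "t \<in> {c..x} - (M \<union> N \<union> {c, d})"
    then show "g t = v t"
      using x by (intro DERIV_unique[OF g v(3)]) auto
  qed
qed

section \<open>Extended real integrals\<close>

lemma ereal_integral_le:
  assumes h: "integrable M h" and le: "AE x in M. f x \<le> ereal (h x)"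
  shows "ereal_integral M f \<le> ereal (integral\<^sup>L M h)"
proof -
  have 1: "(\<integral>\<^sup>+x. e2ennreal (f x) \<partial>M) \<le> (\<integral>\<^sup>+x. ennreal (h x) \<partial>M)"
    using le by (intro nn_integral_mono_AE) (auto elim!: eventually_mono dest: e2ennreal_mono)
  have 2: "(\<integral>\<^sup>+x. ennreal (- h x) \<partial>M) \<le> (\<integral>\<^sup>+x. e2ennreal (- f x) \<partial>M)"
  proof (intro nn_integral_mono_AE eventually_mono[OF le])
    fix x assume "f x \<le> ereal (h x)"
    then have "ereal (- h x) \<le> - f x"
      by (metis ereal_minus_le_minus uminus_ereal.simps(1))
    then show "ennreal (- h x) \<le> e2ennreal (- f x)"
      using e2ennreal_mono by fastforce
  qed
  obtain r where r: "(\<integral>\<^sup>+x. ennreal (h x) \<partial>M) = ennreal r" "0 \<le> r"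
    using h by (cases "\<integral>\<^sup>+x. ennreal (h x) \<partial>M" rule: ennreal_cases) (auto simp: real_integrable_def)
  obtain s where s: "(\<integral>\<^sup>+x. ennreal (- h x) \<partial>M) = ennreal s" "0 \<le> s"
    using h by (cases "\<integral>\<^sup>+x. ennreal (- h x) \<partial>M" rule: ennreal_cases) (auto simp: real_integrable_def)
  have "ereal_integral M f \<le> enn2ereal (\<integral>\<^sup>+x. ennreal (h x) \<partial>M) - enn2ereal (\<integral>\<^sup>+x. ennreal (- h x) \<partial>M)"
    unfolding ereal_integral_def using 1 2
    by (intro ereal_minus_mono) (auto simp: less_eq_ennreal.rep_eq)
  also have "\<dots> = ereal (integral\<^sup>L M h)"
    using r s by (simp add: real_lebesgue_integral_def[OF h] enn2ereal_ennreal)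
  finally show ?thesis .
qed

text \<open>Over a finite measure the lower bound makes the integral of the negative part finite, so
  a finite value forces the positive part to be integrable as well. This turns the finite optimal
  value into square integrability of the angular velocity.\<close>

lemma ereal_integral_finite:
  assumes "finite_measure M" and g: "g \<in> borel_measurable M" and eq: "AE x in M. f x = ereal (g x)"
    and B: "AE x in M. - B \<le> g x" and fin: "\<bar>ereal_integral M f\<bar> \<noteq> \<infinity>"
  shows "integrable M g" "ereal_integral M f = ereal (integral\<^sup>L M g)"
proof -
  interpret finite_measure M by fact
  have 1: "(\<integral>\<^sup>+x. e2ennreal (f x) \<partial>M) = (\<integral>\<^sup>+x. ennreal (g x) \<partial>M)"
    using eq by (intro nn_integral_cong_AE) (auto elim!: eventually_mono)
  have 2: "(\<integral>\<^sup>+x. e2ennreal (- f x) \<partial>M) = (\<integral>\<^sup>+x. ennreal (- g x) \<partial>M)"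
    using eq by (intro nn_integral_cong_AE) (auto elim!: eventually_mono)
  have "(\<integral>\<^sup>+x. ennreal (- g x) \<partial>M) \<le> (\<integral>\<^sup>+x. ennreal B \<partial>M)"
    using B by (intro nn_integral_mono_AE) (auto elim!: eventually_mono intro!: ennreal_leI)
  also have "\<dots> < \<infinity>"
    by (simp add: ennreal_mult_eq_top_iff less_top[symmetric])
  finally have neg: "(\<integral>\<^sup>+x. ennreal (- g x) \<partial>M) < \<infinity>" .
  then obtain s where s: "(\<integral>\<^sup>+x. ennreal (- g x) \<partial>M) = ennreal s" "0 \<le> s"
    by (cases "\<integral>\<^sup>+x. ennreal (- g x) \<partial>M" rule: ennreal_cases) auto
  have pos: "(\<integral>\<^sup>+x. ennreal (g x) \<partial>M) \<noteq> \<infinity>"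
  proof
    assume "(\<integral>\<^sup>+x. ennreal (g x) \<partial>M) = \<infinity>"
    then have "ereal_integral M f = \<infinity>"
      unfolding ereal_integral_def 1 2 s(1) using s(2) by (simp add: enn2ereal_ennreal)
    then show False using fin by simp
  qed
  then show int: "integrable M g"
    using g neg by (simp add: real_integrable_def)
  obtain r where r: "(\<integral>\<^sup>+x. ennreal (g x) \<partial>M) = ennreal r" "0 \<le> r"
    using pos by (cases "\<integral>\<^sup>+x. ennreal (g x) \<partial>M" rule: ennreal_cases) auto
  show "ereal_integral M f = ereal (integral\<^sup>L M g)"
    unfolding ereal_integral_def 1 2 real_lebesgue_integral_def[OF int]
    using r s by (simp add: enn2ereal_ennreal)
qed

section \<open>The angle substitution\<close>

lemma AE_lebesgue_on_negligible:
  assumes "negligible N" "S \<in> sets lebesgue" "\<And>x. x \<in> S - N \<Longrightarrow> P x"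
  shows "AE x in lebesgue_on S. P x"
proof -
  have "AE x in lebesgue. x \<notin> N"
    using assms(1) by (intro AE_not_in) (simp add: negligible_iff_null_sets)
  then show ?thesis
    using assms(2,3) by (subst AE_restrict_space_iff) (auto elim!: eventually_mono)
qed

text \<open>Indicators of disjoint intervals have sum at most 1. Open intervals are used because the
  closed ones may share endpoints.\<close>

lemma sum_integral_interval_system_le:
  fixes f :: "real \<Rightarrow> real"
  assumes D: "interval_system {c..d} D" and f: "f integrable_on {c..d}"
    and nonneg: "\<And>x. x \<in> {c..d} \<Longrightarrow> 0 \<le> f x"
  shows "(\<Sum>(a, b)\<in>D. integral {a..b} f) \<le> integral {c..d} f"
proof -
  define J where "J = (\<lambda>e :: real \<times> real. {fst e<..<snd e})"
  have fin: "finite D" and sub: "\<And>e. e \<in> D \<Longrightarrow> fst e \<le> snd e \<and> {fst e..snd e} \<subseteq> {c..d}"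
    and disj: "disjoint_family_on J D"
    using D by (auto simp: interval_system_def case_prod_unfold J_def)
  have Jsub: "J e \<subseteq> {c..d}" if "e \<in> D" for e
    using sub[OF that] by (auto simp: J_def)
  have eq: "integral {fst e..snd e} f = integral {c..d} (\<lambda>x. if x \<in> J e then f x else 0)" if "e \<in> D" for e
    using integral_restrict_Int[of "{c..d}" "J e" f] integral_open_interval_real[of "fst e" "snd e" f] Jsub[OF that]
    by (simp only: J_def Int_absorb2)
  have int: "(\<lambda>x. if x \<in> J e then f x else 0) integrable_on {c..d}" if "e \<in> D" for e
  proof -
    have "f integrable_on {fst e..snd e}"
      using sub[OF that] by (intro integrable_subinterval_real[OF f]) auto
    then have "f integrable_on J e"
      by (simp add: J_def integrable_on_open_interval_real)
    then have "(\<lambda>x. if x \<in> J e then f x else 0) integrable_on UNIV"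
      by (simp only: integrable_restrict_UNIV)
    then show ?thesis
      by (rule integrable_on_subinterval) auto
  qed
  have "(\<Sum>(a, b)\<in>D. integral {a..b} f) = (\<Sum>e\<in>D. integral {c..d} (\<lambda>x. if x \<in> J e then f x else 0))"
    using eq by (intro sum.cong) (auto simp: case_prod_unfold)
  also have "\<dots> = integral {c..d} (\<lambda>x. \<Sum>e\<in>D. if x \<in> J e then f x else 0)"
    using fin int by (intro integral_sum [symmetric])
  also have "\<dots> \<le> integral {c..d} f"
  proof (intro integral_le integrable_sum fin int f)
    fix x assume x: "x \<in> {c..d}"
    show "(\<Sum>e\<in>D. if x \<in> J e then f x else 0) \<le> f x"
    proof (cases "\<exists>e\<in>D. x \<in> J e")
      case True
      then obtain e0 where e0: "e0 \<in> D" "x \<in> J e0" by blast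
      then have "(\<Sum>e\<in>D. if x \<in> J e then f x else 0) = (\<Sum>e\<in>D. if e = e0 then f x else 0)"
        using disjoint_family_onD[OF disj, of e0] by (intro sum.cong) auto
      then show ?thesis using fin e0 by simp
    next
      case False
      then have "(\<Sum>e\<in>D. if x \<in> J e then f x else 0) = 0"
        by (intro sum.neutral) auto
      then show ?thesis using nonneg[OF x] by simp
    qed
  qed
  finally show ?thesis .
qed

section \<open>Square-integrable velocities and their paths\<close>

definition square_integrable :: "(real \<Rightarrow> real) \<Rightarrow> bool" where
  "square_integrable v \<longleftrightarrow> v \<in> borel_measurable (lebesgue_on {0..1}) \<and> (\<lambda>t. (v t)\<^sup>2) integrable_on {0..1}"

lemma square_integrable_mult:
  assumes v: "square_integrable v" and w: "square_integrable w"
  shows "(\<lambda>t. v t * w t) absolutely_integrable_on {0..1}"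
proof (rule measurable_bounded_by_integrable_imp_absolutely_integrable)
  show "(\<lambda>t. v t * w t) \<in> borel_measurable (lebesgue_on {0..1})"
    using v w by (intro borel_measurable_times) (auto simp: square_integrable_def)
  show "(\<lambda>t. (v t)\<^sup>2 + (w t)\<^sup>2) integrable_on {0..1}"
    using v w by (intro integrable_add) (auto simp: square_integrable_def)
  show "norm (v t * w t) \<le> (v t)\<^sup>2 + (w t)\<^sup>2" for t
  proof -
    have "2 * (\<bar>v t\<bar> * \<bar>w t\<bar>) \<le> (v t)\<^sup>2 + (w t)\<^sup>2"
      using sum_squares_bound[of "\<bar>v t\<bar>" "\<bar>w t\<bar>"] by simp
    moreover have "0 \<le> \<bar>v t\<bar> * \<bar>w t\<bar>" by simp
    ultimately show ?thesis
      unfolding real_norm_def abs_mult by linarith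
  qed
qed auto

lemma square_integrable_bounded:
  assumes "v \<in> borel_measurable (lebesgue_on {0..1})" "\<And>t. t \<in> {0..1} \<Longrightarrow> \<bar>v t\<bar> \<le> B"
  shows "square_integrable v"
  unfolding square_integrable_def
proof
  show "(\<lambda>t. (v t)\<^sup>2) integrable_on {0..1}"
  proof (rule measurable_bounded_by_integrable_imp_integrable)
    show "norm ((v t)\<^sup>2) \<le> B\<^sup>2" if "t \<in> {0..1}" for t
      using power_mono[OF assms(2)[OF that], of 2] by simp
  qed (use assms(1) in auto)
qed fact

lemma square_integrable_const: "square_integrable (\<lambda>_. k)"
  by (rule square_integrable_bounded[of _ "\<bar>k\<bar>"]) auto

lemma square_integrable_imp_absolutely_integrable:
  assumes "square_integrable v"
  shows "v absolutely_integrable_on {0..1}"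
  using square_integrable_mult[OF assms square_integrable_const[of 1]] by simp

lemma square_integrable_imp_integrable:
  assumes "square_integrable v"
  shows "v integrable_on {0..1}"
  using square_integrable_imp_absolutely_integrable[OF assms] set_lebesgue_integral_eq_integral(1) by blast

lemma square_integrable_power2:
  assumes "square_integrable v"
  shows "(\<lambda>t. (v t)\<^sup>2) absolutely_integrable_on {0..1}"
  using square_integrable_mult[OF assms assms] by (simp add: power2_eq_square)

lemma square_integrable_cmult:
  assumes "square_integrable v"
  shows "square_integrable (\<lambda>t. k * v t)"
  using assms unfolding square_integrable_def power_mult_distrib
  by (auto intro!: integrable_on_mult_right borel_measurable_times)

lemma square_integrable_add:
  assumes v: "square_integrable v" and w: "square_integrable w"
  shows "square_integrable (\<lambda>t. v t + w t)"
  unfolding square_integrable_def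
proof
  have "(\<lambda>t. v t * w t) integrable_on {0..1}"
    using square_integrable_mult[OF v w] set_lebesgue_integral_eq_integral(1) by blast
  then have "(\<lambda>t. (v t)\<^sup>2 + (w t)\<^sup>2 + 2 * (v t * w t)) integrable_on {0..1}"
    using v w by (intro integrable_add integrable_on_mult_right) (auto simp: square_integrable_def)
  then show "(\<lambda>t. (v t + w t)\<^sup>2) integrable_on {0..1}"
    by (simp add: power2_sum mult.assoc)
qed (use v w in \<open>auto simp: square_integrable_def intro!: borel_measurable_add\<close>)

text \<open>A path is given by its initial value and its velocity, not by a function to be
  differentiated. With square-integrable velocities these pairs form the vector space on which the
  action is minimized.\<close>

definition path_from :: "real \<Rightarrow> (real \<Rightarrow> real) \<Rightarrow> real \<Rightarrow> real" where
  "path_from c v t = c + integral {0..t} v"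

lemma continuous_on_path_from:
  assumes "v integrable_on {0..1}"
  shows "continuous_on {0..1} (path_from c v)"
  unfolding path_from_def by (intro continuous_intros indefinite_integral_continuous_1 assms)

lemma path_from_diff:
  assumes v: "v integrable_on {0..1}" and ab: "0 \<le> a" "a \<le> b" "b \<le> 1"
  shows "path_from c v b - path_from c v a = integral {a..b} v"
proof -
  have "v integrable_on {0..b}"
    by (rule integrable_subinterval_real[OF v]) (use ab in auto)
  from Henstock_Kurzweil_Integration.integral_combine[OF ab(1,2) this] show ?thesis
    by (simp add: path_from_def)
qed

lemma path_from_linear:
  assumes v: "v integrable_on {0..1}" and w: "w integrable_on {0..1}" and t: "t \<in> {0..1}"
  shows "path_from (c + k * d) (\<lambda>t. v t + k * w t) t = path_from c v t + k * path_from d w t"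
proof -
  have "v integrable_on {0..t}" "w integrable_on {0..t}"
    using t by (auto intro: integrable_subinterval_real[OF v] integrable_subinterval_real[OF w])
  then show ?thesis
    by (simp add: path_from_def Henstock_Kurzweil_Integration.integral_add
      integrable_on_mult_right algebra_simps)
qed

lemma absolutely_continuous_on_path_from:
  assumes v: "square_integrable v"
  shows "absolutely_continuous_on {0..1} (path_from c v)"
proof (rule absolutely_continuous_onI)
  fix \<epsilon> :: real assume "0 < \<epsilon>"
  have sq: "(\<lambda>t. (v t)\<^sup>2) integrable_on {0..1}" and int: "v integrable_on {0..1}"
    using v square_integrable_imp_integrable by (auto simp: square_integrable_def)
  define I where "I = integral {0..1} (\<lambda>t. (v t)\<^sup>2)"
  have "0 \<le> I" unfolding I_def by (rule integral_nonneg[OF sq]) simp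
  \<comment> \<open>In \<open>young\<close>, this \<open>s\<close> puts the energy part below
    \<epsilon>/2, and \<epsilon>/s as \<open>\<delta>\<close> puts the length part below
    \<epsilon>/2. The added 1 keeps \<open>s\<close> positive when the energy is zero.\<close>
  define s where "s = (I + 1) / \<epsilon>"
  have s: "0 < s" "I / s < \<epsilon>" using \<open>0 \<le> I\<close> \<open>0 < \<epsilon>\<close> by (auto simp: s_def field_simps)
  have young: "\<bar>v t\<bar> \<le> (v t)\<^sup>2 / (2 * s) + s / 2" for t
  proof -
    have "0 \<le> (\<bar>v t\<bar> - s)\<^sup>2 / (2 * s)" using s by simp
    also have "\<dots> = (v t)\<^sup>2 / (2 * s) + s / 2 - \<bar>v t\<bar>"
      using s by (simp add: power2_diff field_simps power2_eq_square)
    finally show ?thesis by simp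
  qed
  have "(\<Sum>(a, b)\<in>D. \<bar>path_from c v b - path_from c v a\<bar>) < \<epsilon>"
    if D: "interval_system {0..1} D" and small: "(\<Sum>(a, b)\<in>D. b - a) < \<epsilon> / s" for D
  proof -
    have "(\<Sum>(a, b)\<in>D. \<bar>path_from c v b - path_from c v a\<bar>) \<le>
        (\<Sum>(a, b)\<in>D. integral {a..b} (\<lambda>t. (v t)\<^sup>2) / (2 * s) + s / 2 * (b - a))"
    proof (rule sum_mono, clarify)
      fix a b assume "(a, b) \<in> D"
      then have ab: "a \<le> b" "{a..b} \<subseteq> {0..1}"
        using D by (auto simp: interval_system_def)
      then have ab': "0 \<le> a" "b \<le> 1" by auto
      have sq': "(\<lambda>t. (v t)\<^sup>2) integrable_on {a..b}" and v': "v integrable_on {a..b}"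
        using ab by (auto intro: integrable_subinterval_real[OF sq] integrable_subinterval_real[OF int])
      have "\<bar>path_from c v b - path_from c v a\<bar> = norm (integral {a..b} v)"
        using path_from_diff[OF int, of a b c] ab ab' by simp
      also have "\<dots> \<le> integral {a..b} (\<lambda>t. (v t)\<^sup>2 / (2 * s) + s / 2)"
        using v' sq' young by (intro integral_norm_bound_integral integrable_add integrable_on_divide) auto
      also have "\<dots> = integral {a..b} (\<lambda>t. (v t)\<^sup>2) / (2 * s) + s / 2 * (b - a)"
        using sq' ab(1) by (subst Henstock_Kurzweil_Integration.integral_add) (auto intro: integrable_on_divide)
      finally show "\<bar>path_from c v b - path_from c v a\<bar> \<le> integral {a..b} (\<lambda>t. (v t)\<^sup>2) / (2 * s) + s / 2 * (b - a)" .
    qed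
    also have "\<dots> = (\<Sum>(a, b)\<in>D. integral {a..b} (\<lambda>t. (v t)\<^sup>2)) / (2 * s) + s / 2 * (\<Sum>(a, b)\<in>D. b - a)"
      by (simp add: case_prod_unfold sum.distrib sum_divide_distrib sum_distrib_left)
    also have "\<dots> \<le> I / (2 * s) + s / 2 * (\<Sum>(a, b)\<in>D. b - a)"
      unfolding I_def using s sum_integral_interval_system_le[OF D sq] by (intro add_mono divide_right_mono) auto
    also have "\<dots> < \<epsilon> / 2 + s / 2 * (\<epsilon> / s)"
      using s small by (intro add_strict_mono mult_strict_left_mono) (auto simp: field_simps)
    also have "\<dots> = \<epsilon>" using s by simp
    finally show ?thesis .
  qed
  then show "\<exists>\<delta>>0. \<forall>D. interval_system {0..1} D \<longrightarrow> (\<Sum>(a, b)\<in>D. b - a) < \<delta> \<longrightarrow>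
      (\<Sum>(a, b)\<in>D. \<bar>path_from c v b - path_from c v a\<bar>) < \<epsilon>"
    using s \<open>0 < \<epsilon>\<close> by (intro exI[of _ "\<epsilon> / s"]) auto
qed

lemma abs_sin_diff_le: "\<bar>sin y - sin x\<bar> \<le> \<bar>y - x\<bar>" for x y :: real
  using field_differentiable_bound[of UNIV sin cos 1 y x] by (auto intro: DERIV_sin)

definition action :: "real \<Rightarrow> (real \<Rightarrow> real) \<Rightarrow> real \<Rightarrow> (real \<Rightarrow> real) \<Rightarrow> real" where
  "action lam u c v = integral {0..1} (\<lambda>t. lam * (v t)\<^sup>2 - u t * ((1 + sin (path_from c v t)) / 2))"

lemma bounded_measurable_mult_continuous:
  fixes u :: "real \<Rightarrow> real"
  assumes "u \<in> borel_measurable (lebesgue_on {0..1})" "bounded (u ` {0..1})" "continuous_on {0..1} g"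
  shows "(\<lambda>t. u t * g t) absolutely_integrable_on {0..1}"
  using assms by (intro absolutely_integrable_bounded_measurable_product_real absolutely_integrable_continuous_real) auto

lemma action_integrable:
  assumes u: "u \<in> borel_measurable (lebesgue_on {0..1})" "bounded (u ` {0..1})" and v: "square_integrable v"
  shows "(\<lambda>t. lam * (v t)\<^sup>2 - u t * ((1 + sin (path_from c v t)) / 2)) absolutely_integrable_on {0..1}"
proof (intro set_integral_diff)
  show "(\<lambda>t. lam * (v t)\<^sup>2) absolutely_integrable_on {0..1}"
    using square_integrable_power2[OF v] by (intro set_integrable_mult_right) auto
  show "(\<lambda>t. u t * ((1 + sin (path_from c v t)) / 2)) absolutely_integrable_on {0..1}"
    using square_integrable_imp_integrable[OF v]
    by (intro bounded_measurable_mult_continuous u continuous_intros continuous_on_path_from) auto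
qed

lemma absolutely_integrable_imp_integrable_lebesgue_on:
  fixes f :: "real \<Rightarrow> real"
  assumes "f absolutely_integrable_on {0..1}"
  shows "integrable (lebesgue_on {0..1}) f" "integral\<^sup>L (lebesgue_on {0..1}) f = integral {0..1} f"
proof -
  show "integrable (lebesgue_on {0..1}) f"
    using assms by (simp add: integrable_restrict_space set_integrable_def)
  then show "integral\<^sup>L (lebesgue_on {0..1}) f = integral {0..1} f"
    by (intro lebesgue_integral_eq_integral) auto
qed

text \<open>With \<open>p = (1 + sin \<phi>) / 2\<close> one has \<open>p' = \<phi>' cos \<phi> / 2\<close> and \<open>p (1 - p) = cos\<^sup>2 \<phi> / 4\<close>,
  so the quotient in the cost becomes \<open>\<phi>'\<^sup>2\<close>.\<close>

lemma objective_sin_path_le: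
  assumes u: "u \<in> borel_measurable (lebesgue_on {0..1})" "bounded (u ` {0..1})"
    and v: "square_integrable v" and "0 < lam"
  shows "feasible (\<lambda>t. (1 + sin (path_from c v t)) / 2)"
    and "objective lam u (\<lambda>t. (1 + sin (path_from c v t)) / 2) \<le> ereal (action lam u c v)"
proof -
  let ?p = "\<lambda>t. (1 + sin (path_from c v t)) / 2"
  have "absolutely_continuous_on {0..1} ?p"
  proof (rule absolutely_continuous_on_bounded_by[OF absolutely_continuous_on_path_from[OF v, of c]])
    show "\<bar>?p y - ?p x\<bar> \<le> 1 / 2 * \<bar>path_from c v y - path_from c v x\<bar>" for x y
      using abs_sin_diff_le[of "path_from c v y" "path_from c v x"] by (simp add: field_simps abs_divide flip: diff_divide_distrib)
  qed simp
  moreover have "0 \<le> ?p t \<and> ?p t \<le> 1" for t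
    using sin_ge_minus_one[of "path_from c v t"] sin_le_one[of "path_from c v t"]
    by (simp only: zero_le_divide_iff divide_le_eq_1) linarith
  ultimately show "feasible ?p"
    unfolding feasible_def image_subset_iff by (metis atLeastAtMost_iff)
  obtain N where N: "negligible N"
    "\<And>t. t \<in> {0<..<1} - N \<Longrightarrow> ((\<lambda>t. integral {0..t} v) has_real_derivative v t) (at t)"
    using indefinite_integral_has_real_derivative_AE[OF square_integrable_imp_integrable[OF v]] by blast
  have "objective lam u ?p \<le> ereal (integral\<^sup>L (lebesgue_on {0..1}) (\<lambda>t. lam * (v t)\<^sup>2 - u t * ?p t))"
    unfolding objective_def
  proof (rule ereal_integral_le)
    show "integrable (lebesgue_on {0..1}) (\<lambda>t. lam * (v t)\<^sup>2 - u t * ?p t)"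
      by (rule absolutely_integrable_imp_integrable_lebesgue_on action_integrable u v)+
    show "AE t in lebesgue_on {0..1}. ereal lam * running_cost (?p t) (deriv ?p t) - ereal (u t * ?p t)
        \<le> ereal (lam * (v t)\<^sup>2 - u t * ?p t)"
    proof (rule AE_lebesgue_on_negligible)
      show "negligible (N \<union> {0, 1})" using N(1) by simp
      fix t :: real assume "t \<in> {0..1} - (N \<union> {0, 1})"
      then have t: "t \<in> {0<..<1} - N" by auto
      let ?x = "path_from c v t"
      have "(?p has_real_derivative cos ?x * v t / 2) (at t)"
        unfolding path_from_def by (rule derivative_eq_intros N(2)[OF t] refl | simp)+
      then have d: "deriv ?p t = cos ?x * v t / 2" by (rule DERIV_imp_deriv)
      have pq: "?p t * (1 - ?p t) = (cos ?x)\<^sup>2 / 4"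
        unfolding cos_squared_eq by (simp add: field_simps power2_eq_square)
      \<comment> \<open>Equality may fail where cos \<open>?x\<close> = 0: there p' = 0 and the cost
        is 0 by convention, while \<open>v t\<close> is arbitrary. Hence an inequality between
        \<open>objective\<close> and \<open>action\<close>.\<close>
      have "running_cost (?p t) (deriv ?p t) \<le> ereal ((v t)\<^sup>2)"
      proof (cases "?p t \<in> {0, 1}")
        case True
        then have "cos ?x = 0" using pq by auto
        then show ?thesis using True d by (simp add: running_cost_def)
      next
        case False
        then have "cos ?x \<noteq> 0" using pq by auto
        then have "(deriv ?p t)\<^sup>2 / (?p t * (1 - ?p t)) = (v t)\<^sup>2"
          unfolding pq d by (simp add: power_mult_distrib power_divide)
        then show ?thesis using False unfolding running_cost_def by simp
      qed
      then have "ereal lam * running_cost (?p t) (deriv ?p t) \<le> ereal lam * ereal ((v t)\<^sup>2)"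
        using \<open>0 < lam\<close> by (intro ereal_mult_left_mono) auto
      then show "ereal lam * running_cost (?p t) (deriv ?p t) - ereal (u t * ?p t)
          \<le> ereal (lam * (v t)\<^sup>2 - u t * ?p t)"
        using ereal_minus_mono[of "ereal lam * running_cost (?p t) (deriv ?p t)" "ereal lam * ereal ((v t)\<^sup>2)"
          "ereal (u t * ?p t)" "ereal (u t * ?p t)"] by simp
    qed auto
  qed
  then show "objective lam u ?p \<le> ereal (action lam u c v)"
    using absolutely_integrable_imp_integrable_lebesgue_on(2)[OF action_integrable[OF u v]]
    by (simp add: action_def)
qed

section \<open>The angle of a feasible function\<close>

lemma arcsin_Lipschitz:
  assumes "0 \<le> r" "r < 1" "\<bar>x\<bar> \<le> r" "\<bar>y\<bar> \<le> r"
  shows "\<bar>arcsin y - arcsin x\<bar> \<le> inverse (sqrt (1 - r\<^sup>2)) * \<bar>y - x\<bar>"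
proof -
  have r: "0 < 1 - r\<^sup>2"
    using assms by (simp add: abs_square_less_1)
  have "norm (arcsin y - arcsin x) \<le> inverse (sqrt (1 - r\<^sup>2)) * norm (y - x)"
  proof (rule field_differentiable_bound[of "{- r..r}" arcsin "\<lambda>z. inverse (sqrt (1 - z\<^sup>2))"])
    fix z assume z: "z \<in> {- r..r}"
    then show "(arcsin has_real_derivative inverse (sqrt (1 - z\<^sup>2))) (at z within {- r..r})"
      using assms by (intro DERIV_arcsin[THEN DERIV_subset]) auto
    have "z\<^sup>2 \<le> r\<^sup>2" using z by (intro power2_le_iff_abs_le[THEN iffD2]) auto
    then show "norm (inverse (sqrt (1 - z\<^sup>2))) \<le> inverse (sqrt (1 - r\<^sup>2))"
      using r by (simp add: le_imp_inverse_le)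
  qed (use assms in auto)
  then show ?thesis by simp
qed

text \<open>The angle \<open>\<phi> = arcsin (2 p - 1)\<close> is approximated by \<open>arcsin (r (2 p - 1))\<close> with \<open>r < 1\<close>, which
  avoids the singularity of the derivative of \<open>arcsin\<close> where \<open>p\<close> touches \<open>0\<close> or \<open>1\<close>.\<close>

lemma objective_eq_action:
  assumes u: "u \<in> borel_measurable (lebesgue_on {0..1})" "bounded (u ` {0..1})" and "0 < lam"
    and p: "feasible p" and fin: "\<bar>objective lam u p\<bar> \<noteq> \<infinity>"
  obtains c v where "square_integrable v" "\<And>t. t \<in> {0..1} \<Longrightarrow> path_from c v t = arcsin (2 * p t - 1)"
    "objective lam u p = ereal (action lam u c v)"
proof -
  have ac: "absolutely_continuous_on {0..1} p" and range: "\<And>t. t \<in> {0..1} \<Longrightarrow> 0 \<le> p t \<and> p t \<le> 1"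
    using p by (auto simp: feasible_def image_subset_iff)
  obtain v N where v: "v absolutely_integrable_on {0..1}" and N: "negligible N"
    and der: "\<And>t. t \<in> {0<..<1} - N \<Longrightarrow> (p has_real_derivative v t) (at t)"
    and off: "\<And>t. t \<notin> {0<..<1} - N \<Longrightarrow> v t = 0"
    using absolutely_continuous_on_differentiable_AE[OF zero_less_one ac] by metis
  \<comment> \<open>At a point of differentiability inside (0, 1), p has a local extremum when it
    reaches 0 or 1; at the other points \<open>v\<close> was normalized to 0.\<close>
  have bdry: "v t = 0" if "t \<in> {0..1}" "p t \<in> {0, 1}" for t
  proof (cases "t \<in> {0<..<1} - N")
    case True
    then have d: "0 < min t (1 - t)" by auto
    show ?thesis
    proof (cases "p t = 0")
      case True
      have "\<forall>y. \<bar>t - y\<bar> < min t (1 - t) \<longrightarrow> p t \<le> p y"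
        using range unfolding True by (simp add: abs_if split: if_splits)
      then show ?thesis using DERIV_local_min[OF der d] \<open>t \<in> {0<..<1} - N\<close> by simp
    next
      case False
      then have "p t = 1" using that by simp
      then have "\<forall>y. \<bar>t - y\<bar> < min t (1 - t) \<longrightarrow> p y \<le> p t"
        using range by (simp add: abs_if split: if_splits)
      then show ?thesis using DERIV_local_max[OF der d] \<open>t \<in> {0<..<1} - N\<close> by simp
    qed
  qed (rule off)
  \<comment> \<open>The angular velocity. Where p is 0 or 1, both \<open>v t\<close> and the
    quotient are 0, in agreement with the convention in the cost.\<close>
  define w where "w t = v t / sqrt (p t * (1 - p t))" for t
  define g where "g t = lam * (w t)\<^sup>2 - u t * p t" for t
  have p_cont: "continuous_on {0..1} p"
    using absolutely_continuous_on_imp_continuous_on[OF ac] .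
  have p_meas: "p \<in> borel_measurable (lebesgue_on {0..1})"
    using p_cont by (intro continuous_imp_measurable_on_sets_lebesgue) auto
  have v_meas: "v \<in> borel_measurable (lebesgue_on {0..1})"
    using v by (intro absolutely_integrable_imp_borel_measurable) auto
  have w_meas: "w \<in> borel_measurable (lebesgue_on {0..1})"
    unfolding w_def using p_meas v_meas
    by (intro borel_measurable_divide measurable_compose[OF _ borel_measurable_sqrt] borel_measurable_times
      borel_measurable_diff borel_measurable_const)
  have g_meas: "g \<in> borel_measurable (lebesgue_on {0..1})"
    unfolding g_def using w_meas u(1) p_meas
    by (intro borel_measurable_diff borel_measurable_times borel_measurable_power borel_measurable_const)
  obtain B where B: "\<And>t. t \<in> {0..1} \<Longrightarrow> \<bar>u t\<bar> \<le> B"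
    using u(2) unfolding bounded_iff by (metis image_eqI real_norm_def)
  have "0 \<le> B" using B[of 0] by simp
  have eq: "AE t in lebesgue_on {0..1}. ereal lam * running_cost (p t) (deriv p t) - ereal (u t * p t) = ereal (g t)"
  proof (rule AE_lebesgue_on_negligible)
    show "negligible (N \<union> {0, 1})" using N by simp
    fix t :: real assume "t \<in> {0..1} - (N \<union> {0, 1})"
    then have t: "t \<in> {0<..<1} - N" "t \<in> {0..1}" by auto
    have "deriv p t = v t" using der[OF t(1)] by (rule DERIV_imp_deriv)
    moreover have "running_cost (p t) (v t) = ereal ((w t)\<^sup>2)"
    proof (cases "p t \<in> {0, 1}")
      case True
      then show ?thesis using bdry[OF t(2)] by (auto simp: running_cost_def w_def)
    next
      case False
      then have "0 \<le> p t * (1 - p t)" using range[OF t(2)] by simp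
      then show ?thesis using False unfolding running_cost_def w_def by (simp add: power_divide)
    qed
    ultimately show "ereal lam * running_cost (p t) (deriv p t) - ereal (u t * p t) = ereal (g t)"
      by (simp add: g_def)
  qed auto
  have lower: "AE t in lebesgue_on {0..1}. - B \<le> g t"
  proof (rule AE_lebesgue_on_negligible)
    fix t :: real assume "t \<in> {0..1} - {}"
    then have t: "t \<in> {0..1}" by simp
    have "u t * p t \<le> \<bar>u t\<bar> * \<bar>p t\<bar>" by (metis abs_ge_self abs_mult)
    also have "\<dots> \<le> B * 1"
      using B[OF t] range[OF t] \<open>0 \<le> B\<close> by (intro mult_mono) auto
    finally have "u t * p t \<le> B * 1" .
    then show "- B \<le> g t"
    proof -
      have "0 \<le> lam * (w t)\<^sup>2" using \<open>0 < lam\<close> by simp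
      then show ?thesis
        unfolding g_def using \<open>u t * p t \<le> B * 1\<close> by linarith
    qed
  qed auto
  have fm: "finite_measure (lebesgue_on {0..1 :: real})"
    by (intro finite_measure_lebesgue_on) auto
  note int = ereal_integral_finite[OF fm g_meas eq lower fin[unfolded objective_def]]
  have g_abs: "g absolutely_integrable_on {0..1}"
    using int(1) by (simp add: integrable_restrict_space set_integrable_def)
  have "(\<lambda>t. (g t + u t * p t) / lam) absolutely_integrable_on {0..1}"
    using g_abs bounded_measurable_mult_continuous[OF u p_cont]
    by (intro set_integrable_divide set_integral_add)
  moreover have "(\<lambda>t. (g t + u t * p t) / lam) = (\<lambda>t. (w t)\<^sup>2)"
    using \<open>0 < lam\<close> by (auto simp: g_def)
  ultimately have sq: "square_integrable w"
    using w_meas set_lebesgue_integral_eq_integral(1) by (auto simp: square_integrable_def)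
  \<comment> \<open>The derivative of \<open>arcsin (r * (2 * p t - 1))\<close>; for r = 1 it is
    \<open>w\<close>.\<close>
  define z where "z r t = inverse (sqrt (1 - (r * (2 * p t - 1))\<^sup>2)) * (r * (2 * v t))" for r t
  have X: "\<bar>2 * p t - 1\<bar> \<le> 1" if "t \<in> {0..1}" for t
    using range[OF that] by auto
  have FTC: "(z r has_integral (arcsin (r * (2 * p t - 1)) - arcsin (r * (2 * p 0 - 1)))) {0..t}"
    if r: "0 < r" "r < 1" and t: "t \<in> {0..1}" for r t
  proof (rule fundamental_theorem_of_calculus_absolutely_continuous[OF zero_less_one _ N _ t, of "\<lambda>t. arcsin (r * (2 * p t - 1))"])
    have rX: "\<bar>r * (2 * p t - 1)\<bar> \<le> r" if "t \<in> {0..1}" for t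
      using X[OF that] r by (simp add: abs_mult mult_left_le)
    show "absolutely_continuous_on {0..1} (\<lambda>t. arcsin (r * (2 * p t - 1)))"
    proof (rule absolutely_continuous_on_bounded_by[OF ac])
      show "0 \<le> inverse (sqrt (1 - r\<^sup>2)) * (2 * r)"
        using r by (intro mult_nonneg_nonneg) (auto simp: power_le_one)
      fix x y :: real assume xy: "x \<in> {0..1}" "y \<in> {0..1}"
      have "\<bar>arcsin (r * (2 * p y - 1)) - arcsin (r * (2 * p x - 1))\<bar> \<le>
          inverse (sqrt (1 - r\<^sup>2)) * \<bar>r * (2 * p y - 1) - r * (2 * p x - 1)\<bar>"
        using r xy rX by (intro arcsin_Lipschitz) auto
      also have "r * (2 * p y - 1) - r * (2 * p x - 1) = 2 * r * (p y - p x)"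
        by (simp add: algebra_simps)
      finally show "\<bar>arcsin (r * (2 * p y - 1)) - arcsin (r * (2 * p x - 1))\<bar> \<le>
          inverse (sqrt (1 - r\<^sup>2)) * (2 * r) * \<bar>p y - p x\<bar>"
        using r by (simp add: abs_mult)
    qed
    fix s :: real assume s: "s \<in> {0<..<1} - N"
    then have "\<bar>r * (2 * p s - 1)\<bar> < 1" using rX[of s] r by auto
    then show "((\<lambda>t. arcsin (r * (2 * p t - 1))) has_real_derivative z r s) (at s)"
      unfolding z_def by (auto intro!: derivative_eq_intros der s)
  qed
  have inner: "0 < p t * (1 - p t) \<and> 1 - (2 * p t - 1)\<^sup>2 = 4 * (p t * (1 - p t))"
    if "t \<in> {0..1}" "v t \<noteq> 0" for t
  proof -
    have "p t \<notin> {0, 1}" using bdry that by blast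
    then have "0 < p t" "p t < 1" using range[OF that(1)] by auto
    then show ?thesis by (auto simp: power2_eq_square algebra_simps)
  qed
  have w_eq: "w t = inverse (sqrt (1 - (2 * p t - 1)\<^sup>2)) * (2 * v t)" if "t \<in> {0..1}" for t
  proof (cases "v t = 0")
    case False
    define q where "q = p t * (1 - p t)"
    have "1 - (2 * p t - 1)\<^sup>2 = 4 * q" using inner[OF that False] by (simp add: q_def)
    then have "sqrt (1 - (2 * p t - 1)\<^sup>2) = 2 * sqrt q"
      by (simp add: real_sqrt_mult)
    then show ?thesis
      unfolding w_def q_def[symmetric] by (simp add: field_simps)
  qed (simp add: w_def)
  \<comment> \<open>Dominated convergence asks for one majorant for all \<open>r\<close>: since r^2
    (1 - x^2) <= 1 - (r x)^2, the factor r / sqrt (1 - (r x)^2) is at most 1 / sqrt (1 -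
    x^2).\<close>
  have bound: "norm (z r t) \<le> \<bar>w t\<bar>" if r: "0 < r" "r < 1" and t: "t \<in> {0..1}" for r t
  proof (cases "v t = 0")
    case True
    then show ?thesis by (simp add: z_def)
  next
    case False
    define x where "x = 2 * p t - 1"
    have x: "0 < 1 - x\<^sup>2" using inner[OF t False] by (simp add: x_def)
    have r2: "r\<^sup>2 < 1" using r by (simp add: abs_square_less_1)
    have "r\<^sup>2 * (1 - x\<^sup>2) \<le> 1 - (r * x)\<^sup>2"
      using r2 by (simp add: power_mult_distrib algebra_simps)
    then have "sqrt (r\<^sup>2 * (1 - x\<^sup>2)) \<le> sqrt (1 - (r * x)\<^sup>2)" by simp
    then have le: "r * sqrt (1 - x\<^sup>2) \<le> sqrt (1 - (r * x)\<^sup>2)"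
      using r by (simp add: real_sqrt_mult)
    have pos: "0 < r * sqrt (1 - x\<^sup>2)" using r x by simp
    then have "inverse (sqrt (1 - (r * x)\<^sup>2)) \<le> inverse (r * sqrt (1 - x\<^sup>2))"
      using le by (intro le_imp_inverse_le)
    then have "inverse (sqrt (1 - (r * x)\<^sup>2)) * r \<le> inverse (r * sqrt (1 - x\<^sup>2)) * r"
      using r by (intro mult_right_mono) auto
    also have "\<dots> = inverse (sqrt (1 - x\<^sup>2))"
      using r by (simp add: field_simps)
    finally have "inverse (sqrt (1 - (r * x)\<^sup>2)) * r * (2 * \<bar>v t\<bar>) \<le> inverse (sqrt (1 - x\<^sup>2)) * (2 * \<bar>v t\<bar>)"
      by (intro mult_right_mono) auto
    moreover have "norm (z r t) = inverse (sqrt (1 - (r * x)\<^sup>2)) * r * (2 * \<bar>v t\<bar>)"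
      using abs_of_pos[OF r(1)] abs_of_pos[OF less_le_trans[OF pos le]]
      unfolding z_def x_def[symmetric] real_norm_def abs_mult abs_inverse by simp
    moreover have "\<bar>w t\<bar> = inverse (sqrt (1 - x\<^sup>2)) * (2 * \<bar>v t\<bar>)"
      using x unfolding w_eq[OF t] x_def[symmetric] by (simp add: abs_mult)
    ultimately show ?thesis by simp
  qed
  \<comment> \<open>The shift by 2 keeps \<open>r 0\<close> positive.\<close>
  define r where "r n = 1 - inverse (real (Suc (Suc n)))" for n
  have r: "0 < r n" "r n < 1" for n
    by (auto simp: r_def field_simps)
  have r_lim: "r \<longlonglongrightarrow> 1"
  proof -
    have "(\<lambda>n. inverse (real (Suc (Suc n)))) \<longlonglongrightarrow> 0"
      using LIMSEQ_inverse_real_of_nat by (rule LIMSEQ_Suc)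
    from tendsto_diff[OF tendsto_const this, of 1] show ?thesis
      by (simp add: r_def [abs_def])
  qed
  have z_lim: "(\<lambda>n. z (r n) t) \<longlonglongrightarrow> w t" if t: "t \<in> {0..1}" for t
  proof (cases "v t = 0")
    case True
    then show ?thesis by (simp add: z_def w_def)
  next
    case False
    then have "0 < 1 - (2 * p t - 1)\<^sup>2" using inner[OF t] by simp
    then have "(\<lambda>n. z (r n) t) \<longlonglongrightarrow> inverse (sqrt (1 - (1 * (2 * p t - 1))\<^sup>2)) * (1 * (2 * v t))"
      unfolding z_def by (intro tendsto_intros r_lim) auto
    then show ?thesis using w_eq[OF t] by simp
  qed
  have path: "path_from (arcsin (2 * p 0 - 1)) w t = arcsin (2 * p t - 1)" if t: "t \<in> {0..1}" for t
  proof -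
    have "w absolutely_integrable_on {0..t}"
      using square_integrable_imp_absolutely_integrable[OF sq] t
      by (auto intro: set_integrable_subset)
    then have w_abs: "(\<lambda>s. \<bar>w s\<bar>) integrable_on {0..t}"
      unfolding absolutely_integrable_on_def real_norm_def by blast
    have conv: "(\<lambda>n. integral {0..t} (z (r n))) \<longlonglongrightarrow> integral {0..t} w"
    proof (rule dominated_convergence(2)[OF _ w_abs])
      show "z (r n) integrable_on {0..t}" for n
        using FTC[OF r t] by (rule has_integral_integrable)
    qed (use bound[OF r] z_lim t in auto)
    have lim: "(\<lambda>n. arcsin (r n * (2 * p s - 1))) \<longlonglongrightarrow> arcsin (2 * p s - 1)" if s: "s \<in> {0..1}" for s
    proof (rule continuous_on_tendsto_compose[OF continuous_on_arcsin'])
      show "(\<lambda>n. r n * (2 * p s - 1)) \<longlonglongrightarrow> 2 * p s - 1"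
        using tendsto_mult[OF r_lim tendsto_const, of "2 * p s - 1"] by simp
      show "2 * p s - 1 \<in> {- 1..1}" using X[OF s] by auto
      have "\<bar>r n * (2 * p s - 1)\<bar> \<le> 1" for n
        using mult_mono[of "\<bar>r n\<bar>" 1 "\<bar>2 * p s - 1\<bar>" 1] X[OF s] r[of n] by (simp add: abs_mult)
      then show "\<forall>\<^sub>F n in sequentially. r n * (2 * p s - 1) \<in> {- 1..1}"
        by (simp add: abs_le_iff minus_le_iff)
    qed
    have "integral {0..t} (z (r n)) = arcsin (r n * (2 * p t - 1)) - arcsin (r n * (2 * p 0 - 1))" for n
      using FTC[OF r t] by (rule integral_unique)
    then have "(\<lambda>n. integral {0..t} (z (r n))) \<longlonglongrightarrow> arcsin (2 * p t - 1) - arcsin (2 * p 0 - 1)"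
      using tendsto_diff[OF lim[OF t] lim[of 0]] by simp
    with conv have "integral {0..t} w = arcsin (2 * p t - 1) - arcsin (2 * p 0 - 1)"
      by (rule LIMSEQ_unique)
    then show ?thesis by (simp add: path_from_def)
  qed
  show thesis
  proof (rule that[OF sq path])
    have "action lam u (arcsin (2 * p 0 - 1)) w = integral {0..1} g"
      unfolding action_def
    proof (rule integral_cong)
      fix t :: real assume t: "t \<in> {0..1}"
      have "sin (arcsin (2 * p t - 1)) = 2 * p t - 1" using X[OF t] by (intro sin_arcsin) auto
      then show "lam * (w t)\<^sup>2 - u t * ((1 + sin (path_from (arcsin (2 * p 0 - 1)) w t)) / 2) = g t"
        by (simp add: g_def path[OF t])
    qed
    then show "objective lam u p = ereal (action lam u (arcsin (2 * p 0 - 1)) w)"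
      using int(2) absolutely_integrable_imp_integrable_lebesgue_on(2)[OF g_abs]
      unfolding objective_def by simp
  qed
qed

section \<open>Boundedness and measurability of piecewise continuous functions\<close>

lemma partition_cover:
  fixes s :: "nat \<Rightarrow> real"
  assumes "s 0 \<le> x" "x \<le> s N"
  shows "x \<in> s ` {..N} \<or> (\<exists>i<N. s i < x \<and> x < s (Suc i))"
  using assms
proof (induction N)
  case (Suc N)
  show ?case
  proof (cases "x \<le> s N")
    case True
    then show ?thesis using Suc by (auto simp: less_Suc_eq)
  next
    case False
    then show ?thesis using Suc.prems by (cases "x = s (Suc N)") (auto intro!: exI[of _ N])
  qed
qed auto

text \<open>On each piece the one-sided limits extend u continuously to the closed interval, so
  compactness gives boundedness. Measurability follows from continuity off the finitely many
  partition points.\<close>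

lemma piecewise_continuous_bounded_measurable:
  assumes "piecewise_continuous u"
  shows "u \<in> borel_measurable (lebesgue_on {0..1})" "bounded (u ` {0..1})"
proof -
  obtain N :: nat and s where s: "s 0 = 0" "s N = 1" "\<And>i. i < N \<Longrightarrow> s i < s (Suc i)"
    and cont: "\<And>i. i < N \<Longrightarrow> continuous_on {s i<..<s (Suc i)} u"
    and left: "\<And>i. i \<in> {1..N} \<Longrightarrow> \<exists>l. (u \<longlongrightarrow> l) (at_left (s i))"
    and right: "\<And>i. i < N \<Longrightarrow> \<exists>l. (u \<longlongrightarrow> l) (at_right (s i))"
    using assms unfolding piecewise_continuous_def by blast
  define W where "W = (\<Union>i<N. {s i<..<s (Suc i)})"
  have cover: "{0..1} \<subseteq> s ` {..N} \<union> W"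
    using partition_cover[of s _ N] s(1,2) by (fastforce simp: W_def)
  have bounded_piece: "bounded (u ` {s i<..<s (Suc i)})" if i: "i < N" for i
  proof -
    let ?a = "s i" and ?b = "s (Suc i)"
    have "?a < ?b" using s(3) i by simp
    obtain la lb where la: "(u \<longlongrightarrow> la) (at_right ?a)" and lb: "(u \<longlongrightarrow> lb) (at_left ?b)"
      using right[OF i] left[of "Suc i"] i by auto
    define f where "f x = (if x = ?a then la else if x = ?b then lb else u x)" for x
    have "continuous_on {?a..?b} f"
    proof (rule continuous_on_IccI)
      show "(f \<longlongrightarrow> f ?a) (at_right ?a)"
        using la \<open>?a < ?b\<close>
        by (rule_tac Lim_transform_eventually) (auto simp: f_def eventually_at_right[OF \<open>?a < ?b\<close>] intro!: exI[of _ ?b])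
      show "(f \<longlongrightarrow> f ?b) (at_left ?b)"
        using lb \<open>?a < ?b\<close>
        by (rule_tac Lim_transform_eventually) (auto simp: f_def eventually_at_left[OF \<open>?a < ?b\<close>] intro!: exI[of _ ?a])
      fix x assume x: "?a < x" "x < ?b"
      have "(u \<longlongrightarrow> u x) (at x)"
        using cont[OF i] x by (auto simp: continuous_on_eq_continuous_at isCont_def)
      then have "(f \<longlongrightarrow> u x) (at x)"
        by (rule Lim_transform_within_open[of _ _ _ _ "{?a<..<?b}"]) (use x in \<open>auto simp: f_def\<close>)
      then show "f \<midarrow>x\<rightarrow> f x" using x by (simp add: f_def)
    qed fact
    then have "bounded (f ` {?a..?b})"
      by (intro compact_imp_bounded compact_continuous_image) auto
    then have "bounded (f ` {?a<..<?b})"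
      by (rule bounded_subset) auto
    moreover have "f ` {?a<..<?b} = u ` {?a<..<?b}" by (auto simp: f_def)
    ultimately show ?thesis by simp
  qed
  have "bounded (u ` (s ` {..N} \<union> W))"
    unfolding W_def image_Un image_UN bounded_Un
    using bounded_piece by (intro conjI bounded_UN finite_imp_bounded) auto
  then show "bounded (u ` {0..1})"
    by (rule bounded_subset) (use cover in blast)
  \<comment> \<open>\<open>F\<close> is 0 off the open pieces, so that it is continuous on the whole
    line except at partition points, whatever u is outside [0, 1].\<close>
  define F where "F x = (if x \<in> W then u x else 0)" for x
  have mono: "s i \<le> s j" if "i \<le> j" "j \<le> N" for i j
    using that
  proof (induction j rule: dec_induct)
    case (step n)
    then show ?case using s(3)[of n] by simp
  qed simp
  have W_sub: "W \<subseteq> {0<..<1}"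
  proof
    fix x assume "x \<in> W"
    then obtain i where i: "i < N" "s i < x" "x < s (Suc i)" by (auto simp: W_def)
    then show "x \<in> {0<..<1}"
      using mono[of 0 i] mono[of "Suc i" N] s(1,2) by auto
  qed
  have "F \<in> borel_measurable borel"
  proof (rule borel_measurable_continuous_countable_exceptions)
    show "countable (s ` {..N})" by simp
    have "continuous_on W u"
      unfolding W_def using cont by (intro continuous_on_open_UN) auto
    then have "continuous_on W F"
      by (rule continuous_on_eq) (simp add: F_def)
    moreover have "continuous_on (- {0..1}) F"
      by (rule continuous_on_eq[OF continuous_on_const[of _ 0]]) (use W_sub in \<open>auto simp: F_def\<close>)
    moreover have "open W" by (auto simp: W_def)
    ultimately have "continuous_on (W \<union> - {0..1}) F"
      by (intro continuous_on_open_Un) auto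
    then show "continuous_on (- s ` {..N}) F"
      by (rule continuous_on_subset) (use cover in auto)
  qed
  then have "F \<in> borel_measurable (lebesgue_on {0..1})"
    by (intro measurable_restrict_space1 measurable_completion) simp
  then show "u \<in> borel_measurable (lebesgue_on {0..1})"
  proof (rule measurable_discrete_difference[where X="s ` {..N} \<inter> {0..1}"])
    fix x assume "x \<in> space (lebesgue_on {0..1})" "x \<notin> s ` {..N} \<inter> {0..1}"
    then show "F x = u x" using cover by (auto simp: F_def)
  qed (auto simp: sets_restrict_space)
qed

section \<open>The Euler-Lagrange equation\<close>

text \<open>The mean value inequality for sin x - x cos a, whose derivative cos x - cos a is at most
  |h| in absolute value on the segment.\<close>

lemma sin_first_order_remainder: "\<bar>sin (a + h) - sin a - h * cos a\<bar> \<le> h\<^sup>2" for a h :: real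
proof -
  have "norm ((sin (a + h) - (a + h) * cos a) - (sin a - a * cos a)) \<le> \<bar>h\<bar> * norm ((a + h) - a)"
  proof (rule field_differentiable_bound[where S="{min a (a + h)..max a (a + h)}" and f="\<lambda>x. sin x - x * cos a" and f'="\<lambda>x. cos x - cos a"])
    fix x assume x: "x \<in> {min a (a + h)..max a (a + h)}"
    show "((\<lambda>x. sin x - x * cos a) has_real_derivative cos x - cos a) (at x within {min a (a + h)..max a (a + h)})"
      by (auto intro!: derivative_eq_intros)
    have "norm (cos x - cos a) \<le> 1 * norm (x - a)"
      by (rule field_differentiable_bound[where S=UNIV and f'="\<lambda>x. - sin x"])
         (auto intro!: derivative_eq_intros)
    then show "norm (cos x - cos a) \<le> \<bar>h\<bar>"
      using x by (auto simp: min_def max_def split: if_splits)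
  qed auto
  then show ?thesis
    by (simp add: algebra_simps power2_eq_square abs_mult_self_eq)
qed

lemma zero_of_quadratic_perturbation:
  fixes L C :: real
  assumes "\<And>e. 0 \<le> e * L + e\<^sup>2 * C" "0 \<le> C"
  shows "L = 0"
proof (rule ccontr)
  assume "L \<noteq> 0"
  \<comment> \<open>With this \<open>e\<close> the expression equals - L^2 / (C + 1)^2; the added 1
    covers C = 0.\<close>
  define e where "e = - L / (C + 1)"
  have "e * L + e\<^sup>2 * C = - (L\<^sup>2 / (C + 1)\<^sup>2)"
  proof -
    define E where "E = C + 1"
    have "E \<noteq> 0" "C = E - 1" using \<open>0 \<le> C\<close> by (auto simp: E_def)
    then show ?thesis
      unfolding e_def E_def[symmetric] by (simp add: \<open>C = E - 1\<close> field_simps power2_eq_square)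
  qed
  moreover have "0 < L\<^sup>2 / (C + 1)\<^sup>2"
    using \<open>L \<noteq> 0\<close> \<open>0 \<le> C\<close> by simp
  ultimately show False using assms(1)[of e] by linarith
qed

text \<open>The increment of the action is at most a quadratic polynomial in the size e of the
  variation, so its linear coefficient must vanish; no differentiation under the integral occurs.
  The test path \<open>path_from d w\<close> has a free initial value and a free end, which encodes
  the natural boundary conditions.\<close>

lemma euler_lagrange_weak:
  assumes u: "u \<in> borel_measurable (lebesgue_on {0..1})" "bounded (u ` {0..1})" and "0 < lam"
    and v: "square_integrable v"
    and min: "\<And>c' w. square_integrable w \<Longrightarrow> action lam u c v \<le> action lam u c' w"
    and w: "square_integrable w"
  shows "integral {0..1} (\<lambda>t. 2 * lam * (v t * w t) - u t * (cos (path_from c v t) * path_from d w t / 2)) = 0"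
proof -
  let ?\<phi> = "path_from c v" and ?\<eta> = "path_from d w"
  have vi: "v integrable_on {0..1}" and wi: "w integrable_on {0..1}"
    using v w by (auto intro: square_integrable_imp_integrable)
  note cont = continuous_on_path_from[OF vi, of c] continuous_on_path_from[OF wi, of d]
  obtain B where B: "\<And>t. t \<in> {0..1} \<Longrightarrow> \<bar>u t\<bar> \<le> B"
    using u(2) unfolding bounded_iff by (metis image_eqI real_norm_def)
  have "0 \<le> B" using B[of 0] by simp
  define l where "l t = 2 * lam * (v t * w t) - u t * (cos (?\<phi> t) * ?\<eta> t / 2)" for t
  \<comment> \<open>Majorant of the second-order terms: the kinetic part is exact, and B/2 times the
    square of the test path bounds the remainder of sin.\<close>
  define k where "k t = lam * (w t)\<^sup>2 + B / 2 * (?\<eta> t)\<^sup>2" for t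
  have l_int: "l integrable_on {0..1}"
    unfolding l_def
  proof (intro integrable_diff)
    show "(\<lambda>t. 2 * lam * (v t * w t)) integrable_on {0..1}"
      using square_integrable_mult[OF v w] set_lebesgue_integral_eq_integral(1) integrable_on_mult_right by blast
    have "(\<lambda>t. u t * (cos (?\<phi> t) * ?\<eta> t / 2)) absolutely_integrable_on {0..1}"
      by (intro bounded_measurable_mult_continuous u continuous_intros cont) auto
    then show "(\<lambda>t. u t * (cos (?\<phi> t) * ?\<eta> t / 2)) integrable_on {0..1}"
      using set_lebesgue_integral_eq_integral(1) by blast
  qed
  have k_int: "k integrable_on {0..1}"
    unfolding k_def
  proof (intro integrable_add)
    show "(\<lambda>t. lam * (w t)\<^sup>2) integrable_on {0..1}"
      using w by (intro integrable_on_mult_right) (auto simp: square_integrable_def)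
    show "(\<lambda>t. B / 2 * (?\<eta> t)\<^sup>2) integrable_on {0..1}"
      by (intro integrable_continuous_real continuous_intros cont)
  qed
  define A where "A c v t = lam * (v t)\<^sup>2 - u t * ((1 + sin (path_from c v t)) / 2)" for c v t
  have act: "action lam u c v = integral {0..1} (A c v)" for c v
    by (simp add: action_def A_def [abs_def])
  have A_int: "A c v integrable_on {0..1}" if "square_integrable v" for c v
    using action_integrable[OF u that] set_lebesgue_integral_eq_integral(1) unfolding A_def by blast
  have "0 \<le> e * integral {0..1} l + e\<^sup>2 * integral {0..1} k" for e
  proof -
    let ?v = "\<lambda>t. v t + e * w t" and ?c = "c + e * d"
    have sq: "square_integrable ?v"
      by (intro square_integrable_add square_integrable_cmult v w)
    have "action lam u ?c ?v - action lam u c v = integral {0..1} (\<lambda>t. A ?c ?v t - A c v t)"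
      unfolding act
      by (intro Henstock_Kurzweil_Integration.integral_diff [symmetric] A_int sq v)
    also have "\<dots> \<le> integral {0..1} (\<lambda>t. e * l t + e\<^sup>2 * k t)"
    proof (rule integral_le)
      show "(\<lambda>t. A ?c ?v t - A c v t) integrable_on {0..1}"
        by (intro integrable_diff A_int sq v)
      show "(\<lambda>t. e * l t + e\<^sup>2 * k t) integrable_on {0..1}"
        by (intro integrable_add integrable_on_mult_right l_int k_int)
      fix t :: real assume t: "t \<in> {0..1}"
      have p: "path_from ?c ?v t = ?\<phi> t + e * ?\<eta> t"
        by (rule path_from_linear[OF vi wi t])
      define R where "R = sin (?\<phi> t + e * ?\<eta> t) - sin (?\<phi> t) - e * ?\<eta> t * cos (?\<phi> t)"
      have "- (u t * R) \<le> \<bar>u t\<bar> * \<bar>R\<bar>"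
        by (metis abs_ge_minus_self abs_mult)
      also have "\<dots> \<le> B * (e * ?\<eta> t)\<^sup>2"
        unfolding R_def using B[OF t] \<open>0 \<le> B\<close> sin_first_order_remainder by (intro mult_mono) auto
      finally have "- (u t * R) / 2 \<le> B * (e * ?\<eta> t)\<^sup>2 / 2" by simp
      moreover have "A ?c ?v t - A c v t = e * l t + e\<^sup>2 * (lam * (w t)\<^sup>2) - (u t * R) / 2"
        unfolding A_def p l_def R_def by (simp add: algebra_simps power2_eq_square add_divide_distrib diff_divide_distrib)
      ultimately show "A ?c ?v t - A c v t \<le> e * l t + e\<^sup>2 * k t"
        by (simp add: k_def algebra_simps power_mult_distrib)
    qed
    also have "\<dots> = e * integral {0..1} l + e\<^sup>2 * integral {0..1} k"
      using l_int k_int by (simp add: Henstock_Kurzweil_Integration.integral_add integrable_on_mult_right)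
    finally show ?thesis using min[OF sq, of ?c] by simp
  qed
  moreover have "0 \<le> integral {0..1} k"
    using \<open>0 < lam\<close> \<open>0 \<le> B\<close> by (intro integral_nonneg k_int) (auto simp: k_def)
  ultimately have "integral {0..1} l = 0"
    by (rule zero_of_quadratic_perturbation)
  then show ?thesis by (simp add: l_def [abs_def])
qed

text \<open>Splitting at \<open>b\<close>, the function is the integral of \<open>k t * t\<close>
  over [0, b] plus b times the integral of \<open>k\<close> over [b, 1]. As \<open>k\<close> may
  jump, its increment from a to b is compared directly with the linear term: the error is the
  integral of k t (t - b), at most B (b - a)^2. So the derivative exists at every point of [0, 1],
  the ends included.\<close>

lemma min_kernel_has_derivative:
  fixes k :: "real \<Rightarrow> real"
  assumes k: "k absolutely_integrable_on {0..1}" and B: "\<And>t. t \<in> {0..1} \<Longrightarrow> \<bar>k t\<bar> \<le> B" and x: "x \<in> {0..1}"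
  shows "((\<lambda>b. integral {0..1} (\<lambda>t. k t * min t b)) has_real_derivative integral {x..1} k) (at x within {0..1})"
proof -
  define F where "F b = integral {0..1} (\<lambda>t. k t * min t b)" for b
  define R where "R a = integral {a..1} k" for a
  have "0 \<le> B" using B[of 0] by simp
  have k_int: "k integrable_on {0..1}"
    using k set_lebesgue_integral_eq_integral(1) by blast
  have k_sub: "k integrable_on {a..b}" if "0 \<le> a" "b \<le> 1" for a b
    using that by (intro integrable_subinterval_real[OF k_int]) auto
  have kg: "(\<lambda>t. k t * g t) integrable_on {a..b}" if "continuous_on {0..1} g" "0 \<le> a" "b \<le> 1" for g a b
  proof -
    have "(\<lambda>t. g t * k t) absolutely_integrable_on {0..1}"
      by (rule absolutely_integrable_bounded_measurable_product_real[OF _ _ _ k])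
        (use that(1) in \<open>auto intro!: continuous_imp_measurable_on_sets_lebesgue compact_imp_bounded compact_continuous_image\<close>)
    then have "(\<lambda>t. g t * k t) integrable_on {0..1}"
      using set_lebesgue_integral_eq_integral(1) by blast
    then have "(\<lambda>t. k t * g t) integrable_on {0..1}"
      by (simp only: mult.commute)
    then show ?thesis
      by (rule integrable_subinterval_real) (use that in auto)
  qed
  have bound: "\<bar>integral {a..b} (\<lambda>t. k t * g t)\<bar> \<le> B * K * (b - a)"
    if "continuous_on {0..1} g" "0 \<le> a" "a \<le> b" "b \<le> 1" "\<And>t. t \<in> {a..b} \<Longrightarrow> \<bar>g t\<bar> \<le> K" for g a b K
  proof -
    have "norm (integral {a..b} (\<lambda>t. k t * g t)) \<le> integral {a..b} (\<lambda>t. B * K)"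
    proof (rule integral_norm_bound_integral)
      fix t assume t: "t \<in> {a..b}"
      then have "\<bar>k t\<bar> * \<bar>g t\<bar> \<le> B * K"
        using B[of t] that \<open>0 \<le> B\<close> by (intro mult_mono) auto
      then show "norm (k t * g t) \<le> B * K" by (simp add: abs_mult)
    qed (use kg that in auto)
    then show ?thesis using that by (simp add: algebra_simps)
  qed
  have F: "F b = integral {0..b} (\<lambda>t. k t * t) + b * R b" if b: "b \<in> {0..1}" for b
  proof -
    have "F b = integral {0..b} (\<lambda>t. k t * min t b) + integral {b..1} (\<lambda>t. k t * min t b)"
      unfolding F_def using b
      by (intro Henstock_Kurzweil_Integration.integral_combine[symmetric] kg continuous_intros) auto
    also have "integral {0..b} (\<lambda>t. k t * min t b) = integral {0..b} (\<lambda>t. k t * t)"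
      by (intro integral_cong) auto
    also have "integral {b..1} (\<lambda>t. k t * min t b) = integral {b..1} (\<lambda>t. b * k t)"
      by (intro integral_cong) auto
    finally show ?thesis using b k_sub[of b 1] by (simp add: R_def)
  qed
  have diff: "\<bar>F b - F a - (b - a) * R a\<bar> \<le> B * (b - a)\<^sup>2" if ab: "0 \<le> a" "a \<le> b" "b \<le> 1" for a b
  proof -
    have "integral {0..a} (\<lambda>t. k t * t) + integral {a..b} (\<lambda>t. k t * t) = integral {0..b} (\<lambda>t. k t * t)"
      using ab by (intro Henstock_Kurzweil_Integration.integral_combine kg continuous_intros) auto
    moreover have "integral {a..b} k + R b = R a"
      unfolding R_def using ab by (intro Henstock_Kurzweil_Integration.integral_combine k_sub) auto
    ultimately have "F b - F a - (b - a) * R a = integral {a..b} (\<lambda>t. k t * t) - b * integral {a..b} k"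
      using ab F[of a] F[of b] by (simp add: algebra_simps) (simp flip: distrib_left)
    also have "\<dots> = integral {a..b} (\<lambda>t. k t * t - b * k t)"
      using ab kg[of "\<lambda>t. t" a b] k_sub[of a b]
      by (subst Henstock_Kurzweil_Integration.integral_diff) (auto intro: integrable_on_mult_right)
    also have "\<dots> = integral {a..b} (\<lambda>t. k t * (t - b))"
      by (simp add: algebra_simps)
    also have "\<bar>\<dots>\<bar> \<le> B * (b - a) * (b - a)"
      using ab by (intro bound continuous_intros) auto
    finally show ?thesis by (simp add: power2_eq_square)
  qed
  \<comment> \<open>For y < x the estimate \<open>diff\<close> has its base at y; moving from
    \<open>R y\<close> to \<open>R x\<close> costs another B (y - x)^2, whence the factor 2.\<close>
  have quad: "\<bar>F y - F x - (y - x) * R x\<bar> \<le> 2 * B * (y - x)\<^sup>2" if y: "y \<in> {0..1}" for y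
  proof (cases "x \<le> y")
    case True
    then show ?thesis
      using diff[of x y] x y \<open>0 \<le> B\<close> by (auto intro: order.trans)
  next
    case False
    have "integral {y..x} k + R x = R y"
      unfolding R_def using False x y by (intro Henstock_Kurzweil_Integration.integral_combine k_sub) auto
    then have "\<bar>R y - R x\<bar> \<le> B * (x - y)"
      using bound[of "\<lambda>_. 1" y x 1] False x y by simp
    then have "\<bar>x - y\<bar> * \<bar>R y - R x\<bar> \<le> \<bar>x - y\<bar> * (B * (x - y))"
      by (rule mult_left_mono) simp
    also have "\<bar>x - y\<bar> * (B * (x - y)) = B * (y - x)\<^sup>2"
      using False by (simp add: power2_eq_square algebra_simps)
    finally have "\<bar>(x - y) * (R y - R x)\<bar> \<le> B * (y - x)\<^sup>2"
      by (simp only: abs_mult)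
    moreover have "\<bar>F x - F y - (x - y) * R y\<bar> \<le> B * (y - x)\<^sup>2"
      using diff[of y x] x y False by (simp add: power2_commute)
    moreover have "F y - F x - (y - x) * R x = - (F x - F y - (x - y) * R y) - (x - y) * (R y - R x)"
      by (simp add: algebra_simps)
    ultimately show ?thesis by linarith
  qed
  have "((\<lambda>y. (F y - F x) / (y - x) - R x) \<longlongrightarrow> 0) (at x within {0..1})"
  proof (rule Lim_null_comparison[where g="\<lambda>y. 2 * B * \<bar>y - x\<bar>"])
    have "norm ((F y - F x) / (y - x) - R x) \<le> 2 * B * \<bar>y - x\<bar>" if y: "y \<in> {0..1}" "y \<noteq> x" for y
    proof -
      have "(F y - F x) / (y - x) - R x = (F y - F x - (y - x) * R x) / (y - x)"
        using y by (simp add: field_simps)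
      then have "norm ((F y - F x) / (y - x) - R x) = \<bar>F y - F x - (y - x) * R x\<bar> / \<bar>y - x\<bar>"
        by (simp add: abs_divide)
      also have "\<dots> \<le> 2 * B * (y - x)\<^sup>2 / \<bar>y - x\<bar>"
        using quad[OF y(1)] by (intro divide_right_mono) auto
      also have "\<dots> = 2 * B * \<bar>y - x\<bar>"
        using y by (simp add: power2_eq_square field_simps abs_mult_self_eq flip: abs_mult)
      finally show ?thesis .
    qed
    then show "\<forall>\<^sub>F y in at x within {0..1}. norm ((F y - F x) / (y - x) - R x) \<le> 2 * B * \<bar>y - x\<bar>"
      by (auto simp: eventually_at_filter)
    have "((\<lambda>y. 2 * B * \<bar>y - x\<bar>) \<longlongrightarrow> 2 * B * \<bar>x - x\<bar>) (at x within {0..1})"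
      by (intro tendsto_intros)
    then show "((\<lambda>y. 2 * B * \<bar>y - x\<bar>) \<longlongrightarrow> 0) (at x within {0..1})" by simp
  qed
  then have "((\<lambda>y. (F y - F x) / (y - x)) \<longlongrightarrow> R x) (at x within {0..1})"
    by (simp add: LIM_zero_iff)
  then show ?thesis
    by (simp add: has_field_derivative_iff F_def R_def)
qed

text \<open>Testing the weak equation with \<open>\<eta> = 1\<close> and with \<open>\<eta> t = min t b\<close> (whose derivative is the
  indicator of \<open>[0, b]\<close>) yields the solution in closed form, without integration by parts.\<close>

lemma euler_lagrange:
  assumes u: "u \<in> borel_measurable (lebesgue_on {0..1})" "bounded (u ` {0..1})" and "0 < lam"
    and v: "square_integrable v"
    and min: "\<And>c' w. square_integrable w \<Longrightarrow> action lam u c v \<le> action lam u c' w"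
  shows "integral {0..1} (\<lambda>t. u t * cos (path_from c v t)) = 0"
    and "\<And>x. x \<in> {0..1} \<Longrightarrow> (path_from c v has_real_derivative
      integral {x..1} (\<lambda>t. u t * cos (path_from c v t)) / (4 * lam)) (at x within {0..1})"
proof -
  define k where "k t = u t * cos (path_from c v t)" for t
  have EL: "integral {0..1} (\<lambda>t. 2 * lam * (v t * w t) - u t * (cos (path_from c v t) * path_from d w t / 2)) = 0"
    if "square_integrable w" for d w
    by (rule euler_lagrange_weak[OF u \<open>0 < lam\<close> v]) (rule min, assumption, rule that)
  have vi: "v integrable_on {0..1}" using v by (rule square_integrable_imp_integrable)
  have k_abs: "k absolutely_integrable_on {0..1}"
    unfolding k_def by (intro bounded_measurable_mult_continuous u continuous_intros continuous_on_path_from vi)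
  have kg: "(\<lambda>t. k t * g t) integrable_on {0..1}" if "continuous_on {0..1} g" for g
  proof -
    have "(\<lambda>t. u t * (cos (path_from c v t) * g t)) absolutely_integrable_on {0..1}"
      by (intro bounded_measurable_mult_continuous u continuous_intros continuous_on_path_from vi that)
    then show ?thesis
      using set_lebesgue_integral_eq_integral(1) by (auto simp: k_def mult.assoc)
  qed
  obtain B where B: "\<And>t. t \<in> {0..1} \<Longrightarrow> \<bar>u t\<bar> \<le> B"
    using u(2) unfolding bounded_iff by (metis image_eqI real_norm_def)
  have kB: "\<bar>k t\<bar> \<le> B" if "t \<in> {0..1}" for t
    using mult_mono[of "\<bar>u t\<bar>" B "\<bar>cos (path_from c v t)\<bar>" 1] B[OF that] by (simp add: k_def abs_mult)
  have "integral {0..1} (\<lambda>t. - (1 / 2) * k t) = 0"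
    using EL[OF square_integrable_const[of 0], of 1] by (simp add: path_from_def k_def)
  then show k0: "integral {0..1} (\<lambda>t. u t * cos (path_from c v t)) = 0"
    by (simp add: k_def)
  have path: "path_from c v b = c + integral {0..1} (\<lambda>t. k t * min t b) / (4 * lam)" if b: "b \<in> {0..1}" for b
  proof -
    define w where "w t = (if t \<in> {0..b} then 1 else 0 :: real)" for t
    have w_int: "integral {0..t} (\<lambda>s. f s * w s) = integral {0..min t b} f" if "t \<in> {0..1}" for t and f :: "real \<Rightarrow> real"
    proof -
      have "integral {0..t} (\<lambda>s. f s * w s) = integral {0..t} (\<lambda>s. if s \<in> {0..b} then f s else 0)"
        by (intro integral_cong) (auto simp: w_def)
      also have "\<dots> = integral ({0..b} \<inter> {0..t}) f"
        by (rule integral_restrict_Int)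
      also have "{0..b} \<inter> {0..t} = {0..min t b}"
        using b that by auto
      finally show ?thesis .
    qed
    have "w \<in> borel_measurable (lebesgue_on {0..1})"
      unfolding w_def by (intro measurable_restrict_space1 measurable_completion) simp
    then have w: "square_integrable w"
      by (rule square_integrable_bounded[of _ 1]) (auto simp: w_def)
    have pw: "path_from 0 w t = min t b" if "t \<in> {0..1}" for t
      using w_int[OF that, of "\<lambda>_. 1"] that b by (simp add: path_from_def)
    have vw: "(\<lambda>t. v t * w t) integrable_on {0..1}"
      using square_integrable_mult[OF v w] set_lebesgue_integral_eq_integral(1) by blast
    have "0 = integral {0..1} (\<lambda>t. 2 * lam * (v t * w t) - u t * (cos (path_from c v t) * path_from 0 w t / 2))"
      using EL[OF w, of 0] by simp
    also have "\<dots> = integral {0..1} (\<lambda>t. 2 * lam * (v t * w t) - 1 / 2 * (k t * min t b))"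
      by (intro integral_cong) (simp add: pw k_def)
    also have "\<dots> = 2 * lam * integral {0..1} (\<lambda>t. v t * w t) - 1 / 2 * integral {0..1} (\<lambda>t. k t * min t b)"
    proof -
      have "(\<lambda>t. k t * min t b) integrable_on {0..1}"
        by (intro kg continuous_intros)
      then show ?thesis
        using vw by (subst Henstock_Kurzweil_Integration.integral_diff) (auto intro: integrable_on_mult_right integrable_on_divide)
    qed
    also have "integral {0..1} (\<lambda>t. v t * w t) = integral {0..b} v"
      using w_int[of 1 v] b by simp
    finally show ?thesis
      using \<open>0 < lam\<close> by (simp add: path_from_def field_simps)
  qed
  fix x :: real assume x: "x \<in> {0..1}"
  have "((\<lambda>b. c + integral {0..1} (\<lambda>t. k t * min t b) / (4 * lam)) has_real_derivative
      integral {x..1} k / (4 * lam)) (at x within {0..1})"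
    using DERIV_add[OF DERIV_const DERIV_cdivide[OF min_kernel_has_derivative[OF k_abs kB x]], of c "4 * lam"]
    by simp
  then have "(path_from c v has_real_derivative integral {x..1} k / (4 * lam)) (at x within {0..1})"
    by (rule has_field_derivative_transform_within[OF _ zero_less_one x]) (simp add: path)
  then show "(path_from c v has_real_derivative
      integral {x..1} (\<lambda>t. u t * cos (path_from c v t)) / (4 * lam)) (at x within {0..1})"
    by (simp add: k_def [abs_def])
qed

section \<open>Symmetry of minimizers\<close>

lemma has_integral_reflect_unit:
  fixes f :: "real \<Rightarrow> real"
  assumes "(f has_integral i) {a..b}"
  shows "((\<lambda>x. f (1 - x)) has_integral i) {1 - b..1 - a}"
proof (cases "a \<le> b")
  case True
  have "(f has_integral i) (cbox a b)" using assms by simp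
  from has_integral_affinity[OF this, of "-1" 1] have "((\<lambda>x. f (1 - x)) has_integral i) ((\<lambda>x. 1 - x) ` {a..b})"
    by simp
  moreover have "(\<lambda>x. 1 - x) ` {a..b} = {1 - b..1 - a}"
    by simp
  ultimately show ?thesis by simp
next
  case False
  then show ?thesis using assms by simp
qed

lemma integral_reflect_unit:
  fixes f :: "real \<Rightarrow> real"
  assumes "f integrable_on {a..b}"
  shows "(\<lambda>x. f (1 - x)) integrable_on {1 - b..1 - a}"
    "integral {1 - b..1 - a} (\<lambda>x. f (1 - x)) = integral {a..b} f"
  using has_integral_reflect_unit[OF integrable_integral[OF assms]]
  by (auto intro: has_integral_integrable integral_unique)

text \<open>As u may jump, the argument is measure-theoretic: a nonnegative function with zero
  integral vanishes a.e., and a nonempty open interval is not null. The auxiliary \<open>g\<close>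
  is 0 at the endpoints, where the sign of \<open>f\<close> is unknown.\<close>

lemma integral_strictly_positive:
  fixes f :: "real \<Rightarrow> real"
  assumes ab: "a < b" and f: "f integrable_on {a..b}" and pos: "\<And>x. x \<in> {a<..<b} \<Longrightarrow> 0 < f x"
  shows "0 < integral {a..b} f"
proof (rule ccontr)
  define g where "g x = (if x \<in> {a<..<b} then f x else 0)" for x
  have eq: "integral {a..b} g = integral {a..b} f"
    by (rule integral_spike[of "{a, b}"]) (auto simp: g_def)
  have g: "g integrable_on {a..b}"
    by (rule integrable_spike[OF f, of "{a, b}"]) (auto simp: g_def)
  have nonneg: "0 \<le> g x" for x using pos[of x] by (auto simp: g_def intro: less_imp_le)
  have gpos: "g x \<noteq> 0" if "a < x" "x < b" for x
    using pos[of x] that by (simp add: g_def)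
  assume "\<not> 0 < integral {a..b} f"
  then have "integral {a..b} g = 0"
    using integral_nonneg[OF g] nonneg eq by fastforce
  have "g absolutely_integrable_on {a..b}"
    using g nonneg by (rule nonnegative_absolutely_integrable_1)
  then have int: "integrable (lebesgue_on {a..b}) g" "integral\<^sup>L (lebesgue_on {a..b}) g = 0"
    using \<open>integral {a..b} g = 0\<close> by (auto simp: integrable_restrict_space set_integrable_def lebesgue_integral_eq_integral)
  then have "AE x in lebesgue_on {a..b}. g x = 0"
    using integral_nonneg_eq_0_iff_AE[OF int(1)] nonneg by auto
  then have "AE x in lebesgue. x \<notin> {a<..<b}"
    using gpos by (subst (asm) AE_restrict_space_iff) (auto elim!: eventually_mono)
  then have "{a<..<b} \<in> null_sets lebesgue"
    by (simp add: AE_iff_null_sets)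
  then show False
    using ab by auto
qed

text \<open>The derivative cos y - 1/2 is nonnegative on [0, 1] because 1 < \<pi>/3. The bound
  estimates the gain of the trial angle in \<open>exists_negative_action\<close>.\<close>

lemma half_le_sin:
  fixes x :: real
  assumes "0 \<le> x" "x \<le> 1"
  shows "x / 2 \<le> sin x"
proof -
  have "sin 0 - 0 / 2 \<le> sin x - x / 2"
  proof (rule DERIV_nonneg_imp_nondecreasing[OF assms(1)])
    fix y assume y: "0 \<le> y" "y \<le> x"
    have "1 / 2 \<le> cos y"
      using cos_monotone_0_pi_le[of y "pi / 3"] y assms pi_gt3 by (simp add: cos_60)
    then show "\<exists>d. ((\<lambda>x. sin x - x / 2) has_real_derivative d) (at y) \<and> 0 \<le> d"
      by (intro exI[of _ "cos y - 1 / 2"]) (auto intro!: derivative_eq_intros)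
  qed
  then show ?thesis by simp
qed

locale antisymmetric_utility =
  fixes u :: "real \<Rightarrow> real"
  assumes measurable: "u \<in> borel_measurable (lebesgue_on {0..1})"
    and bounded: "bounded (u ` {0..1})"
    and antisymmetric: "\<And>t. t \<in> {0..1} \<Longrightarrow> u t = - u (1 - t)"
    and negative: "\<And>t. t \<in> {0..<1/2} \<Longrightarrow> u t < 0"
begin

lemma positive: "t \<in> {1/2<..1} \<Longrightarrow> 0 < u t"
  using antisymmetric[of t] negative[of "1 - t"] by auto

lemma sign:
  assumes "t \<in> {0..1}"
  shows "t \<le> 1/2 \<Longrightarrow> u t \<le> 0" "1/2 \<le> t \<Longrightarrow> 0 \<le> u t"
proof -
  have half: "u (1/2) = 0" using antisymmetric[of "1/2"] by simp
  show "u t \<le> 0" if "t \<le> 1/2"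
  proof (cases "t < 1/2")
    case True
    then show ?thesis using negative[of t] assms by simp
  next
    case False
    then have "t = 1/2" using that by simp
    then show ?thesis by (simp only: half)
  qed
  show "0 \<le> u t" if "1/2 \<le> t"
  proof (cases "1/2 < t")
    case True
    then show ?thesis using positive[of t] assms by simp
  next
    case False
    then have "t = 1/2" using that by simp
    then show ?thesis by (simp only: half)
  qed
qed

section \<open>Pairing with an antisymmetric function\<close>

lemma mult_integrable:
  assumes "continuous_on {0..1} g"
  shows "(\<lambda>t. u t * g t) integrable_on {0..1}"
  using bounded_measurable_mult_continuous[OF measurable bounded assms] set_lebesgue_integral_eq_integral(1)
  by blast

lemma continuous_on_reflect:
  fixes g :: "real \<Rightarrow> real"
  assumes "continuous_on {0..1} g"
  shows "continuous_on {0..1} (\<lambda>t. g (1 - t))"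
  by (rule continuous_on_compose2[OF assms]) (auto intro!: continuous_intros)

lemma integral_antisymmetrize:
  assumes g: "continuous_on {0..1} g"
  shows "integral {0..1} (\<lambda>t. u t * g t) = integral {0..1} (\<lambda>t. u t * ((g t - g (1 - t)) / 2))"
proof -
  note int = mult_integrable[OF g] mult_integrable[OF continuous_on_reflect[OF g]]
  have "integral {0..1} (\<lambda>t. u t * g t) = integral {0..1} (\<lambda>t. u (1 - t) * g (1 - t))"
    using integral_reflect_unit(2)[OF int(1)] by simp
  also have "\<dots> = integral {0..1} (\<lambda>t. - (u t * g (1 - t)))"
  proof (rule integral_cong)
    fix t :: real assume "t \<in> {0..1}"
    from antisymmetric[OF this] show "u (1 - t) * g (1 - t) = - (u t * g (1 - t))"
      by simp
  qed
  finally have "integral {0..1} (\<lambda>t. u t * g t) = - integral {0..1} (\<lambda>t. u t * g (1 - t))"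
    by simp
  moreover have "integral {0..1} (\<lambda>t. u t * ((g t - g (1 - t)) / 2)) =
      integral {0..1} (\<lambda>t. (u t * g t - u t * g (1 - t)) / 2)"
    by (intro integral_cong) (simp add: algebra_simps diff_divide_distrib)
  moreover have "\<dots> = (integral {0..1} (\<lambda>t. u t * g t) - integral {0..1} (\<lambda>t. u t * g (1 - t))) / 2"
    using int by (simp add: Henstock_Kurzweil_Integration.integral_diff)
  ultimately show ?thesis by simp
qed

text \<open>Only the odd part of (1 + sin \<phi>) / 2 pairs with u, and the formula for a difference
  of sines separates the odd part of \<phi>, inside sin, from its even part, inside cos.\<close>

lemma action_antisymmetrize:
  assumes v: "square_integrable v"
  shows "action lam u c v = lam * integral {0..1} (\<lambda>t. (v t)\<^sup>2) -
    integral {0..1} (\<lambda>t. u t * (sin ((path_from c v t - path_from c v (1 - t)) / 2) *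
      cos ((path_from c v t + path_from c v (1 - t)) / 2) / 2))"
proof -
  let ?\<phi> = "path_from c v"
  have g: "continuous_on {0..1} (\<lambda>t. (1 + sin (?\<phi> t)) / 2)"
    by (intro continuous_intros continuous_on_path_from square_integrable_imp_integrable v) auto
  have "action lam u c v = lam * integral {0..1} (\<lambda>t. (v t)\<^sup>2) - integral {0..1} (\<lambda>t. u t * ((1 + sin (?\<phi> t)) / 2))"
    unfolding action_def using v mult_integrable[OF g]
    by (subst Henstock_Kurzweil_Integration.integral_diff) (auto simp: square_integrable_def intro: integrable_on_mult_right)
  also have "integral {0..1} (\<lambda>t. u t * ((1 + sin (?\<phi> t)) / 2)) =
      integral {0..1} (\<lambda>t. u t * ((sin (?\<phi> t) - sin (?\<phi> (1 - t))) / 4))"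
    by (subst integral_antisymmetrize[OF g]) (simp add: field_simps flip: diff_divide_distrib)
  finally show ?thesis
    by (simp add: sin_diff_sin mult.commute)
qed

text \<open>For the angle e (t - 1/2) the energy is of order e^2 but the gain of order e. This
  excludes minimizers whose odd part vanishes, since their action is at least 0.\<close>

lemma exists_negative_action:
  assumes "0 < lam"
  shows "\<exists>c v. square_integrable v \<and> action lam u c v < 0"
proof -
  define C where "C = integral {0..1} (\<lambda>t. u t * (t - 1/2))"
  have int: "(\<lambda>t. u t * (t - 1/2)) integrable_on {0..1}"
    by (intro mult_integrable continuous_intros)
  have nonneg: "0 \<le> u t * (t - 1/2)" if "t \<in> {0..1}" for t
    using sign[OF that] by (cases "t \<le> 1/2") (auto intro: mult_nonneg_nonneg mult_nonpos_nonpos)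
  have "0 < integral {0..1/2} (\<lambda>t. u t * (t - 1/2))"
    by (rule integral_strictly_positive) (auto intro!: integrable_subinterval_real[OF int] mult_neg_neg negative)
  also have "\<dots> \<le> C"
    unfolding C_def by (rule integral_subset_le) (use nonneg in \<open>auto intro!: integrable_subinterval_real[OF int]\<close>)
  finally have "0 < C" .
  \<comment> \<open>The bound 1 allows \<open>half_le_sin\<close>, and lam e <= C/8 is below the
    gain C/4 per unit of e.\<close>
  define e where "e = min 1 (C / (8 * lam))"
  have e: "0 < e" "e \<le> 1" "lam * e \<le> C / 8"
    using \<open>0 < C\<close> \<open>0 < lam\<close> by (auto simp: e_def min_def field_simps)
  have path: "path_from (- e / 2) (\<lambda>_. e) t = e * (t - 1/2)" if "t \<in> {0..1}" for t
    using that by (simp add: path_from_def algebra_simps)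
  have "e / 4 * C = integral {0..1} (\<lambda>t. e / 4 * (u t * (t - 1/2)))"
    by (simp add: C_def)
  also have "\<dots> \<le> integral {0..1} (\<lambda>t. u t * (sin (e * (t - 1/2)) / 2))"
  proof (rule integral_le)
    show "(\<lambda>t. e / 4 * (u t * (t - 1/2))) integrable_on {0..1}"
      by (intro integrable_on_mult_right int)
    show "(\<lambda>t. u t * (sin (e * (t - 1/2)) / 2)) integrable_on {0..1}"
      by (intro mult_integrable continuous_intros) auto
    fix t :: real assume t: "t \<in> {0..1}"
    show "e / 4 * (u t * (t - 1/2)) \<le> u t * (sin (e * (t - 1/2)) / 2)"
    proof (cases "t \<le> 1/2")
      case True
      have "e * (1/2 - t) \<le> 1 * 1" using e t True by (intro mult_mono) auto
      then have "e * (1/2 - t) / 2 \<le> sin (e * (1/2 - t))"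
        using e True by (intro half_le_sin) auto
      moreover have "sin (e * (1/2 - t)) = - sin (e * (t - 1/2))"
        by (metis minus_diff_eq mult_minus_right sin_minus)
      ultimately have "sin (e * (t - 1/2)) \<le> e * (t - 1/2) / 2" by (simp add: algebra_simps)
      then have "u t * (e * (t - 1/2) / 2) \<le> u t * sin (e * (t - 1/2))"
        using sign(1)[OF t True] by (rule mult_left_mono_neg)
      then show ?thesis by (simp add: algebra_simps)
    next
      case False
      have "e * (t - 1/2) \<le> 1 * 1" using e t False by (intro mult_mono) auto
      then have "e * (t - 1/2) / 2 \<le> sin (e * (t - 1/2))"
        using e False by (intro half_le_sin) auto
      then have "u t * (e * (t - 1/2) / 2) \<le> u t * sin (e * (t - 1/2))"
        using sign(2)[OF t] False by (intro mult_left_mono) auto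
      then show ?thesis by (simp add: algebra_simps)
    qed
  qed
  also have "\<dots> = integral {0..1} (\<lambda>t. u t * (sin ((path_from (- e / 2) (\<lambda>_. e) t - path_from (- e / 2) (\<lambda>_. e) (1 - t)) / 2) *
      cos ((path_from (- e / 2) (\<lambda>_. e) t + path_from (- e / 2) (\<lambda>_. e) (1 - t)) / 2) / 2))"
  proof (rule integral_cong)
    fix t :: real assume t: "t \<in> {0..1}"
    then have "1 - t \<in> {0..1}" by simp
    then have "(path_from (- e / 2) (\<lambda>_. e) t - path_from (- e / 2) (\<lambda>_. e) (1 - t)) / 2 = e * (t - 1/2)"
      "(path_from (- e / 2) (\<lambda>_. e) t + path_from (- e / 2) (\<lambda>_. e) (1 - t)) / 2 = 0"
      unfolding path[OF t] path[OF \<open>1 - t \<in> {0..1}\<close>] by (simp_all add: field_simps)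
    then show "u t * (sin (e * (t - 1/2)) / 2) =
      u t * (sin ((path_from (- e / 2) (\<lambda>_. e) t - path_from (- e / 2) (\<lambda>_. e) (1 - t)) / 2) *
      cos ((path_from (- e / 2) (\<lambda>_. e) t + path_from (- e / 2) (\<lambda>_. e) (1 - t)) / 2) / 2)"
      by (simp only: cos_zero mult_1_right)
  qed
  finally have "action lam u (- e / 2) (\<lambda>_. e) \<le> lam * e\<^sup>2 - e / 4 * C"
    unfolding action_antisymmetrize[OF square_integrable_const] by simp
  also have "\<dots> = e * (lam * e - C / 4)"
    by (simp add: algebra_simps power2_eq_square)
  also have "\<dots> < 0"
    using e \<open>0 < C\<close> by (intro mult_pos_neg) auto
  finally show ?thesis
    using square_integrable_const by blast
qed

section \<open>Monotonicity and oddness of a minimizer\<close>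

context
  fixes lam c :: real and v :: "real \<Rightarrow> real"
  assumes lam: "0 < lam" and v: "square_integrable v"
    and minimal: "\<And>c' w. square_integrable w \<Longrightarrow> action lam u c v \<le> action lam u c' w"
    and range: "\<And>t. t \<in> {0..1} \<Longrightarrow> \<bar>path_from c v t\<bar> \<le> pi / 2"
begin

abbreviation (input) phi :: "real \<Rightarrow> real" where "phi \<equiv> path_from c v"

lemma phi_continuous: "continuous_on {0..1} phi"
  by (intro continuous_on_path_from square_integrable_imp_integrable v)

lemma cos_phi_nonneg: "t \<in> {0..1} \<Longrightarrow> 0 \<le> cos (phi t)"
  using range[of t] by (intro cos_ge_zero) auto

lemma force_integrable:
  assumes "0 \<le> a" "b \<le> 1"
  shows "(\<lambda>t. u t * cos (phi t)) integrable_on {a..b}"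
proof -
  have "(\<lambda>t. u t * cos (phi t)) integrable_on {0..1}"
    by (intro mult_integrable continuous_intros phi_continuous)
  then show ?thesis
    by (rule integrable_subinterval_real) (use assms in auto)
qed

text \<open>The force u cos \<phi> is nonpositive before 1/2 and nonnegative after it, with total
  integral 0. So its integral up to x is nonpositive: directly for x <= 1/2, and otherwise as the
  negative of the integral over the rest.\<close>

lemma phi_derivative:
  assumes x: "x \<in> {0..1}"
  shows "(phi has_real_derivative - integral {0..x} (\<lambda>t. u t * cos (phi t)) / (4 * lam)) (at x within {0..1})"
    and "integral {0..x} (\<lambda>t. u t * cos (phi t)) \<le> 0"
proof -
  have EL: "integral {0..1} (\<lambda>t. u t * cos (phi t)) = 0"
    "(phi has_real_derivative integral {x..1} (\<lambda>t. u t * cos (phi t)) / (4 * lam)) (at x within {0..1})"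
    using euler_lagrange[OF measurable bounded lam v] minimal x by blast+
  have "integral {0..x} (\<lambda>t. u t * cos (phi t)) + integral {x..1} (\<lambda>t. u t * cos (phi t)) =
      integral {0..1} (\<lambda>t. u t * cos (phi t))"
    using x
    by (intro Henstock_Kurzweil_Integration.integral_combine force_integrable) auto
  then have eq: "integral {x..1} (\<lambda>t. u t * cos (phi t)) = - integral {0..x} (\<lambda>t. u t * cos (phi t))"
    using EL(1) by simp
  show "(phi has_real_derivative - integral {0..x} (\<lambda>t. u t * cos (phi t)) / (4 * lam)) (at x within {0..1})"
    using EL(2) by (simp only: eq)
  show "integral {0..x} (\<lambda>t. u t * cos (phi t)) \<le> 0"
  proof (cases "x \<le> 1/2")
    case True
    have "integral {0..x} (\<lambda>t. u t * cos (phi t)) \<le> integral {0..x} (\<lambda>t. 0)"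
      using True x sign cos_phi_nonneg
      by (intro integral_le force_integrable) (auto intro!: mult_nonpos_nonneg)
    then show ?thesis by simp
  next
    case False
    have "0 \<le> integral {x..1} (\<lambda>t. u t * cos (phi t))"
      using False x sign cos_phi_nonneg
      by (intro integral_nonneg force_integrable) (auto intro!: mult_nonneg_nonneg)
    then show ?thesis using eq by simp
  qed
qed

lemma phi_mono:
  assumes "0 \<le> s" "s \<le> t" "t \<le> 1"
  shows "phi s \<le> phi t"
proof (rule DERIV_nonneg_imp_increasing_open[OF assms(2)])
  fix x assume x: "s < x" "x < t"
  then have "(phi has_real_derivative - integral {0..x} (\<lambda>t. u t * cos (phi t)) / (4 * lam)) (at x)"
    using phi_derivative(1)[of x] assms at_within_Icc_at[of 0 x 1] by simp
  moreover have "0 \<le> - integral {0..x} (\<lambda>t. u t * cos (phi t)) / (4 * lam)"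
    using phi_derivative(2)[of x] x assms lam by (intro divide_nonneg_pos) auto
  ultimately show "\<exists>y. (phi has_real_derivative y) (at x) \<and> 0 \<le> y"
    by blast
next
  show "continuous_on {s..t} phi"
    by (rule continuous_on_subset[OF phi_continuous]) (use assms in auto)
qed

text \<open>The odd part of \<open>\<phi>\<close> about \<open>1/2\<close> has smaller action than \<open>\<phi>\<close>, strictly so unless \<open>\<phi>\<close> is odd.\<close>

lemma phi_odd:
  assumes t: "t \<in> {0..1}"
  shows "phi (1 - t) = - phi t"
proof -
  \<comment> \<open>\<open>d\<close> and \<open>m\<close> are the odd and even parts of \<phi> about
    1/2; below, \<open>w\<close> and \<open>g\<close> are their velocities.\<close>
  define d where "d t = (phi t - phi (1 - t)) / 2" for t
  define m where "m t = (phi t + phi (1 - t)) / 2" for t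
  define vr where "vr t = v (1 - t)" for t
  define w where "w t = 1/2 * v t + 1/2 * vr t" for t
  define g where "g t = 1/2 * v t + (- 1/2) * vr t" for t
  have vi: "v integrable_on {0..1}" using v by (rule square_integrable_imp_integrable)
  have v2: "(\<lambda>t. (v t)\<^sup>2) integrable_on {0..1}" using v by (simp add: square_integrable_def)
  have vri: "vr integrable_on {0..1}"
    using integral_reflect_unit(1)[OF vi] by (simp add: vr_def [abs_def])
  have vr2: "(\<lambda>t. (vr t)\<^sup>2) integrable_on {0..1}"
    "integral {0..1} (\<lambda>t. (vr t)\<^sup>2) = integral {0..1} (\<lambda>t. (v t)\<^sup>2)"
    using integral_reflect_unit[OF v2] by (auto simp: vr_def)
  have vr: "square_integrable vr"
    unfolding square_integrable_def using vr2 integrable_imp_measurable[OF vri] by blast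
  have w: "square_integrable w" and g: "square_integrable g"
    unfolding w_def g_def by (intro square_integrable_add square_integrable_cmult v vr)+
  have gi: "g integrable_on {0..1}" using g by (rule square_integrable_imp_integrable)
  have vr_path: "integral {0..t} vr = phi 1 - phi (1 - t)" if "t \<in> {0..1}" for t
  proof -
    have "v integrable_on {1 - t..1}"
      by (rule integrable_subinterval_real[OF vi]) (use that in auto)
    from integral_reflect_unit(2)[OF this] have "integral {0..t} vr = integral {1 - t..1} v"
      by (simp add: vr_def [abs_def])
    then show ?thesis
      using path_from_diff[OF vi, of "1 - t" 1 c] that by simp
  qed
  have sub: "v integrable_on {0..t}" "vr integrable_on {0..t}" if "t \<in> {0..1}" for t
    using that by (auto intro: integrable_subinterval_real[OF vi] integrable_subinterval_real[OF vri])
  have w_path: "path_from (d 0) w t = d t" if t: "t \<in> {0..1}" for t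
  proof -
    have "integral {0..t} w = 1/2 * integral {0..t} v + 1/2 * integral {0..t} vr"
    proof -
      have int: "(\<lambda>s. 1/2 * v s) integrable_on {0..t}" "(\<lambda>s. 1/2 * vr s) integrable_on {0..t}"
        by (intro integrable_on_mult_right sub[OF t])+
      show ?thesis
        unfolding w_def Henstock_Kurzweil_Integration.integral_add[OF int] integral_mult_right ..
    qed
    then show ?thesis
      unfolding vr_path[OF t] by (simp add: path_from_def d_def field_simps)
  qed
  have g_path: "integral {0..t} g = m t - m 0" if t: "t \<in> {0..1}" for t
  proof -
    have "integral {0..t} g = 1/2 * integral {0..t} v + (- 1/2) * integral {0..t} vr"
    proof -
      have int: "(\<lambda>s. 1/2 * v s) integrable_on {0..t}" "(\<lambda>s. (- 1/2) * vr s) integrable_on {0..t}"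
        by (intro integrable_on_mult_right sub[OF t])+
      show ?thesis
        unfolding g_def Henstock_Kurzweil_Integration.integral_add[OF int] integral_mult_right ..
    qed
    then show ?thesis
      unfolding vr_path[OF t] by (simp add: path_from_def m_def field_simps)
  qed
  have d_refl: "d (1 - t) = - d t" for t by (simp add: d_def field_simps)
  have cont: "continuous_on {0..1} d" "continuous_on {0..1} m"
    unfolding d_def m_def by (intro continuous_intros phi_continuous continuous_on_reflect; simp)+
  have d_range: "\<bar>d t\<bar> \<le> pi / 2" if "t \<in> {0..1}" for t
    using range[of t] range[of "1 - t"] that unfolding d_def by auto
  have d_le: "d s \<le> d t" if "0 \<le> s" "s \<le> t" "t \<le> 1" for s t
    using phi_mono[of s t] phi_mono[of "1 - t" "1 - s"] that by (simp add: d_def)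
  have d_left: "d t \<le> 0" if "t \<in> {0..1}" "t \<le> 1/2" for t
    using phi_mono[of t "1 - t"] that by (simp add: d_def)
  define S where "S t = u t * (sin (d t) / 2)" for t
  have S_int: "S integrable_on {0..1}"
    unfolding S_def by (intro mult_integrable continuous_intros cont) auto
  have Sm_int: "(\<lambda>t. u t * (sin (d t) * cos (m t) / 2)) integrable_on {0..1}"
    by (intro mult_integrable continuous_intros cont) auto
  \<comment> \<open>Monotonicity of \<phi> makes \<open>d\<close> nonpositive before 1/2 and
    nonnegative after it, just as u is; the bound \<pi>/2 passes this sign on to sin
    \<open>d\<close>.\<close>
  have S_nonneg: "0 \<le> S t" if t: "t \<in> {0..1}" for t
  proof (cases "t \<le> 1/2")
    case True
    have "0 \<le> sin (- d t)"
      using d_range[OF t] d_left[OF t True] by (intro sin_ge_zero) (auto simp: abs_le_iff)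
    then show ?thesis using sign(1)[OF t True] by (simp add: S_def mult_nonpos_nonpos)
  next
    case False
    have "0 \<le> d t" using d_left[of "1 - t"] d_refl[of t] t False by simp
    then have "0 \<le> sin (d t)"
      using d_range[OF t] by (intro sin_ge_zero) (auto simp: abs_le_iff)
    then show ?thesis using sign(2)[OF t] False by (simp add: S_def)
  qed
  have A1: "action lam u c v = lam * integral {0..1} (\<lambda>t. (v t)\<^sup>2) - integral {0..1} (\<lambda>t. u t * (sin (d t) * cos (m t) / 2))"
    unfolding action_antisymmetrize[OF v] d_def m_def ..
  have A2: "action lam u (d 0) w = lam * integral {0..1} (\<lambda>t. (w t)\<^sup>2) - integral {0..1} S"
  proof -
    have "integral {0..1} (\<lambda>t. u t * (sin ((path_from (d 0) w t - path_from (d 0) w (1 - t)) / 2) *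
        cos ((path_from (d 0) w t + path_from (d 0) w (1 - t)) / 2) / 2)) = integral {0..1} S"
      by (rule integral_cong) (simp add: w_path d_refl S_def)
    then show ?thesis unfolding action_antisymmetrize[OF w] by simp
  qed
  have w2: "(\<lambda>t. (w t)\<^sup>2) integrable_on {0..1}" and g2: "(\<lambda>t. (g t)\<^sup>2) integrable_on {0..1}"
    using w g by (auto simp: square_integrable_def)
  \<comment> \<open>Parallelogram law: the energy of \<phi> is the sum of the energies of its odd
    and even parts.\<close>
  have "integral {0..1} (\<lambda>t. (w t)\<^sup>2) + integral {0..1} (\<lambda>t. (g t)\<^sup>2) =
      integral {0..1} (\<lambda>t. 1/2 * (v t)\<^sup>2 + 1/2 * (vr t)\<^sup>2)"
    unfolding Henstock_Kurzweil_Integration.integral_add[OF w2 g2, symmetric]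
    by (intro integral_cong) (simp add: w_def g_def power2_eq_square field_simps)
  also have "\<dots> = integral {0..1} (\<lambda>t. (v t)\<^sup>2)"
    using v2 vr2 by (subst Henstock_Kurzweil_Integration.integral_add) (auto intro: integrable_on_mult_right)
  finally have parallelogram: "integral {0..1} (\<lambda>t. (v t)\<^sup>2) = integral {0..1} (\<lambda>t. (w t)\<^sup>2) + integral {0..1} (\<lambda>t. (g t)\<^sup>2)"
    by simp
  have T_int: "(\<lambda>t. S t * (1 - cos (m t))) integrable_on {0..1}"
    by (rule integrable_eq[OF integrable_diff[OF S_int Sm_int]]) (simp add: S_def field_simps)
  have T_nonneg: "0 \<le> S t * (1 - cos (m t))" if "t \<in> {0..1}" for t
    using S_nonneg[OF that] by (intro mult_nonneg_nonneg) auto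
  have T: "integral {0..1} S - integral {0..1} (\<lambda>t. u t * (sin (d t) * cos (m t) / 2)) =
      integral {0..1} (\<lambda>t. S t * (1 - cos (m t)))"
    unfolding Henstock_Kurzweil_Integration.integral_diff[OF S_int Sm_int, symmetric]
    by (intro integral_cong) (simp add: S_def field_simps)
  have both_zero: "a = 0 \<and> b = 0" if "lam * a + b \<le> 0" "0 \<le> a" "0 \<le> b" for a b
  proof -
    have "0 \<le> lam * a" using lam that(2) by simp
    then have "lam * a = 0" "b = 0" using that by linarith+
    then show ?thesis using lam by simp
  qed
  \<comment> \<open>Minimality against the odd part. The excess is the energy of \<open>m\<close>
    plus the loss caused by the factor cos \<open>m\<close>; both are nonnegative, so both
    vanish.\<close>
  have "lam * integral {0..1} (\<lambda>t. (g t)\<^sup>2) + integral {0..1} (\<lambda>t. S t * (1 - cos (m t))) \<le> 0"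
    using minimal[OF w, of "d 0"] unfolding A1 A2 parallelogram T[symmetric] by (simp add: algebra_simps)
  moreover have "0 \<le> integral {0..1} (\<lambda>t. (g t)\<^sup>2)"
    by (intro integral_nonneg g2) auto
  moreover have "0 \<le> integral {0..1} (\<lambda>t. S t * (1 - cos (m t)))"
    by (intro integral_nonneg T_int T_nonneg)
  ultimately have g0: "integral {0..1} (\<lambda>t. (g t)\<^sup>2) = 0" and T0: "integral {0..1} (\<lambda>t. S t * (1 - cos (m t))) = 0"
    using both_zero by blast+
  have m_const: "m t = m 0" if t: "t \<in> {0..1}" for t
  proof -
    \<comment> \<open>Young's inequality with an arbitrary e takes the place of Cauchy-Schwarz: the
      integral of g^2 is 0, so only the term in e is left.\<close>
    have "\<bar>integral {0..t} g\<bar> \<le> e" if "0 < e" for e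
    proof -
      have g2t: "(\<lambda>s. (g s)\<^sup>2) integrable_on {0..t}"
        by (rule integrable_subinterval_real[OF g2]) (use t in auto)
      have "norm (integral {0..t} g) \<le> integral {0..t} (\<lambda>s. inverse e * (g s)\<^sup>2 + e)"
      proof (rule integral_norm_bound_integral)
        show "g integrable_on {0..t}"
          by (rule integrable_subinterval_real[OF gi]) (use t in auto)
        show "(\<lambda>s. inverse e * (g s)\<^sup>2 + e) integrable_on {0..t}"
          using g2t by (intro integrable_add integrable_on_mult_right) auto
        fix s
        have "0 \<le> (\<bar>g s\<bar> - e)\<^sup>2 / e + \<bar>g s\<bar>" using that by simp
        also have "\<dots> = inverse e * (g s)\<^sup>2 + e - \<bar>g s\<bar>"
          using that by (simp add: power2_diff field_simps power2_eq_square)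
        finally show "norm (g s) \<le> inverse e * (g s)\<^sup>2 + e" by simp
      qed
      also have "\<dots> = inverse e * integral {0..t} (\<lambda>s. (g s)\<^sup>2) + e * t"
        using g2t t by (subst Henstock_Kurzweil_Integration.integral_add) (auto intro: integrable_on_mult_right)
      also have "integral {0..t} (\<lambda>s. (g s)\<^sup>2) \<le> integral {0..1} (\<lambda>s. (g s)\<^sup>2)"
        using t by (intro integral_subset_le g2t g2) auto
      then have "inverse e * integral {0..t} (\<lambda>s. (g s)\<^sup>2) + e * t \<le> inverse e * 0 + e * 1"
        unfolding g0 using t that by (intro add_mono mult_left_mono) auto
      finally show ?thesis by simp
    qed
    then have "\<bar>integral {0..t} g\<bar> \<le> 0" by (rule field_le_epsilon) simp
    then show ?thesis using g_path[OF t] by simp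
  qed
  \<comment> \<open>A nonzero constant \<open>m\<close> would have cos \<open>m\<close> < 1 and
    force the integral of \<open>S\<close> to be 0. As u < 0 on the left and \<open>d\<close> is
    monotone, \<open>d\<close> would vanish, leaving an action of at least 0, contrary to
    \<open>exists_negative_action\<close>.\<close>
  have "m 0 = 0"
  proof (rule ccontr)
    assume "m 0 \<noteq> 0"
    moreover have "\<bar>m 0\<bar> \<le> pi / 2"
      using range[of 0] range[of 1] unfolding m_def by auto
    ultimately have "cos \<bar>m 0\<bar> < cos 0"
      using pi_gt_zero by (intro cos_monotone_0_pi) linarith+
    then have cm: "0 < 1 - cos (m 0)" by simp
    have "integral {0..1} (\<lambda>t. S t * (1 - cos (m t))) = integral {0..1} (\<lambda>t. S t * (1 - cos (m 0)))"
    proof (rule integral_cong)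
      fix t :: real assume "t \<in> {0..1}"
      from m_const[OF this] show "S t * (1 - cos (m t)) = S t * (1 - cos (m 0))"
        by (rule arg_cong)
    qed
    then have S0: "integral {0..1} S = 0"
      using T0 cm by simp
    have d0: "d t = 0" if t: "t \<in> {0<..<1/2}" for t
    proof (rule ccontr)
      assume "d t \<noteq> 0"
      then have "d t < 0" using d_left[of t] t by simp
      have S_sub: "S integrable_on {0..t}"
        by (rule integrable_subinterval_real[OF S_int]) (use t in auto)
      have "0 < integral {0..t} S"
      proof (rule integral_strictly_positive[OF _ S_sub])
        fix s assume s: "s \<in> {0<..<t}"
        then have "d s < 0" using d_le[of s t] \<open>d t < 0\<close> t by simp
        then have "0 < sin (- d s)"
          using d_range[of s] s t pi_gt_zero by (intro sin_gt_zero) (auto simp: abs_le_iff)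
        then show "0 < S s"
          using negative[of s] s t by (auto simp: S_def intro!: mult_neg_neg)
      qed (use t in auto)
      also have "\<dots> \<le> integral {0..1} S"
        using t S_nonneg by (intro integral_subset_le S_sub S_int) auto
      finally show False using S0 by simp
    qed
    have d0': "d t = 0" if t: "t \<in> {0<..<1}" for t
    proof -
      consider "t < 1/2" | "t = 1 - t" | "1/2 < t" by linarith
      then show ?thesis
      proof cases
        case 2
        then show ?thesis using d_refl[of t] by (metis neg_equal_zero)
      qed (use d0[of t] d0[of "1 - t"] d_refl[of t] t in auto)
    qed
    have "integral {0..1} (\<lambda>t. u t * (sin (d t) * cos (m t) / 2)) = integral {0..1 :: real} (\<lambda>t. 0)"
      by (rule integral_spike[of "{0, 1 :: real}"]) (auto simp: d0')
    then have "0 \<le> action lam u c v"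
      unfolding A1 using lam integral_nonneg[OF v2] by simp
    moreover obtain c' v' where "square_integrable v'" "action lam u c' v' < 0"
      using exists_negative_action[OF lam] by blast
    ultimately show False using minimal[of v' c'] by simp
  qed
  then show ?thesis using m_const[OF t] by (simp add: m_def)
qed

end

end

section \<open>Comparison of minimizers\<close>

context antisymmetric_utility
begin

text \<open>The velocity of an extremal in closed form: the equation integrated once from 0, where
  the free end gives slope 0. Being an explicit integral, it has a meaning at every point even if u
  jumps.\<close>

definition slope :: "real \<Rightarrow> (real \<Rightarrow> real) \<Rightarrow> real \<Rightarrow> real" where
  "slope lam \<phi> x = - integral {0..x} (\<lambda>t. u t * cos (\<phi> t)) / (4 * lam)"

definition extremal :: "real \<Rightarrow> (real \<Rightarrow> real) \<Rightarrow> bool" where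
  "extremal lam \<phi> \<longleftrightarrow> 0 < lam \<and> (\<forall>x\<in>{0..1}. (\<phi> has_real_derivative slope lam \<phi> x) (at x within {0..1})) \<and>
    (\<forall>t\<in>{0..1}. \<phi> (1 - t) = - \<phi> t \<and> \<bar>\<phi> t\<bar> \<le> pi / 2) \<and> mono_on {0..1} \<phi>"

text \<open>Every pair (c', w) gives a feasible function with objective at most its action, while at
  \<open>p\<close> objective and action agree; so the angle of \<open>p\<close> minimizes the action
  among all pairs.\<close>

lemma optimal_solution_extremal:
  assumes opt: "optimal_solution lam u p" and lam: "0 < lam"
  obtains \<phi> where "extremal lam \<phi>" "\<And>t. t \<in> {0..1} \<Longrightarrow> p t = (1 + sin (\<phi> t)) / 2"
proof -
  have feas: "feasible p" and fin: "\<bar>objective lam u p\<bar> \<noteq> \<infinity>"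
    and best: "\<And>q. feasible q \<Longrightarrow> objective lam u p \<le> objective lam u q"
    using opt by (auto simp: optimal_solution_def)
  obtain c v where v: "square_integrable v"
    and path: "\<And>t. t \<in> {0..1} \<Longrightarrow> path_from c v t = arcsin (2 * p t - 1)"
    and obj: "objective lam u p = ereal (action lam u c v)"
    using objective_eq_action[OF measurable bounded lam feas fin] by metis
  have minimal: "action lam u c v \<le> action lam u c' w" if w: "square_integrable w" for c' w
  proof -
    have "objective lam u p \<le> ereal (action lam u c' w)"
      using best objective_sin_path_le[OF measurable bounded w lam, of c'] order_trans by blast
    then show ?thesis by (simp add: obj)
  qed
  have p01: "- 1 \<le> 2 * p t - 1 \<and> 2 * p t - 1 \<le> 1" if "t \<in> {0..1}" for t
    using feas that by (auto simp: feasible_def image_subset_iff)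
  have range: "\<bar>path_from c v t\<bar> \<le> pi / 2" if "t \<in> {0..1}" for t
    using arcsin[of "2 * p t - 1"] p01[OF that] path[OF that] by auto
  show thesis
  proof
    show "extremal lam (path_from c v)"
      unfolding extremal_def slope_def
      using lam range phi_derivative(1)[OF lam v minimal range] phi_odd[OF lam v minimal range]
        phi_mono[OF lam v minimal range] by (auto intro!: mono_onI)
    show "p t = (1 + sin (path_from c v t)) / 2" if "t \<in> {0..1}" for t
      using sin_arcsin[of "2 * p t - 1"] p01[OF that] path[OF that] by simp
  qed
qed

lemma extremalD:
  assumes "extremal lam \<phi>"
  shows "0 < lam" "x \<in> {0..1} \<Longrightarrow> (\<phi> has_real_derivative slope lam \<phi> x) (at x within {0..1})"
    "t \<in> {0..1} \<Longrightarrow> \<phi> (1 - t) = - \<phi> t" "t \<in> {0..1} \<Longrightarrow> \<bar>\<phi> t\<bar> \<le> pi / 2"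
    "0 \<le> s \<Longrightarrow> s \<le> t \<Longrightarrow> t \<le> 1 \<Longrightarrow> \<phi> s \<le> \<phi> t"
  using assms mono_onD[of "{0..1}" \<phi> s t] unfolding extremal_def by auto

lemma extremal_derivative_interior:
  assumes "extremal lam \<phi>" "0 < x" "x < 1"
  shows "(\<phi> has_real_derivative slope lam \<phi> x) (at x)"
  using extremalD(2)[OF assms(1), of x] assms(2,3) by (simp add: at_within_Icc_at)

lemma extremal_continuous:
  assumes "extremal lam \<phi>"
  shows "continuous_on {0..1} \<phi>"
  using extremalD(2)[OF assms] DERIV_continuous_on by blast

lemma extremal_half:
  assumes "extremal lam \<phi>"
  shows "\<phi> (1/2) = 0"
  using extremalD(3)[OF assms, of "1/2"] by simp

section \<open>Strict bounds for one extremal\<close>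

lemma force_sub_integrable:
  assumes "continuous_on {0..1} g" "0 \<le> a" "b \<le> 1"
  shows "(\<lambda>t. u t * g t) integrable_on {a..b}"
  by (rule integrable_subinterval_real[OF mult_integrable[OF assms(1)]]) (use assms in auto)

text \<open>If \<open>\<phi> 0 = - \<pi>/2\<close>, then \<open>w = \<phi> + \<pi>/2\<close> satisfies \<open>w' \<le> C w\<close> and \<open>w 0 = 0\<close>, so \<open>w\<close> vanishes.\<close>

lemma extremal_gt_left:
  assumes ext: "extremal lam \<phi>"
  shows "- (pi / 2) < \<phi> 0"
proof (rule ccontr)
  assume "\<not> - (pi / 2) < \<phi> 0"
  then have \<phi>0: "\<phi> 0 = - (pi / 2)" using extremalD(4)[OF ext, of 0] by auto
  have lam: "0 < lam" using extremalD(1)[OF ext] .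
  obtain B where B: "\<And>t. t \<in> {0..1} \<Longrightarrow> \<bar>u t\<bar> \<le> B"
    using bounded unfolding bounded_iff by (metis image_eqI real_norm_def)
  have "0 \<le> B" using B[of 0] by simp
  \<comment> \<open>Since cos \<phi> = sin w <= w, w is nondecreasing and |u| <= B, the velocity at
    t is at most B / (4 lam) times w t.\<close>
  define C where "C = B / (4 * lam)"
  have "0 \<le> C" using \<open>0 \<le> B\<close> lam by (simp add: C_def)
  define w where "w t = \<phi> t + pi / 2" for t
  have w_nonneg: "0 \<le> w t" if "t \<in> {0..1}" for t
    using extremalD(4)[OF ext that] by (auto simp: w_def abs_le_iff)
  have cos_le: "0 \<le> cos (\<phi> t) \<and> cos (\<phi> t) \<le> w t" if "t \<in> {0..1}" for t
  proof -
    have "cos (\<phi> t) = sin (w t)" by (simp add: w_def sin_add)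
    moreover have "0 \<le> cos (\<phi> t)"
      using extremalD(4)[OF ext that] by (intro cos_ge_zero) (auto simp: abs_le_iff)
    ultimately show ?thesis
      using sin_x_le_x[OF w_nonneg[OF that]] by simp
  qed
  have slope: "slope lam \<phi> t \<le> C * w t" if t: "t \<in> {0..1}" for t
  proof -
    have int: "(\<lambda>s. u s * cos (\<phi> s)) integrable_on {0..t}"
      using t by (intro force_sub_integrable continuous_intros extremal_continuous[OF ext]) auto
    have "- integral {0..t} (\<lambda>s. u s * cos (\<phi> s)) = integral {0..t} (\<lambda>s. - (u s * cos (\<phi> s)))"
      by simp
    also have "\<dots> \<le> integral {0..t} (\<lambda>s. B * w t)"
    proof (intro integral_le integrable_neg int)
      fix s assume s: "s \<in> {0..t}"
      then have s1: "s \<in> {0..1}" using t by auto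
      have "- (u s * cos (\<phi> s)) \<le> \<bar>u s\<bar> * \<bar>cos (\<phi> s)\<bar>"
        by (metis abs_ge_minus_self abs_mult)
      also have "\<dots> \<le> B * w s"
        using B[OF s1] cos_le[OF s1] \<open>0 \<le> B\<close> by (intro mult_mono) auto
      also have "\<dots> \<le> B * w t"
        using extremalD(5)[OF ext, of s t] s t \<open>0 \<le> B\<close> by (intro mult_left_mono) (auto simp: w_def)
      finally show "- (u s * cos (\<phi> s)) \<le> B * w t" .
    qed auto
    also have "\<dots> = t * (B * w t)" using t by simp
    also have "\<dots> \<le> 1 * (B * w t)"
      using t \<open>0 \<le> B\<close> w_nonneg[OF t] by (intro mult_right_mono) auto
    finally have "- integral {0..t} (\<lambda>s. u s * cos (\<phi> s)) / (4 * lam) \<le> 1 * (B * w t) / (4 * lam)"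
      using lam by (intro divide_right_mono) auto
    then show ?thesis by (simp add: slope_def C_def)
  qed
  \<comment> \<open>Gronwall: w exp (- C t) is nonincreasing from the value 0, yet w (1/2) =
    \<pi>/2.\<close>
  have "w (1/2) * exp (- C * (1/2)) \<le> w 0 * exp (- C * 0)"
  proof (rule DERIV_nonpos_imp_decreasing_open[of 0 "1/2" "\<lambda>t. w t * exp (- C * t)"])
    fix x :: real assume x: "0 < x" "x < 1/2"
    have "(w has_real_derivative slope lam \<phi> x) (at x)"
      unfolding w_def using extremal_derivative_interior[OF ext, of x] x by (auto intro!: derivative_eq_intros)
    then have "((\<lambda>t. w t * exp (- C * t)) has_real_derivative (slope lam \<phi> x - C * w x) * exp (- C * x)) (at x)"
      by (auto intro!: derivative_eq_intros simp: algebra_simps)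
    moreover have "(slope lam \<phi> x - C * w x) * exp (- C * x) \<le> 0"
      using slope[of x] x by (intro mult_nonpos_nonneg) auto
    ultimately show "\<exists>y. ((\<lambda>t. w t * exp (- C * t)) has_real_derivative y) (at x) \<and> y \<le> 0"
      by blast
  next
    show "continuous_on {0..1/2} (\<lambda>t. w t * exp (- C * t))"
      unfolding w_def
      by (intro continuous_intros continuous_on_subset[OF extremal_continuous[OF ext]]) auto
  qed simp
  then show False
    using extremal_half[OF ext] \<phi>0 pi_gt_zero by (simp add: w_def mult_le_0_iff not_le)
qed

lemma extremal_left_half:
  assumes ext: "extremal lam \<phi>" and t: "t \<in> {0..1/2}"
  shows "- (pi / 2) < \<phi> t" "\<phi> t \<le> 0" "0 < cos (\<phi> t)"
proof -
  show 1: "- (pi / 2) < \<phi> t"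
    using extremal_gt_left[OF ext] extremalD(5)[OF ext, of 0 t] t by simp
  show 2: "\<phi> t \<le> 0"
    using extremal_half[OF ext] extremalD(5)[OF ext, of t "1/2"] t by simp
  show "0 < cos (\<phi> t)"
    using 1 2 pi_gt_zero by (intro cos_gt_zero_pi) linarith+
qed

lemma integral_force_neg:
  assumes ab: "0 \<le> a" "a < b" "b \<le> 1/2" and g: "continuous_on {0..1} g"
    and pos: "\<And>t. a < t \<Longrightarrow> t < b \<Longrightarrow> 0 < g t"
  shows "integral {a..b} (\<lambda>t. u t * g t) < 0"
proof -
  have "(\<lambda>t. - (u t * g t)) integrable_on {a..b}"
    using ab by (intro integrable_neg force_sub_integrable g) auto
  then have "0 < integral {a..b} (\<lambda>t. - (u t * g t))"
  proof (rule integral_strictly_positive[OF ab(2)])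
    fix t assume "t \<in> {a<..<b}"
    then show "0 < - (u t * g t)"
      using negative[of t] pos[of t] ab by (simp add: mult_neg_pos)
  qed
  then show ?thesis by simp
qed

lemma slope_pos:
  assumes ext: "extremal lam \<phi>" and x: "0 < x" "x \<le> 1/2"
  shows "0 < slope lam \<phi> x"
proof -
  have "integral {0..x} (\<lambda>t. u t * cos (\<phi> t)) < 0"
    using x extremal_left_half(3)[OF ext]
    by (intro integral_force_neg continuous_intros extremal_continuous[OF ext]) auto
  then show ?thesis
    using extremalD(1)[OF ext] by (simp add: slope_def divide_neg_pos)
qed

lemma extremal_neg:
  assumes ext: "extremal lam \<phi>" and t: "t \<in> {0..<1/2}"
  shows "\<phi> t < 0"
proof -
  have "\<phi> t < \<phi> (1/2)"
  proof (rule DERIV_pos_imp_increasing_open[of t "1/2" \<phi>])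
    show "t < 1/2" using t by simp
    show "\<exists>y. (\<phi> has_real_derivative y) (at x) \<and> 0 < y" if "t < x" "x < 1/2" for x
      using extremal_derivative_interior[OF ext, of x] slope_pos[OF ext, of x] that t by auto
    show "continuous_on {t..1/2} \<phi>"
      by (rule continuous_on_subset[OF extremal_continuous[OF ext]]) (use t in auto)
  qed
  then show ?thesis using extremal_half[OF ext] by simp
qed

section \<open>Difference of two extremals\<close>

context
  fixes lam1 lam2 :: real and \<phi>1 \<phi>2 :: "real \<Rightarrow> real"
  assumes ext1: "extremal lam1 \<phi>1" and ext2: "extremal lam2 \<phi>2" and less: "lam1 < lam2"
begin

definition gap :: "real \<Rightarrow> real" where
  "gap t = \<phi>1 t - \<phi>2 t"

text \<open>Formally gap'' = - u gap_force, so on [0, 1/2), where u < 0, the sign of this factor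
  decides convexity.\<close>

definition gap_force :: "real \<Rightarrow> real" where
  "gap_force t = cos (\<phi>1 t) / (4 * lam1) - cos (\<phi>2 t) / (4 * lam2)"

definition gap_slope :: "real \<Rightarrow> real" where
  "gap_slope x = slope lam1 \<phi>1 x - slope lam2 \<phi>2 x"

lemma lam_pos: "0 < lam1" "0 < lam2"
  using extremalD(1) ext1 ext2 by blast+

lemma gap_continuous: "continuous_on {0..1} gap"
  unfolding gap_def by (intro continuous_intros extremal_continuous[OF ext1] extremal_continuous[OF ext2])

lemma gap_force_continuous: "continuous_on {0..1} gap_force"
  unfolding gap_force_def using lam_pos
  by (intro continuous_intros extremal_continuous[OF ext1] extremal_continuous[OF ext2]) auto

lemma gap_derivative: "0 < x \<Longrightarrow> x < 1 \<Longrightarrow> (gap has_real_derivative gap_slope x) (at x)"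
  unfolding gap_def gap_slope_def
  by (intro DERIV_diff extremal_derivative_interior ext1 ext2)

lemma gap_slope_eq:
  assumes "x \<in> {0..1}"
  shows "gap_slope x = - integral {0..x} (\<lambda>t. u t * gap_force t)"
proof -
  have int: "(\<lambda>t. u t * cos (\<phi>1 t)) integrable_on {0..x}" "(\<lambda>t. u t * cos (\<phi>2 t)) integrable_on {0..x}"
    using assms by (intro force_sub_integrable continuous_intros extremal_continuous[OF ext1] extremal_continuous[OF ext2]; simp)+
  have "integral {0..x} (\<lambda>t. u t * gap_force t) =
      integral {0..x} (\<lambda>t. u t * cos (\<phi>1 t) / (4 * lam1) - u t * cos (\<phi>2 t) / (4 * lam2))"
    by (intro integral_cong) (simp add: gap_force_def algebra_simps)
  also have "\<dots> = integral {0..x} (\<lambda>t. u t * cos (\<phi>1 t)) / (4 * lam1) - integral {0..x} (\<lambda>t. u t * cos (\<phi>2 t)) / (4 * lam2)"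
    using int by (subst Henstock_Kurzweil_Integration.integral_diff) (auto intro: integrable_on_divide)
  finally show ?thesis by (simp add: gap_slope_def slope_def)
qed

text \<open>Strict convexity is expressed as strict growth of the slope, since u may jump and a
  second derivative may fail to exist.\<close>

lemma gap_slope_less:
  assumes xy: "0 \<le> x" "x < y" "y \<le> 1/2" and pos: "\<And>t. x < t \<Longrightarrow> t < y \<Longrightarrow> 0 < gap_force t"
  shows "gap_slope x < gap_slope y"
proof -
  have "integral {0..x} (\<lambda>t. u t * gap_force t) + integral {x..y} (\<lambda>t. u t * gap_force t) =
      integral {0..y} (\<lambda>t. u t * gap_force t)"
    using xy by (intro Henstock_Kurzweil_Integration.integral_combine force_sub_integrable gap_force_continuous) auto
  moreover have "integral {x..y} (\<lambda>t. u t * gap_force t) < 0"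
    using xy pos by (intro integral_force_neg gap_force_continuous) auto
  ultimately show ?thesis
    using gap_slope_eq[of x] gap_slope_eq[of y] xy by simp
qed

text \<open>On [-\<pi>/2, 0] the cosine increases, so gap >= 0 gives cos \<phi>1 >= cos \<phi>2 > 0;
  the smaller \<open>lam1\<close> makes the inequality strict, also when gap = 0.\<close>

lemma gap_force_pos:
  assumes t: "t \<in> {0..1/2}" and "0 \<le> gap t"
  shows "0 < gap_force t"
proof -
  have "cos (\<phi>2 t) / (4 * lam2) < cos (\<phi>2 t) / (4 * lam1)"
    using extremal_left_half(3)[OF ext2 t] lam_pos less by (intro divide_strict_left_mono) auto
  also have "cos (\<phi>2 t) \<le> cos (\<phi>1 t)"
    using extremal_left_half[OF ext1 t] extremal_left_half[OF ext2 t] \<open>0 \<le> gap t\<close> pi_gt_zero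
    by (intro cos_monotone_minus_pi_0') (auto simp: gap_def)
  then have "cos (\<phi>2 t) / (4 * lam1) \<le> cos (\<phi>1 t) / (4 * lam1)"
    using lam_pos by (intro divide_right_mono) auto
  finally show ?thesis by (simp add: gap_force_def)
qed

text \<open>Convexity is wanted on an interval, while gap >= 0 is known at one point; the strict
  inequality there persists nearby by continuity.\<close>

lemma gap_force_pos_near:
  assumes t: "t \<in> {0..1/2}" and "0 \<le> gap t"
  obtains e where "0 < e" "\<And>s. s \<in> {0..1} \<Longrightarrow> \<bar>s - t\<bar> < e \<Longrightarrow> 0 < gap_force s"
proof -
  have pos: "0 < gap_force t" by (rule gap_force_pos[OF assms])
  moreover have "t \<in> {0..1}" using t by auto
  ultimately obtain e where e: "0 < e" "\<And>s. s \<in> {0..1} \<Longrightarrow> dist s t < e \<Longrightarrow> dist (gap_force s) (gap_force t) < gap_force t"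
    using gap_force_continuous unfolding continuous_on_iff by metis
  show thesis
  proof (rule that[OF e(1)])
    fix s assume "s \<in> {0..1}" "\<bar>s - t\<bar> < e"
    then show "0 < gap_force s"
      using e(2)[of s] by (auto simp: dist_real_def)
  qed
qed

text \<open>Where \<open>\<phi>\<^sub>1 \<ge> \<phi>\<^sub>2\<close> the difference is strictly convex, so it has no nonnegative maximum on \<open>[0, 1/2)\<close>.\<close>

lemma gap_neg:
  assumes t: "t \<in> {0..<1/2}"
  shows "gap t < 0"
proof (rule ccontr)
  assume "\<not> gap t < 0"
  then have gt: "0 \<le> gap t" by simp
  have cont: "continuous_on {0..1/2} gap"
    by (rule continuous_on_subset[OF gap_continuous]) auto
  obtain m where m: "m \<in> {0..1/2}" "\<And>s. s \<in> {0..1/2} \<Longrightarrow> gap s \<le> gap m"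
    using continuous_attains_sup[OF compact_Icc _ cont] by auto
  have half: "gap (1/2) = 0"
    by (simp only: gap_def extremal_half[OF ext1] extremal_half[OF ext2])
  \<comment> \<open>A maximizer different from 1/2: if the maximum is at 1/2, its value is 0, which
    \<open>t\<close> attains as well.\<close>
  define z where "z = (if m = 1/2 then t else m)"
  have z: "z \<in> {0..<1/2}" using m(1) t by (auto simp: z_def)
  have z_max: "gap s \<le> gap z" if "s \<in> {0..1/2}" for s
  proof (cases "m = 1/2")
    case True
    then have "gap m = 0" using half by (simp only:)
    then show ?thesis using m(2)[OF that] gt True by (simp add: z_def)
  qed (use m(2)[OF that] in \<open>simp add: z_def\<close>)
  have gz: "0 \<le> gap z" using z_max[of t] gt t by simp
  \<comment> \<open>At 0 the slope vanishes by the free end, inside the interval by the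
    maximum.\<close>
  have slope0: "gap_slope z = 0"
  proof (cases "z = 0")
    case True
    then show ?thesis using gap_slope_eq[of 0] by simp
  next
    case False
    then have d: "0 < min z (1/2 - z)" using z by auto
    have der: "(gap has_real_derivative gap_slope z) (at z)"
      using gap_derivative[of z] False z by simp
    have "\<forall>y. \<bar>z - y\<bar> < min z (1/2 - z) \<longrightarrow> gap y \<le> gap z"
      using z by (auto intro!: z_max simp: abs_if split: if_splits)
    then show ?thesis by (rule DERIV_local_max[OF der d])
  qed
  obtain e where e: "0 < e" "\<And>s. s \<in> {0..1} \<Longrightarrow> \<bar>s - z\<bar> < e \<Longrightarrow> 0 < gap_force s"
    using gap_force_pos_near[of z] z gz by auto
  define b where "b = min (z + e) (1/2)"
  have "z < b"
    unfolding b_def min_less_iff_conj using z e(1) by auto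
  moreover have "b \<le> 1/2"
    unfolding b_def by (rule min.cobounded2)
  ultimately have b: "z < b" "b \<le> 1/2" .
  \<comment> \<open>From slope 0 at \<open>z\<close> the slope becomes positive to the right, which
    contradicts the maximum.\<close>
  have "gap z < gap b"
  proof (rule DERIV_pos_imp_increasing_open[OF b(1)])
    fix x assume x: "z < x" "x < b"
    have "gap_slope z < gap_slope x"
    proof (rule gap_slope_less)
      show "0 < gap_force s" if "z < s" "s < x" for s
        using e(2)[of s] that x z b by (auto simp: b_def)
    qed (use x z b in auto)
    then show "\<exists>y. (gap has_real_derivative y) (at x) \<and> 0 < y"
      using gap_derivative[of x] x z b slope0 by (auto intro!: exI[of _ "gap_slope x"])
  next
    show "continuous_on {z..b} gap"
      by (rule continuous_on_subset[OF cont]) (use z b in auto)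
  qed
  then show False using z_max[of b] z b by simp
qed

text \<open>A Hopf-type argument at 1/2, where gap = 0: just before 1/2 the slope is strictly
  increasing, so a nonpositive slope at 1/2 would make gap decrease to 0 and be positive on the
  left, against \<open>gap_neg\<close>.\<close>

lemma gap_slope_half_pos: "0 < gap_slope (1/2)"
proof (rule ccontr)
  assume neg: "\<not> 0 < gap_slope (1/2)"
  have half: "gap (1/2) = 0"
    by (simp only: gap_def extremal_half[OF ext1] extremal_half[OF ext2])
  obtain e where e: "0 < e" "\<And>s. s \<in> {0..1} \<Longrightarrow> \<bar>s - 1/2\<bar> < e \<Longrightarrow> 0 < gap_force s"
    using gap_force_pos_near[of "1/2"] half by auto
  define a where "a = max (1/2 - e) 0"
  have a: "0 \<le> a" "a < 1/2"
    unfolding a_def max_less_iff_conj using e(1) by auto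
  have "gap (1/2) < gap a"
  proof (rule DERIV_neg_imp_decreasing_open[OF a(2)])
    fix x assume x: "a < x" "x < 1/2"
    have "gap_slope x < gap_slope (1/2)"
    proof (rule gap_slope_less)
      show "0 < gap_force s" if "x < s" "s < 1/2" for s
        using e(2)[of s] that x a by (auto simp: a_def)
    qed (use x a in auto)
    then show "\<exists>y. (gap has_real_derivative y) (at x) \<and> y < 0"
      using gap_derivative[of x] x a neg by (auto intro!: exI[of _ "gap_slope x"])
  next
    show "continuous_on {a..1/2} gap"
      by (rule continuous_on_subset[OF gap_continuous]) (use a in auto)
  qed
  then show False using half gap_neg[of a] a by simp
qed

end

section \<open>Return from the angles to the solutions\<close>

lemma solution_derivative_half:
  assumes ext: "extremal lam \<phi>" and p: "\<And>t. t \<in> {0..1} \<Longrightarrow> p t = (1 + sin (\<phi> t)) / 2"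
  shows "(p has_real_derivative slope lam \<phi> (1/2) / 2) (at (1/2))"
proof -
  have "((\<lambda>t. (1 + sin (\<phi> t)) / 2) has_real_derivative cos (\<phi> (1/2)) * slope lam \<phi> (1/2) / 2) (at (1/2))"
    using extremal_derivative_interior[OF ext, of "1/2"] by (auto intro!: derivative_eq_intros)
  then have "((\<lambda>t. (1 + sin (\<phi> t)) / 2) has_real_derivative slope lam \<phi> (1/2) / 2) (at (1/2))"
    using extremal_half[OF ext] by simp
  then show ?thesis
    by (rule has_field_derivative_transform_within_open[where S="{0<..<1}"]) (use p in auto)
qed

end

theorem proposition4:
  fixes u p1 p2 :: "real \<Rightarrow> real" and lam1 lam2 :: real
  assumes "piecewise_continuous u"
    and "\<And>t. t \<in> {0..1} \<Longrightarrow> u t = - u (1 - t)"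
    and "\<And>t. t \<in> {0..<1/2} \<Longrightarrow> u t < 0"
    and "0 < lam1" and "lam1 < lam2"
    and "optimal_solution lam1 u p1"
    and "optimal_solution lam2 u p2"
  shows "p1 0 < p2 0 \<and> p2 0 < 1/2 \<and> 1/2 < p2 1 \<and> p2 1 < p1 1 \<and>
    p1 differentiable at (1/2) \<and> p2 differentiable at (1/2) \<and>
    0 < deriv p2 (1/2) \<and> deriv p2 (1/2) < deriv p1 (1/2) \<and>
    (\<forall>t\<in>{0..<1/2}. p1 t < p2 t \<and> p2 t < 1/2) \<and>
    (\<forall>t\<in>{1/2<..1}. 1/2 < p2 t \<and> p2 t < p1 t)"
proof -
  interpret antisymmetric_utility u
    using piecewise_continuous_bounded_measurable[OF assms(1)] assms(2,3) by unfold_locales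
  have "0 < lam2" using assms(4,5) by simp
  obtain \<phi>1 where ext1: "extremal lam1 \<phi>1" and p1: "\<And>t. t \<in> {0..1} \<Longrightarrow> p1 t = (1 + sin (\<phi>1 t)) / 2"
    using optimal_solution_extremal[OF assms(6,4)] by blast
  obtain \<phi>2 where ext2: "extremal lam2 \<phi>2" and p2: "\<And>t. t \<in> {0..1} \<Longrightarrow> p2 t = (1 + sin (\<phi>2 t)) / 2"
    using optimal_solution_extremal[OF assms(7) \<open>0 < lam2\<close>] by blast
  note gap = gap_neg[OF ext1 ext2 assms(5)] gap_slope_half_pos[OF ext1 ext2 assms(5)]
  have left: "p1 t < p2 t \<and> p2 t < 1/2" if t: "t \<in> {0..<1/2}" for t
  proof -
    have t1: "t \<in> {0..1}" "t \<in> {0..1/2}" using t by auto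
    have less: "- (pi / 2) \<le> \<phi>1 t" "\<phi>1 t < \<phi>2 t" "\<phi>2 t < 0"
      using extremal_left_half(1)[OF ext1 t1(2)] gap(1)[OF t] extremal_neg[OF ext2 t]
      by (auto simp: gap_def[OF ext1 ext2 assms(5)])
    have "sin (\<phi>1 t) < sin (\<phi>2 t)"
      using less pi_gt_zero by (intro sin_monotone_2pi) linarith+
    moreover have "sin (\<phi>2 t) < sin 0"
      using less pi_gt_zero by (intro sin_monotone_2pi) linarith+
    ultimately show ?thesis
      using p1[OF t1(1)] p2[OF t1(1)] by simp
  qed
  \<comment> \<open>Oddness of the angles is the symmetry p (1 - t) = 1 - p t, which carries the
    left half to the right.\<close>
  have refl: "p1 t = 1 - p1 (1 - t) \<and> p2 t = 1 - p2 (1 - t)" if t: "t \<in> {0..1}" for t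
  proof -
    have "1 - t \<in> {0..1}" using t by simp
    then show ?thesis
      using p1[OF t] p2[OF t] p1[of "1 - t"] p2[of "1 - t"] extremalD(3)[OF ext1 t] extremalD(3)[OF ext2 t]
      by (simp add: field_simps)
  qed
  have right: "1/2 < p2 t \<and> p2 t < p1 t" if t: "t \<in> {1/2<..1}" for t
    using left[of "1 - t"] refl[of t] t by auto
  have der1: "(p1 has_real_derivative slope lam1 \<phi>1 (1/2) / 2) (at (1/2))"
    by (rule solution_derivative_half[OF ext1]) (rule p1)
  have der2: "(p2 has_real_derivative slope lam2 \<phi>2 (1/2) / 2) (at (1/2))"
    by (rule solution_derivative_half[OF ext2]) (rule p2)
  have "0 < deriv p2 (1/2)" "deriv p2 (1/2) < deriv p1 (1/2)"
    using slope_pos[OF ext2, of "1/2"] gap(2)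
    unfolding DERIV_imp_deriv[OF der1] DERIV_imp_deriv[OF der2] gap_slope_def[OF ext1 ext2 assms(5)] by auto
  moreover have "p1 differentiable at (1/2)" "p2 differentiable at (1/2)"
    using der1 der2 by (auto simp: real_differentiable_def)
  ultimately show ?thesis
    using left right left[of 0] right[of 1] by auto
qed

end
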